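(* Let $(\ell_n)_{n\in\mathbb N}$ be a bounded sequence in $BV([0,T];\mathbb R^d)$ and, for each $n$, let $(S_n,\hat t_n,\hat z_n,\hat\ell_n)$ be a relaxed solution associated with $\ell_n$. Assume moreover that the sequence $(\|\hat\ell_n\|_{BV([0,S_n];\mathbb R^d)})_{n\in\mathbb N}$ is bounded. Then there exist a subsequence (again denoted with the index $n$) and limits $S$, $\hat t$, $\hat z$, $\hat\ell$, $\ell$ such that $$S_n\to S,\qquad \hat z_n\rightharpoonup^*\hat z\ \text{ in }W^{1,\infty}(0,S;\mathbb R^d),\qquad \hat t_n\rightharpoonup^*\hat t\ \text{ in }W^{1,\infty}(0,S),$$ $$\hat\ell_n\rightharpoonup^*\hat\ell\ \text{ in }\mathrm{BV}(0,S;\mathbb R^d),\qquad \ell_n\rightharpoonup^*\ell\ \text{ in }\mathrm{BV}(0,T;\mathbb R^d),$$ $$\hat\ell_n(s)\to\hat\ell(s)\ \text{ for all }s\in[0,S],\qquad \ell_n(t)\to\ell(t)\ \text{ for all }t\in[0,T],$$ where $\hat t_n,\hat z_n,\hat\ell_n$ are extended constantly to $[0,S]$ if $S_n<S$ (and restricted to $[0,S]$ if $S_n>S$). Furthermore, the limit $(S,\hat t,\hat z,\hat\ell)$ is a relaxed solution associated with $\ell$.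
   Context: Standing assumptions. $d\in\mathbb N$, $T>0$, $\langle\cdot,\cdot\rangle$ and $\|\cdot\|$ are the Euclidean scalar product and norm on $\mathbb R^d$. $A\in\mathbb R^{d\times d}$ is symmetric positive definite; $\mathcal F\in C^2(\mathbb R^d;\mathbb R)$, $\mathcal F\ge0$, and $\|D^2\mathcal F(z)v\|\le C(1+\|z\|^q)\|v\|$ for all $v,z\in\mathbb R^d$, for some $C>0$, $q\ge1$. Put $\mathcal E(z)=\frac12\langle Az,z\rangle+\mathcal F(z)$. $\mathcal R:\mathbb R^d\to[0,\infty)$ is proper, convex, lower semicontinuous, positively 1-homogeneous ($\mathcal R(\lambda z)=\lambda\mathcal R(z)$ for $\lambda>0$), and $c\|z\|\le\mathcal R(z)\le C\|z\|$ for all $z$ with constants $c,C>0$. The initial value $z_0\in\mathbb R^d$ is such that there is $\ell_0\in\mathbb R^d$ with $-D_z\mathcal E(z_0)+\ell_0\in\partial\mathcal R(0)$. $\partial\mathcal R(0)$ is the convex subdifferential at $0$ and $\operatorname{dist}(w,\partial\mathcal R(0))$ the Euclidean distance to it. Function spaces. $BV([0,T];\mathbb R^d)$ is the set of functions $f:[0,T]\to\mathbb R^d$ (defined everywhere) with $\mathrm{Var}(f;[0,T])<\infty$ (pointwise total variation, supremum over partitions), normed by $\|f\|_{BV([0,T];\mathbb R^d)}=\|f\|_{L^1(0,T;\mathbb R^d)}+\mathrm{Var}(f;[0,T])$. $\mathrm{BV}(0,T;\mathbb R^d)$ is the space of (classes of) $f\in L^1(0,T;\mathbb R^d)$ whose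 distributional derivative $Df$ belongs to the space $\mathfrak M(0,T;\mathbb R^d)$ of regular Borel measures. A function in $BV([0,T];\mathbb R^d)$ and its class in $\mathrm{BV}(0,T;\mathbb R^d)$ are denoted by the same symbol. $f_n\rightharpoonup^*f$ in $\mathrm{BV}(0,T;\mathbb R^d)$ means $f_n\to f$ in $L^1(0,T;\mathbb R^d)$ and $Df_n\rightharpoonup^*Df$ in $\mathfrak M(0,T;\mathbb R^d)$. $W^{1,\infty}$ functions are identified with their continuous representatives. Relaxed solution. For $\hat\ell\in BV([0,S];\mathbb R^d)$ put $\hat{\mathcal I}(s,z)=\mathcal E(z)-\langle\hat\ell(s),z\rangle$. Given $\ell\in BV([0,T];\mathbb R^d)$, a tuple $(S,\hat t,\hat z,\hat\ell)\in(0,\infty)\times W^{1,\infty}(0,S)\times W^{1,\infty}(0,S;\mathbb R^d)\times BV([0,S];\mathbb R^d)$ is a relaxed (normalized, $\mathfrak p$-parametrized BV) solution associated with $\ell$ if: (1) $\hat t(0)=0$, $\hat t(S)=T$, $\hat z(0)=z_0$; (2) for almost all $s\in(0,S)$: $\hat t'(s)\ge0$, $\hat t'(s)\operatorname{dist}(-D_z\hat{\mathcal I}(s,\hat z(s)),\partial\mathcal R(0))=0$, and $\hat t'(s)+\mathcal R(\hat z'(s))+\|\hat z'(s)\|\operatorname{dist}(-D_z\hat{\mathcal I}(s,\hat z(s)),\partial\mathcal R(0))=1$; (3) for all $s_1,s_2\in[0,S]$: $\mathcal E(\hat z(s_2))+\int_{s_1}^{s_2}\mathcal R(\hat z'(r))+\|\hat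 z'(r)\|\operatorname{dist}(-D_z\hat{\mathcal I}(r,\hat z(r)),\partial\mathcal R(0))\,dr=\mathcal E(\hat z(s_1))+\int_{s_1}^{s_2}\langle\hat\ell(r),\hat z'(r)\rangle\,dr$; (4) $\hat\ell(s)=\ell(\hat t(s))$ for almost all $s\in M$, where $M=\{s\in(0,S):\hat t(s_1)<\hat t(s_2)\text{ for all }s_1,s_2\in[0,S]\text{ with }s_1<s<s_2\}$. *)

theory Defs
  imports "HOL-Analysis.Analysis"
begin

subsection \<open>Energy and dissipation\<close>

definition grad :: "('a::real_inner \<Rightarrow> real) \<Rightarrow> 'a \<Rightarrow> 'a" where
  "grad f z = (THE g. GDERIV f z :> g)"

definition hessian :: "(real^'n \<Rightarrow> real) \<Rightarrow> real^'n \<Rightarrow> real^'n^'n" where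
  "hessian f z = jacobian (grad f) (at z)"

definition C2_function :: "(real^'n \<Rightarrow> real) \<Rightarrow> bool" where
  "C2_function f \<longleftrightarrow>
     (\<forall>z. f differentiable (at z)) \<and> (\<forall>z. grad f differentiable (at z)) \<and>
     continuous_on UNIV (hessian f)"

definition symmetric_positive_definite :: "real^'n^'n \<Rightarrow> bool" where
  "symmetric_positive_definite A \<longleftrightarrow>
     transpose A = A \<and> (\<forall>z. z \<noteq> 0 \<longrightarrow> (A *v z) \<bullet> z > 0)"

definition energy :: "real^'n^'n \<Rightarrow> (real^'n \<Rightarrow> real) \<Rightarrow> real^'n \<Rightarrow> real" where
  "energy A F z = 1/2 * ((A *v z) \<bullet> z) + F z"

definition lower_semicontinuous :: "('a::topological_space \<Rightarrow> real) \<Rightarrow> bool" where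
  "lower_semicontinuous f \<longleftrightarrow> (\<forall>x. ereal (f x) \<le> Liminf (nhds x) (\<lambda>y. ereal (f y)))"

definition subdifferential :: "('a::real_inner \<Rightarrow> real) \<Rightarrow> 'a \<Rightarrow> 'a set" where
  "subdifferential f x = {\<xi>. \<forall>y. f x + \<xi> \<bullet> (y - x) \<le> f y}"

subsection \<open>Functions of bounded pointwise variation\<close>

text \<open>Functions on \<open>[a,b]\<close> are total functions on \<open>real\<close> of which only the values on \<open>[a,b]\<close>
  matter. Repeated partition points are allowed; they contribute nothing to the sums.\<close>

definition variation :: "real \<Rightarrow> real \<Rightarrow> (real \<Rightarrow> 'a::real_normed_vector) \<Rightarrow> ennreal" where
  "variation a b f =
     (SUP (n, p) \<in> {(n::nat, p::nat \<Rightarrow> real). p 0 = a \<and> p n = b \<and> (\<forall>i<n. p i \<le> p (Suc i))}.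
        \<Sum>i<n. ennreal (norm (f (p (Suc i)) - f (p i))))"

definition BV_on :: "real \<Rightarrow> real \<Rightarrow> (real \<Rightarrow> 'a::real_normed_vector) \<Rightarrow> bool" where
  "BV_on a b f \<longleftrightarrow> variation a b f < \<infinity>"

definition BV_norm :: "real \<Rightarrow> real \<Rightarrow> (real \<Rightarrow> 'a::real_normed_vector) \<Rightarrow> real" where
  "BV_norm a b f = (LINT s:{a<..<b}|lebesgue. norm (f s)) + enn2real (variation a b f)"

subsection \<open>Weak derivatives and \<open>W\<^sup>1\<^sup>,\<^sup>\<infinity>\<close>\<close>

definition test_function :: "real \<Rightarrow> real \<Rightarrow> (real \<Rightarrow> real) \<Rightarrow> bool" where
  "test_function a b \<phi> \<longleftrightarrow>
     (\<forall>k x. ((deriv ^^ k) \<phi>) differentiable (at x)) \<and>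
     compact (closure {x. \<phi> x \<noteq> 0}) \<and> closure {x. \<phi> x \<noteq> 0} \<subseteq> {a<..<b}"

definition L1_on :: "real \<Rightarrow> real \<Rightarrow> (real \<Rightarrow> 'a::euclidean_space) \<Rightarrow> bool" where
  "L1_on a b f \<longleftrightarrow> set_integrable lebesgue {a<..<b} f"

definition Linf_on :: "real \<Rightarrow> real \<Rightarrow> (real \<Rightarrow> 'a::euclidean_space) \<Rightarrow> bool" where
  "Linf_on a b f \<longleftrightarrow>
     f \<in> borel_measurable (lebesgue_on {a<..<b}) \<and>
     (\<exists>C. AE x in lebesgue_on {a<..<b}. norm (f x) \<le> C)"

definition has_weak_derivative ::
  "real \<Rightarrow> real \<Rightarrow> (real \<Rightarrow> 'a::euclidean_space) \<Rightarrow> (real \<Rightarrow> 'a) \<Rightarrow> bool" where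
  "has_weak_derivative a b f g \<longleftrightarrow>
     (\<forall>\<phi>. test_function a b \<phi> \<longrightarrow>
        (LINT x:{a<..<b}|lebesgue. deriv \<phi> x *\<^sub>R f x) =
        - (LINT x:{a<..<b}|lebesgue. \<phi> x *\<^sub>R g x))"

text \<open>\<open>W1inf a b f g\<close>: \<open>f\<close> is the continuous representative (on \<open>[a,b]\<close>) of an element of
  \<open>W\<^sup>1\<^sup>,\<^sup>\<infinity>(a,b)\<close>, and \<open>g\<close> is a representative of its weak derivative. As \<open>g\<close> is unique up to
  null sets, existential quantification over \<open>g\<close> below amounts to choosing a representative.\<close>

definition W1inf ::
  "real \<Rightarrow> real \<Rightarrow> (real \<Rightarrow> 'a::euclidean_space) \<Rightarrow> (real \<Rightarrow> 'a) \<Rightarrow> bool" where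
  "W1inf a b f g \<longleftrightarrow>
     continuous_on {a..b} f \<and> Linf_on a b f \<and> Linf_on a b g \<and> has_weak_derivative a b f g"

definition weak_star_Linf ::
  "real \<Rightarrow> real \<Rightarrow> (nat \<Rightarrow> real \<Rightarrow> 'a::euclidean_space) \<Rightarrow> (real \<Rightarrow> 'a) \<Rightarrow> bool" where
  "weak_star_Linf a b fn f \<longleftrightarrow>
     (\<forall>\<psi>. L1_on a b \<psi> \<longrightarrow>
        (\<lambda>n. LINT x:{a<..<b}|lebesgue. fn n x \<bullet> \<psi> x)
          \<longlonglongrightarrow> (LINT x:{a<..<b}|lebesgue. f x \<bullet> \<psi> x))"

definition weak_star_W1inf ::
  "real \<Rightarrow> real \<Rightarrow> (nat \<Rightarrow> real \<Rightarrow> 'a::euclidean_space) \<Rightarrow> (real \<Rightarrow> 'a) \<Rightarrow> bool" where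
  "weak_star_W1inf a b fn f \<longleftrightarrow>
     (\<exists>gn g. (\<forall>n. W1inf a b (fn n) (gn n)) \<and> W1inf a b f g \<and>
        weak_star_Linf a b fn f \<and> weak_star_Linf a b gn g)"

subsection \<open>Vector measures and weak-star convergence in \<open>BV\<close>\<close>

text \<open>Finite Borel measures on the interval \<open>(a,b)\<close> with values in a Euclidean space are
  countably additive set functions; on an interval they are automatically regular and of finite
  total variation.\<close>

definition vector_measure ::
  "real \<Rightarrow> real \<Rightarrow> (real set \<Rightarrow> 'a::euclidean_space) \<Rightarrow> bool" where
  "vector_measure a b \<mu> \<longleftrightarrow>
     (\<forall>X::nat \<Rightarrow> real set. range X \<subseteq> sets (restrict_space borel {a<..<b}) \<longrightarrow> disjoint_family X \<longrightarrow>
        (\<lambda>i. \<mu> (X i)) sums \<mu> (\<Union>i. X i))"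

text \<open>The integral of a scalar function against a vector measure: each component of the measure is
  written as a difference of two finite positive measures (such as its Jordan decomposition). The
  value does not depend on the chosen decomposition.\<close>

definition has_vm_integral ::
  "real \<Rightarrow> real \<Rightarrow> (real set \<Rightarrow> 'a::euclidean_space) \<Rightarrow> (real \<Rightarrow> real) \<Rightarrow> 'a \<Rightarrow> bool" where
  "has_vm_integral a b \<mu> \<phi> J \<longleftrightarrow>
     (\<forall>e\<in>Basis. \<exists>P N.
        finite_measure P \<and> sets P = sets (restrict_space borel {a<..<b}) \<and>
        finite_measure N \<and> sets N = sets (restrict_space borel {a<..<b}) \<and>
        (\<forall>X\<in>sets (restrict_space borel {a<..<b}). \<mu> X \<bullet> e = measure P X - measure N X) \<and>
        integrable P \<phi> \<and> integrable N \<phi> \<and>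
        J \<bullet> e = (LINT x|P. \<phi> x) - (LINT x|N. \<phi> x))"

definition distributional_derivative ::
  "real \<Rightarrow> real \<Rightarrow> (real \<Rightarrow> 'a::euclidean_space) \<Rightarrow> (real set \<Rightarrow> 'a) \<Rightarrow> bool" where
  "distributional_derivative a b f \<mu> \<longleftrightarrow>
     vector_measure a b \<mu> \<and>
     (\<forall>\<phi>. test_function a b \<phi> \<longrightarrow>
        has_vm_integral a b \<mu> \<phi> (- (LINT x:{a<..<b}|lebesgue. deriv \<phi> x *\<^sub>R f x)))"

text \<open>The test functions are the elements of \<open>C\<^sub>0\<close> of the open interval, whose dual is the space
  of measures; they are extended by \<open>0\<close> to the end points.\<close>

definition weak_star_measure ::
  "real \<Rightarrow> real \<Rightarrow> (nat \<Rightarrow> real set \<Rightarrow> 'a::euclidean_space) \<Rightarrow> (real set \<Rightarrow> 'a) \<Rightarrow> bool" where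
  "weak_star_measure a b \<mu>n \<mu> \<longleftrightarrow>
     (\<forall>\<phi>. continuous_on {a..b} \<phi> \<longrightarrow> \<phi> a = 0 \<longrightarrow> \<phi> b = 0 \<longrightarrow>
        (\<exists>Jn J. (\<forall>n. has_vm_integral a b (\<mu>n n) \<phi> (Jn n)) \<and> has_vm_integral a b \<mu> \<phi> J \<and>
           Jn \<longlonglongrightarrow> J))"

definition weak_star_BV ::
  "real \<Rightarrow> real \<Rightarrow> (nat \<Rightarrow> real \<Rightarrow> 'a::euclidean_space) \<Rightarrow> (real \<Rightarrow> 'a) \<Rightarrow> bool" where
  "weak_star_BV a b fn f \<longleftrightarrow>
     (\<forall>n. L1_on a b (fn n)) \<and> L1_on a b f \<and>
     (\<lambda>n. LINT x:{a<..<b}|lebesgue. norm (fn n x - f x)) \<longlonglongrightarrow> 0 \<and>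
     (\<exists>\<mu>n \<mu>. (\<forall>n. distributional_derivative a b (fn n) (\<mu>n n)) \<and>
        distributional_derivative a b f \<mu> \<and> weak_star_measure a b \<mu>n \<mu>)"

subsection \<open>Relaxed solutions\<close>

definition load_energy ::
  "real^'n^'n \<Rightarrow> (real^'n \<Rightarrow> real) \<Rightarrow> (real \<Rightarrow> real^'n) \<Rightarrow> real \<Rightarrow> real^'n \<Rightarrow> real" where
  "load_energy A F lh s z = energy A F z - lh s \<bullet> z"

definition residual ::
  "real^'n^'n \<Rightarrow> (real^'n \<Rightarrow> real) \<Rightarrow> (real^'n \<Rightarrow> real) \<Rightarrow> (real \<Rightarrow> real^'n) \<Rightarrow>
     (real \<Rightarrow> real^'n) \<Rightarrow> real \<Rightarrow> real" where
  "residual A F R lh zh s = infdist (- grad (load_energy A F lh s) (zh s)) (subdifferential R 0)"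

definition increase_points :: "real \<Rightarrow> (real \<Rightarrow> real) \<Rightarrow> real set" where
  "increase_points S th =
     {s\<in>{0<..<S}. \<forall>s1\<in>{0..S}. \<forall>s2\<in>{0..S}. s1 < s \<longrightarrow> s < s2 \<longrightarrow> th s1 < th s2}"

definition relaxed_solution ::
  "real^'n^'n \<Rightarrow> (real^'n \<Rightarrow> real) \<Rightarrow> (real^'n \<Rightarrow> real) \<Rightarrow> real^'n \<Rightarrow> real \<Rightarrow> (real \<Rightarrow> real^'n) \<Rightarrow>
     real \<Rightarrow> (real \<Rightarrow> real) \<Rightarrow> (real \<Rightarrow> real^'n) \<Rightarrow> (real \<Rightarrow> real^'n) \<Rightarrow> bool" where
  "relaxed_solution A F R z0 T l S th zh lh \<longleftrightarrow>
     S > 0 \<and> BV_on 0 S lh \<and>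
     (\<exists>dt dz. W1inf 0 S th dt \<and> W1inf 0 S zh dz \<and>
        th 0 = 0 \<and> th S = T \<and> zh 0 = z0 \<and>
        (AE s in lebesgue_on {0<..<S}.
           dt s \<ge> 0 \<and> dt s * residual A F R lh zh s = 0 \<and>
           dt s + R (dz s) + norm (dz s) * residual A F R lh zh s = 1) \<and>
        (\<forall>s1\<in>{0..S}. \<forall>s2\<in>{0..S}.
           energy A F (zh s2) +
             (LINT r=s1..s2|lebesgue. (R (dz r) + norm (dz r) * residual A F R lh zh r)) =
           energy A F (zh s1) + (LINT r=s1..s2|lebesgue. (lh r \<bullet> dz r)))) \<and>
     (AE s in lebesgue. s \<in> increase_points S th \<longrightarrow> lh s = l (th s))"

text \<open>On \<open>[0,S]\<close>, this is the constant extension of \<open>f\<close> beyond \<open>Sn\<close> if \<open>Sn < S\<close>, and the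
  restriction of \<open>f\<close> if \<open>Sn \<ge> S\<close>.\<close>

definition const_ext :: "real \<Rightarrow> (real \<Rightarrow> 'a) \<Rightarrow> real \<Rightarrow> 'a" where
  "const_ext Sn f s = f (min s Sn)"

end

theory Submission
  imports Defs "HOL-Library.Diagonal_Subsequence"
begin

text \<open>
  The arc-length normalization bounds \<open>th' \<le> 1\<close> and \<open>norm zh' \<le> 1 / c\<close>. Together with the energy identity on the whole
  interval it confines the lengths \<open>S n\<close> to a compact subset of \<open>(0, \<infinity>)\<close>. Hence, extended constantly to the
  line, all unknowns form one sequence of curves of uniformly bounded variation, and a single application of Helly's
  selection theorem (\<open>Helly_selection_dominated\<close>) yields a subsequence that converges at every point and, off a
  countable set, converges continuously, that is, also along convergent sequences of arguments. Pointwise convergence and the uniform bounds imply every weak-star convergence that is claimed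
  (\<open>weak_star_W1inf_pointwise\<close>, \<open>weak_star_BV_pointwise\<close>).

  For the limit equations (\<open>limit_of_extended_solutions\<close>) the essential point is that the normalization lets one rewrite the
  nonlinear dissipation in the energy identity as \<open>1 - th'\<close>. In this form the identity is affine in the derivatives, so it is stable under
  weak-star convergence. In the limit, the chain rule identifies \<open>1 - th'\<close> with the power \<open>(lh - DE(zh)) \<bullet> zh'\<close>. That
  is at most the dissipation density, by the definition of the residual as a distance to the subdifferential of \<open>R\<close>, whereas the density is at most \<open>1 - th'\<close>
  because it is a countable supremum of functions affine in \<open>zh'\<close>. So all three are equal, which is the normalization
  and, integrated, the energy identity of the limit.

  The coupling \<open>lh s = l (th s)\<close> at points of increase (\<open>limit_load_identity\<close>) needs more than pointwise convergence: a
  point of increase of the limit is only approximated by points of increase of \<open>th n\<close>, and \<open>th n s\<close> differs from its limit. The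
  continuous convergence off a countable set handles both; exceptional times are hit by only countably many points of increase.

  The definitions use weak derivatives and measures throughout. The proof works instead with primitives of bounded functions
  (\<open>bounded_primitive\<close>). \<open>W1inf_primitive\<close> leads from weak derivatives to primitives, \<open>bounded_primitive_imp_W1inf\<close> back,
  and \<open>lipschitz_primitive\<close> provides the derivative of the limit.
\<close>

section \<open>Smooth cut-off functions\<close>

text \<open>A polynomial in \<open>1 / x\<close> times \<open>exp (- 1 / x)\<close>. This family contains the standard smooth function that is flat
  at \<open>0\<close> and is closed under differentiation, which makes smoothness immediate.\<close>

definition flat :: "real poly \<Rightarrow> real \<Rightarrow> real" where
  "flat p x = (if x > 0 then poly p (1/x) * exp (- (1/x)) else 0)"

lemma poly_times_exp_neg_tendsto_0: "((\<lambda>y. poly p y * exp (- y)) \<longlongrightarrow> (0::real)) at_top"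
proof -
  have eq: "poly p y * exp (- y) = (\<Sum>i\<le>degree p. coeff p i * (y ^ i / exp y))" for y
    by (simp add: poly_altdef exp_minus sum_distrib_right divide_inverse mult.assoc)
  have "((\<lambda>y. \<Sum>i\<le>degree p. coeff p i * (y ^ i / exp y)) \<longlongrightarrow> (\<Sum>i\<le>degree p. coeff p i * 0)) at_top"
    by (intro tendsto_intros tendsto_power_div_exp_0)
  then show ?thesis by (simp add: eq)
qed

lemma flat_tendsto_0: "(flat p \<longlongrightarrow> 0) (at 0)"
proof -
  have "((\<lambda>x. poly p (1/x) * exp (- (1/x))) \<longlongrightarrow> 0) (at_right 0)"
    using filterlim_compose[OF poly_times_exp_neg_tendsto_0[of p] filterlim_inverse_at_top_right]
    by (simp add: inverse_eq_divide)
  then have r: "(flat p \<longlongrightarrow> 0) (at_right 0)"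
    by (rule Lim_transform_eventually) (auto simp: flat_def eventually_at_filter)
  have l: "(flat p \<longlongrightarrow> 0) (at_left 0)"
    by (rule tendsto_eventually) (auto simp: flat_def eventually_at_filter)
  show ?thesis using l r by (simp add: filterlim_split_at_real)
qed

lemma flat_has_derivative:
  "(flat p has_real_derivative flat (monom 1 2 * (p - pderiv p)) x) (at x)"
proof -
  consider "x > 0" | "x < 0" | "x = 0" by linarith
  then show ?thesis
  proof cases
    case 1
    have "((\<lambda>x. poly p (1/x) * exp (- (1/x))) has_real_derivative
            flat (monom 1 2 * (p - pderiv p)) x) (at x)"
      using 1 by (auto intro!: derivative_eq_intros DERIV_chain'[OF _ poly_DERIV]
          simp: flat_def poly_monom power2_eq_square field_simps)
    then show ?thesis
      by (rule DERIV_cong_ev[THEN iffD1, rotated 3])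
         (use 1 eventually_nhds_in_open[of "{0<..}" x] in \<open>auto elim!: eventually_mono simp: flat_def\<close>)
  next
    case 2
    have "((\<lambda>x. 0) has_real_derivative flat (monom 1 2 * (p - pderiv p)) x) (at x)"
      using 2 by (simp add: flat_def)
    then show ?thesis
      by (rule DERIV_cong_ev[THEN iffD1, rotated 3])
         (use 2 eventually_nhds_in_open[of "{..<0}" x] in \<open>auto elim!: eventually_mono simp: flat_def\<close>)
  next
    case 3
    have "(flat p (0 + h) - flat p 0) / h = flat (monom 1 1 * p) h" for h
      by (simp add: flat_def poly_monom)
    moreover have "flat (monom 1 2 * (p - pderiv p)) 0 = 0" by (simp add: flat_def)
    ultimately show ?thesis
      unfolding 3 DERIV_def using flat_tendsto_0[of "monom 1 1 * p"] by simp
  qed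
qed

text \<open>The algebra generated by affine reparametrizations of the flat functions. Each member has a derivative in
  the algebra, so by induction every member is smooth.\<close>

inductive_set flat_algebra :: "(real \<Rightarrow> real) set" where
  base: "(\<lambda>x. flat p (a * x + b)) \<in> flat_algebra"
| const: "(\<lambda>x. k) \<in> flat_algebra"
| add: "f \<in> flat_algebra \<Longrightarrow> g \<in> flat_algebra \<Longrightarrow> (\<lambda>x. f x + g x) \<in> flat_algebra"
| mult: "f \<in> flat_algebra \<Longrightarrow> g \<in> flat_algebra \<Longrightarrow> (\<lambda>x. f x * g x) \<in> flat_algebra"

lemma flat_algebra_has_derivative:
  assumes "f \<in> flat_algebra"
  shows "\<exists>f'\<in>flat_algebra. \<forall>x. (f has_real_derivative f' x) (at x)"
  using assms
proof induction
  case (base p a b)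
  have "((\<lambda>x. flat p (a * x + b)) has_real_derivative
          a * flat (monom 1 2 * (p - pderiv p)) (a * x + b)) (at x)" for x
    by (rule DERIV_cong[OF DERIV_chain'[where g = "flat p", OF _ flat_has_derivative]])
       (auto intro!: derivative_eq_intros)
  then show ?case
    by (intro bexI[of _ "\<lambda>x. a * flat (monom 1 2 * (p - pderiv p)) (a * x + b)"])
       (auto intro!: flat_algebra.intros)
next
  case (const k)
  show ?case by (intro bexI[of _ "\<lambda>x. 0"]) (auto intro: flat_algebra.intros)
next
  case (add f g)
  then obtain f' g' where "f' \<in> flat_algebra" "g' \<in> flat_algebra"
    "\<forall>x. (f has_real_derivative f' x) (at x)" "\<forall>x. (g has_real_derivative g' x) (at x)" by blast
  then show ?case
    by (intro bexI[of _ "\<lambda>x. f' x + g' x"]) (auto intro!: derivative_eq_intros flat_algebra.intros)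
next
  case (mult f g)
  then obtain f' g' where "f' \<in> flat_algebra" "g' \<in> flat_algebra"
    "\<forall>x. (f has_real_derivative f' x) (at x)" "\<forall>x. (g has_real_derivative g' x) (at x)" by blast
  then show ?case using mult.hyps
    by (intro bexI[of _ "\<lambda>x. f' x * g x + f x * g' x"])
       (auto intro!: derivative_eq_intros flat_algebra.intros)
qed

lemma flat_algebra_smooth:
  assumes "f \<in> flat_algebra"
  shows "((deriv ^^ k) f) differentiable (at x)"
proof -
  have "(deriv ^^ k) f \<in> flat_algebra"
  proof (induction k)
    case (Suc k)
    obtain f' where "f' \<in> flat_algebra" "\<forall>x. ((deriv ^^ k) f has_real_derivative f' x) (at x)"
      using flat_algebra_has_derivative[OF Suc] by blast
    moreover then have "deriv ((deriv ^^ k) f) = f'" by (auto intro!: ext DERIV_imp_deriv)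
    ultimately show ?case by simp
  qed (use assms in simp)
  then show ?thesis
    using flat_algebra_has_derivative by (meson real_differentiable_def)
qed

definition bump :: "real \<Rightarrow> real" where "bump x = flat 1 x * flat 1 (1 - x)"

lemma bump_affine_flat_algebra: "(\<lambda>x. bump (a * x + b)) \<in> flat_algebra"
proof -
  have "(\<lambda>x. flat 1 (a * x + b) * flat 1 ((-a) * x + (1 - b))) \<in> flat_algebra"
    by (intro flat_algebra.intros)
  moreover have "1 - (a * x + b) = - a * x + (1 - b)" for x by simp
  ultimately show ?thesis by (simp only: bump_def)
qed

lemma continuous_on_bump: "continuous_on UNIV bump"
  using flat_algebra_has_derivative[OF bump_affine_flat_algebra[of 1 0]]
  by (auto intro!: continuous_at_imp_continuous_on dest: DERIV_isCont)

lemma bump_nonneg: "bump x \<ge> 0" and bump_eq_0: "x \<le> 0 \<or> x \<ge> 1 \<Longrightarrow> bump x = 0"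
  and bump_pos: "0 < x \<Longrightarrow> x < 1 \<Longrightarrow> bump x > 0"
  by (auto simp: bump_def flat_def)

text \<open>The normalized primitive \<open>H\<close> of the bump function rises from \<open>0\<close> on \<open>{..0}\<close> to \<open>1\<close> on \<open>{1..}\<close>. Differences of
  shifted and rescaled copies of \<open>H\<close> are test functions approximating indicator functions of intervals.\<close>

lemma smooth_step:
  obtains H h :: "real \<Rightarrow> real"
  where "\<And>x. (H has_real_derivative h x) (at x)" "\<And>a b. (\<lambda>x. h (a * x + b)) \<in> flat_algebra"
    "continuous_on UNIV h" "\<And>x. h x \<ge> 0" "\<And>x. x \<le> 0 \<or> x \<ge> 1 \<Longrightarrow> h x = 0"
    "\<And>x. x \<le> 0 \<Longrightarrow> H x = 0" "\<And>x. x \<ge> 1 \<Longrightarrow> H x = 1" "\<And>x. 0 \<le> H x" "\<And>x. H x \<le> 1"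
proof -
  define G where "G x = integral {-1..x} bump" for x
  have G0: "G x = 0" if "x \<le> 0" for x
  proof -
    have "G x = integral {-1..x} (\<lambda>x. 0)" unfolding G_def
      by (rule integral_cong) (use that bump_eq_0 in auto)
    then show ?thesis by simp
  qed
  have dG: "(G has_real_derivative bump x) (at x)" for x
  proof (cases "x < 0")
    case True
    have "((\<lambda>x. 0) has_real_derivative bump x) (at x)" using True by (simp add: bump_eq_0)
    then show ?thesis
      by (rule DERIV_cong_ev[THEN iffD1, rotated 3])
         (use True eventually_nhds_in_open[of "{..<0}" x] in \<open>auto elim!: eventually_mono simp: G0\<close>)
  next
    case False
    have "(G has_real_derivative bump x) (at x within {-1..x+1})"
      unfolding G_def[abs_def] using False
      by (intro integral_has_real_derivative continuous_on_subset[OF continuous_on_bump]) auto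
    then show ?thesis using False by (subst (asm) at_within_interior) auto
  qed
  have mono: "G x \<le> G y" if "x \<le> y" for x y
    using DERIV_nonneg_imp_nondecreasing[OF that, of G] dG bump_nonneg by blast
  have "G 0 < G 1"
    by (rule DERIV_pos_imp_increasing_open)
       (use dG bump_pos in \<open>auto intro!: continuous_at_imp_continuous_on DERIV_isCont\<close>)
  then have pos: "G 1 > 0" by (simp add: G0)
  have G1: "G x = G 1" if "x \<ge> 1" for x
  proof (cases "x = 1")
    case False
    show ?thesis
    proof (rule DERIV_isconst_end[of 1 x G])
      show "continuous_on {1..x} G"
        using dG by (auto intro!: continuous_at_imp_continuous_on DERIV_isCont)
      show "(G has_real_derivative 0) (at y)" if "1 < y" "y < x" for y
        using dG[of y] that by (simp add: bump_eq_0)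
    qed (use False that in auto)
  qed simp
  show ?thesis
  proof (rule that[of "\<lambda>x. G x / G 1" "\<lambda>x. bump x * (1 / G 1)"])
    show "((\<lambda>x. G x / G 1) has_real_derivative bump x * (1 / G 1)) (at x)" for x
      using dG pos by (auto intro!: derivative_eq_intros)
    show "(\<lambda>x. bump (a * x + b) * (1 / G 1)) \<in> flat_algebra" for a b
      by (intro flat_algebra.mult bump_affine_flat_algebra flat_algebra.const)
    show "G x / G 1 \<le> 1" for x
      using mono[of x 1] G1[of x] pos by (cases "x \<le> 1") auto
    show "0 \<le> G x / G 1" for x
      using mono[of 0 x] G0[of x] pos by (cases "x \<le> 0") (auto simp: G0)
    show "G x / G 1 = 1" if "x \<ge> 1" for x using G1[OF that] pos by simp
    show "continuous_on UNIV (\<lambda>x. bump x * (1 / G 1))"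
      by (intro continuous_intros continuous_on_bump)
  qed (use pos bump_nonneg bump_eq_0 G0 in auto)
qed

text \<open>Only the derivative has to lie in the flat algebra: the higher derivatives of \<open>\<phi>\<close> are derivatives of \<open>\<psi>\<close>.\<close>

lemma test_functionI:
  assumes d: "\<And>x. (\<phi> has_real_derivative \<psi> x) (at x)" and alg: "\<psi> \<in> flat_algebra"
    and supp: "\<And>x. x \<notin> {u..v} \<Longrightarrow> \<phi> x = 0" and "a < u" "v < b"
  shows "test_function a b \<phi>"
proof -
  have "deriv \<phi> = \<psi>" using d by (auto intro!: ext DERIV_imp_deriv)
  then have "((deriv ^^ k) \<phi>) differentiable (at x)" for k x
    using flat_algebra_smooth[OF alg] d
    by (cases k) (auto simp: funpow_swap1 real_differentiable_def)
  moreover have sub: "closure {x. \<phi> x \<noteq> 0} \<subseteq> {u..v}"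
    using supp by (intro closure_minimal) (force, auto)
  moreover have "compact (closure {x. \<phi> x \<noteq> 0})"
    using sub bounded_subset[OF bounded_closed_interval] by (auto simp: compact_eq_bounded_closed)
  ultimately show ?thesis
    using assms(4,5) unfolding test_function_def by fastforce
qed

lemma test_functionD:
  assumes "test_function a b \<phi>" "a \<le> b"
  shows "(\<phi> has_real_derivative deriv \<phi> x) (at x)" "continuous_on UNIV (deriv \<phi>)"
    "\<phi> a = 0" "\<phi> b = 0"
proof -
  have 0: "((deriv ^^ 0) \<phi>) differentiable (at x)" "((deriv ^^ 1) \<phi>) differentiable (at x)" for x
    using assms unfolding test_function_def by blast+
  show "(\<phi> has_real_derivative deriv \<phi> x) (at x)"
    using 0(1) by (auto simp: DERIV_deriv_iff_real_differentiable)
  show "continuous_on UNIV (deriv \<phi>)"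
    using 0(2) by (auto intro!: continuous_at_imp_continuous_on differentiable_imp_continuous_within)
  have "{x. \<phi> x \<noteq> 0} \<subseteq> {a<..<b}"
    using assms closure_subset[of "{x. \<phi> x \<noteq> 0}"] unfolding test_function_def by blast
  then show "\<phi> a = 0" "\<phi> b = 0" by auto
qed

section \<open>Primitives of bounded functions and the chain rule\<close>

text \<open>Composition with the projection onto \<open>[a, b]\<close> extends a function constantly to the whole line. With all functions
  living on the line, curves of different lengths can be compared directly.\<close>

definition clip :: "real \<Rightarrow> real \<Rightarrow> real \<Rightarrow> real" where
  "clip a b x = max a (min x b)"

lemma clip_id [simp]: "x \<in> {a..b} \<Longrightarrow> clip a b x = x"
  and clip_mono: "x \<le> y \<Longrightarrow> clip a b x \<le> clip a b y"
  by (auto simp: clip_def)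

lemma clip_bounds [simp]: "a \<le> clip a b x" "a \<le> b \<Longrightarrow> clip a b x \<le> b"
  by (auto simp: clip_def)

lemma continuous_on_clip: "continuous_on UNIV (clip a b)"
  unfolding clip_def by (intro continuous_intros)

lemma continuous_on_comp_clip:
  "a \<le> b \<Longrightarrow> continuous_on {a..b} f \<Longrightarrow> continuous_on UNIV (\<lambda>x. f (clip a b x))"
  by (rule continuous_on_compose2[OF _ continuous_on_clip]) auto

lemma continuous_on_Icc_bound:
  fixes f :: "real \<Rightarrow> 'a::real_normed_vector"
  assumes "continuous_on {a..b} f"
  obtains M where "M > 0" "\<And>r. r \<in> {a..b} \<Longrightarrow> norm (f r) \<le> M"
proof -
  have "bounded (f ` {a..b})"
    using assms by (intro compact_imp_bounded compact_continuous_image) auto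
  then show ?thesis using that unfolding bounded_pos by blast
qed

lemma continuous_imp_lebesgue_measurable:
  "continuous_on UNIV f \<Longrightarrow> f \<in> borel_measurable lebesgue"
  by (rule measurable_completion) (auto intro: borel_measurable_continuous_onI)

lemma set_integrable_bounded:
  fixes g :: "real \<Rightarrow> 'a::euclidean_space"
  assumes "g \<in> borel_measurable lebesgue" "\<And>x. x \<in> A \<Longrightarrow> norm (g x) \<le> K" "A \<in> lmeasurable"
  shows "set_integrable lebesgue A g"
  unfolding set_integrable_def using assms
  by (intro integrableI_bounded_set_indicator[where B = K]) (auto simp: fmeasurable_def)

lemma norm_set_integral_Icc_le:
  fixes g :: "real \<Rightarrow> 'a::euclidean_space"
  assumes "g \<in> borel_measurable lebesgue" "\<And>r. r \<in> {x..y} \<Longrightarrow> norm (g r) \<le> K" "x \<le> y"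
  shows "norm (LINT r:{x..y}|lebesgue. g r) \<le> K * (y - x)"
proof -
  have "norm (LINT r:{x..y}|lebesgue. g r) \<le> (LINT r|lebesgue. norm (indicator {x..y} r *\<^sub>R g r))"
    unfolding set_lebesgue_integral_def by (rule integral_norm_bound)
  also have "\<dots> \<le> (LINT r|lebesgue. indicator {x..y} r * K)"
  proof (rule integral_mono)
    show "integrable lebesgue (\<lambda>r. norm (indicator {x..y} r *\<^sub>R g r))"
      using set_integrable_bounded[OF assms(1,2), of "{x..y}"] unfolding set_integrable_def
      by (intro integrable_norm) auto
    show "integrable lebesgue (\<lambda>r. indicator {x..y} r * K)"
      by (intro integrable_mult_left integrable_real_indicator) (auto simp: emeasure_lborel_Icc_eq)
  qed (use assms in \<open>auto simp: indicator_def\<close>)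
  also have "\<dots> = K * (y - x)" using assms(3) by simp
  finally show ?thesis .
qed

lemma set_integral_empty [simp]: "(LINT x:{}|M. f x) = 0"
  by (simp add: set_lebesgue_integral_def)

lemma integrable_indicator_Ioo: "integrable lebesgue (\<lambda>x. indicator {a<..<b::real} x * (c::real))"
  by (intro integrable_mult_left lmeasurable_iff_integrable[THEN iffD1]) simp

lemma set_integral_Icc_add:
  fixes g :: "real \<Rightarrow> 'a::euclidean_space"
  assumes "set_integrable lebesgue {x..z} g" "x \<le> y" "y \<le> z"
  shows "(LINT r:{x..z}|lebesgue. g r) = (LINT r:{x..y}|lebesgue. g r) + (LINT r:{y..z}|lebesgue. g r)"
proof -
  have "(LINT r:{x..y} \<union> {y..z}|lebesgue. g r) = (LINT r:{x..y}|lebesgue. g r) + (LINT r:{y..z}|lebesgue. g r)"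
  proof (rule set_integral_Un_AE)
    have "AE r in lebesgue. r \<noteq> y"
      by (rule AE_I'[of "{y}"]) auto
    then show "AE r in lebesgue. \<not> (r \<in> {x..y} \<and> r \<in> {y..z})"
      by eventually_elim auto
  qed (use assms in \<open>auto intro: set_integrable_subset\<close>)
  moreover have "{x..y} \<union> {y..z} = {x..z}" using assms by auto
  ultimately show ?thesis by simp
qed

lemma set_integral_clip:
  fixes q :: "real \<Rightarrow> 'a::euclidean_space"
  assumes "a \<le> b" "x \<le> y" "\<And>r. r \<notin> {a<..<b} \<Longrightarrow> q r = 0"
  shows "(LINT r:{clip a b x..clip a b y}|lebesgue. q r) = (LINT r:{x..y}|lebesgue. q r)"
  unfolding set_lebesgue_integral_def
proof (rule integral_discrete_difference[of "{a, b}"])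
  fix r
  show "indicat_real {clip a b x..clip a b y} r *\<^sub>R q r = indicat_real {x..y} r *\<^sub>R q r"
    using assms by (cases "r \<in> {a<..<b}") (auto simp: clip_def indicator_def)
qed auto

text \<open>A Lipschitz curve together with a bounded representative of its derivative. The bound is required everywhere, not
  almost everywhere, and the representative is Lebesgue measurable on the whole line.\<close>

definition bounded_primitive :: "real \<Rightarrow> (real \<Rightarrow> 'a::euclidean_space) \<Rightarrow> (real \<Rightarrow> 'a) \<Rightarrow> bool" where
  "bounded_primitive K f g \<longleftrightarrow> g \<in> borel_measurable lebesgue \<and> (\<forall>x. norm (g x) \<le> K) \<and>
     (\<forall>x y. x \<le> y \<longrightarrow> f y - f x = (LINT r:{x..y}|lebesgue. g r))"

lemma bounded_primitiveD:
  assumes "bounded_primitive K f g"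
  shows "g \<in> borel_measurable lebesgue" "norm (g x) \<le> K" "K \<ge> 0"
    "x \<le> y \<Longrightarrow> f y - f x = (LINT r:{x..y}|lebesgue. g r)"
    "norm (f y - f x) \<le> K * \<bar>y - x\<bar>" "continuous_on UNIV f"
    "A \<in> lmeasurable \<Longrightarrow> set_integrable lebesgue A g"
proof -
  show m: "g \<in> borel_measurable lebesgue" using assms by (simp add: bounded_primitive_def)
  show b: "norm (g x) \<le> K" for x using assms by (simp add: bounded_primitive_def)
  show eq: "x \<le> y \<Longrightarrow> f y - f x = (LINT r:{x..y}|lebesgue. g r)" for x y
    using assms by (simp add: bounded_primitive_def)
  show K: "K \<ge> 0" using norm_ge_zero order_trans b by blast
  show "A \<in> lmeasurable \<Longrightarrow> set_integrable lebesgue A g"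
    using m b by (rule set_integrable_bounded)
  have *: "norm (f y - f x) \<le> K * (y - x)" if "x \<le> y" for x y
    using norm_set_integral_Icc_le[OF m b that] eq[OF that] by simp
  show lip: "norm (f y - f x) \<le> K * \<bar>y - x\<bar>" for x y
    using *[of x y] *[of y x] by (cases "x \<le> y") (auto simp: norm_minus_commute)
  have "K-lipschitz_on UNIV f"
    using lip K by (auto simp: lipschitz_on_def dist_norm)
  then show "continuous_on UNIV f" by (rule lipschitz_on_continuous_on)
qed

lemma bounded_primitive_mono: "bounded_primitive K f g \<Longrightarrow> K \<le> L \<Longrightarrow> bounded_primitive L f g"
  unfolding bounded_primitive_def by (meson order_trans)

lemma bounded_primitive_id: "bounded_primitive 1 (\<lambda>x. x) (\<lambda>x. 1 :: real)"
  by (auto simp: bounded_primitive_def set_lebesgue_integral_def)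

lemma bounded_primitive_Pair:
  fixes f g :: "real \<Rightarrow> 'a::euclidean_space" and f' g' :: "real \<Rightarrow> 'b::euclidean_space"
  assumes f: "bounded_primitive K f g" and f': "bounded_primitive L f' g'"
  shows "bounded_primitive (K + L) (\<lambda>x. (f x, f' x)) (\<lambda>x. (g x, g' x))"
  unfolding bounded_primitive_def
proof (intro conjI allI impI)
  show m: "(\<lambda>x. (g x, g' x)) \<in> borel_measurable lebesgue"
    using bounded_primitiveD(1)[OF f] bounded_primitiveD(1)[OF f'] by (rule borel_measurable_Pair)
  show b: "norm (g x, g' x) \<le> K + L" for x
    by (rule order_trans[OF norm_Pair_le add_mono[OF bounded_primitiveD(2)[OF f] bounded_primitiveD(2)[OF f']]])
  fix x y :: real assume xy: "x \<le> y"
  have i: "integrable lebesgue (\<lambda>r. indicat_real {x..y} r *\<^sub>R (g r, g' r))"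
    using set_integrable_bounded[OF m b, of "{x..y}"] by (simp add: set_integrable_def)
  have "fst (LINT r:{x..y}|lebesgue. (g r, g' r)) = f y - f x"
    "snd (LINT r:{x..y}|lebesgue. (g r, g' r)) = f' y - f' x"
    unfolding bounded_primitiveD(4)[OF f xy] bounded_primitiveD(4)[OF f' xy] set_lebesgue_integral_def
    using integral_bounded_linear[OF bounded_linear_fst i] integral_bounded_linear[OF bounded_linear_snd i]
    by simp_all
  then show "(f y, f' y) - (f x, f' x) = (LINT r:{x..y}|lebesgue. (g r, g' r))"
    by (simp add: prod_eq_iff)
qed

lemma clip_primitive:
  fixes g :: "real \<Rightarrow> 'a::euclidean_space"
  assumes "a \<le> b" "K \<ge> 0" "(\<lambda>x. if x \<in> {a<..<b} then g x else 0) \<in> borel_measurable lebesgue"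
    and "\<And>x. x \<in> {a<..<b} \<Longrightarrow> norm (g x) \<le> K"
    and eq: "\<And>x y. a \<le> x \<Longrightarrow> x \<le> y \<Longrightarrow> y \<le> b \<Longrightarrow> f y - f x = (LINT r:{x..y}|lebesgue. g r)"
  shows "bounded_primitive K (\<lambda>x. f (clip a b x)) (\<lambda>x. if x \<in> {a<..<b} then g x else 0)"
  unfolding bounded_primitive_def
proof (intro conjI allI impI)
  fix x y :: real assume "x \<le> y"
  have "f (clip a b y) - f (clip a b x) = (LINT r:{clip a b x..clip a b y}|lebesgue. g r)"
    using assms(1) \<open>x \<le> y\<close> by (intro eq) (auto simp: clip_def)
  also have "\<dots> = (LINT r:{x..y}|lebesgue. if r \<in> {a<..<b} then g r else 0)"
    unfolding set_lebesgue_integral_def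
    by (rule integral_discrete_difference[of "{a,b}"])
       (use assms(1) \<open>x \<le> y\<close> in \<open>auto simp: clip_def indicator_def\<close>)
  finally show "f (clip a b y) - f (clip a b x) = (LINT r:{x..y}|lebesgue. if r \<in> {a<..<b} then g r else 0)" .
qed (use assms in auto)

lemma GDERIV_estimate:
  assumes "GDERIV E w :> D" "e > 0"
  shows "\<exists>d>0. \<forall>v. norm (v - w) < d \<longrightarrow> \<bar>E v - E w - D \<bullet> (v - w)\<bar> \<le> e * norm (v - w)"
  using assms unfolding gderiv_def has_derivative_at_alt by (simp add: inner_commute)

text \<open>Chain rule for a \<open>C\<^sup>1\<close> function along a Lipschitz curve. As functions of the end point, the two sides differ by a function with derivative zero at
  every point, because on a short interval both are close to the increment of \<open>w\<close> paired with the frozen gradient.\<close>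

lemma chain_rule_primitive:
  fixes E :: "'a::euclidean_space \<Rightarrow> real"
  assumes E: "\<And>v. GDERIV E v :> D v" and D: "continuous_on UNIV D"
    and w: "bounded_primitive K w w'" and "x \<le> y"
  shows "E (w y) - E (w x) = (LINT r:{x..y}|lebesgue. D (w r) \<bullet> w' r)"
proof -
  note wD = bounded_primitiveD[OF w]
  have cDw: "continuous_on UNIV (\<lambda>r. D (w r))"
    by (rule continuous_on_compose2[OF D wD(6)]) auto
  define k where "k r = D (w r) \<bullet> w' r" for r
  have km: "k \<in> borel_measurable lebesgue"
    unfolding k_def[abs_def]
    by (intro borel_measurable_inner continuous_imp_lebesgue_measurable cDw wD)
  obtain M where M: "\<And>r. r \<in> {x..y} \<Longrightarrow> norm (D (w r)) \<le> M"
    using continuous_on_Icc_bound[OF continuous_on_subset[OF cDw]] by blast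
  have kb: "norm (k r) \<le> M * K" if "r \<in> {x..y}" for r
    unfolding k_def using Cauchy_Schwarz_ineq2[of "D (w r)" "w' r"]
      mult_mono[OF M[OF that] wD(2)[of r]] order_trans[OF norm_ge_zero M[OF that]] by force
  have ki: "set_integrable lebesgue {x..y} k"
    by (rule set_integrable_bounded[OF km kb]) auto
  define I where "I t = (LINT r:{x..t}|lebesgue. k r)" for t
  have Idiff: "I q - I p = (LINT r:{p..q}|lebesgue. k r)" if "x \<le> p" "p \<le> q" "q \<le> y" for p q
    unfolding I_def using set_integral_Icc_add[of x q k p] set_integrable_subset[OF ki, of "{x..q}"] that
    by simp
  define G where "G t = E (w t) - I t" for t
  \<comment> \<open>Freezing the gradient at a nearby point costs only its oscillation.\<close>
  have key: "\<bar>d \<bullet> (w q - w p) - (I q - I p)\<bar> \<le> e * K * (q - p)"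
    if "x \<le> p" "p \<le> q" "q \<le> y" and e: "\<And>r. r \<in> {p..q} \<Longrightarrow> norm (d - D (w r)) \<le> e" for p q d e
  proof -
    have i1: "set_integrable lebesgue {p..q} (\<lambda>r. d \<bullet> w' r)"
      by (rule set_integrable_bounded[where K = "norm d * K"])
         (use wD(1,2) Cauchy_Schwarz_ineq2 in \<open>auto intro!: order_trans[OF Cauchy_Schwarz_ineq2] mult_left_mono\<close>)
    have i2: "set_integrable lebesgue {p..q} k"
      using that by (intro set_integrable_subset[OF ki]) auto
    have "d \<bullet> (w q - w p) = (LINT r:{p..q}|lebesgue. d \<bullet> w' r)"
      unfolding wD(4)[OF that(2)] set_lebesgue_integral_def
      by (subst integral_inner_right[symmetric])
         (use wD(7)[of "{p..q}"] in \<open>auto simp: set_integrable_def inner_scaleR_right\<close>)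
    then have "d \<bullet> (w q - w p) - (I q - I p) = (LINT r:{p..q}|lebesgue. d \<bullet> w' r - k r)"
      using set_integral_diff(2)[OF i1 i2] Idiff that by simp
    moreover have "norm (d \<bullet> w' r - k r) \<le> e * K" if "r \<in> {p..q}" for r
    proof -
      have "norm (d \<bullet> w' r - k r) = \<bar>(d - D (w r)) \<bullet> w' r\<bar>" by (simp add: k_def inner_diff_left)
      also have "\<dots> \<le> norm (d - D (w r)) * norm (w' r)" by (rule Cauchy_Schwarz_ineq2)
      also have "\<dots> \<le> e * K" using e[OF that] wD(2)[of r] order_trans[OF norm_ge_zero e[OF that]]
        by (intro mult_mono) auto
      finally show ?thesis .
    qed
    ultimately show ?thesis
      using norm_set_integral_Icc_le[of "\<lambda>r. d \<bullet> w' r - k r" p q "e * K"] km wD(1) that(2) by simp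
  qed
  have "(G has_derivative (\<lambda>h. 0)) (at t within {x..y})" if t: "t \<in> {x..y}" for t
    unfolding has_derivative_within_alt
  proof (intro conjI allI impI)
    fix e :: real assume "e > 0"
    \<comment> \<open>The Taylor error of \<open>E\<close> and the oscillation of the gradient each contribute \<open>e' * K\<close>.\<close>
    define e' where "e' = e / (2 * K + 1)"
    have e': "e' > 0" using \<open>e > 0\<close> wD(3) by (simp add: e'_def add_nonneg_pos)
    obtain d1 where d1: "d1 > 0"
      "\<And>v. norm (v - w t) < d1 \<Longrightarrow> \<bar>E v - E (w t) - D (w t) \<bullet> (v - w t)\<bar> \<le> e' * norm (v - w t)"
      using GDERIV_estimate[OF E e'] by blast
    have "isCont (\<lambda>r. D (w r)) t" using cDw by (simp add: continuous_on_eq_continuous_at)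
    then obtain d2 where d2: "d2 > 0" "\<And>r. \<bar>r - t\<bar> < d2 \<Longrightarrow> norm (D (w r) - D (w t)) < e'"
      using e' unfolding continuous_at_eps_delta by (auto simp: dist_norm)
    define d where "d = min d2 (d1 / (K + 1))"
    show "\<exists>d>0. \<forall>s\<in>{x..y}. norm (s - t) < d \<longrightarrow> norm (G s - G t - 0) \<le> e * norm (s - t)"
    proof (intro exI[of _ d] conjI ballI impI)
      show "d > 0" using d1 d2 wD(3) by (simp add: d_def add_nonneg_pos)
      fix s assume s: "s \<in> {x..y}" "norm (s - t) < d"
      have lip: "norm (w s - w t) \<le> K * \<bar>s - t\<bar>" by (rule wD(5))
      have "(K + 1) * \<bar>s - t\<bar> < d1" using s wD(3) by (simp add: d_def field_simps)
      moreover have "K * \<bar>s - t\<bar> \<le> (K + 1) * \<bar>s - t\<bar>" by (intro mult_right_mono) auto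
      ultimately have "norm (w s - w t) < d1" using lip by linarith
      then have 1: "\<bar>E (w s) - E (w t) - D (w t) \<bullet> (w s - w t)\<bar> \<le> e' * (K * \<bar>s - t\<bar>)"
        using d1(2)[of "w s"] mult_left_mono[OF lip, of e'] e' by linarith
      have near: "norm (D (w t) - D (w r)) \<le> e'" if "\<bar>r - t\<bar> \<le> \<bar>s - t\<bar>" for r
        using d2(2)[of r] that s(2) by (simp add: d_def norm_minus_commute)
      have 2: "\<bar>D (w t) \<bullet> (w s - w t) - (I s - I t)\<bar> \<le> e' * K * \<bar>s - t\<bar>"
      proof (cases "t \<le> s")
        case True
        then show ?thesis using key[of t s "D (w t)" e'] near s t by simp
      next
        case False
        have "\<bar>D (w t) \<bullet> (w t - w s) - (I t - I s)\<bar> \<le> e' * K * (t - s)"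
          by (rule key) (use near s t False in auto)
        moreover have "D (w t) \<bullet> (w t - w s) - (I t - I s) = - (D (w t) \<bullet> (w s - w t) - (I s - I t))"
          by (simp add: inner_diff_right)
        ultimately show ?thesis using False by simp
      qed
      have "\<bar>G s - G t\<bar> \<le> e' * (2 * K) * \<bar>s - t\<bar>"
        using 1 2 unfolding G_def by (simp add: abs_le_iff)
      also have "\<dots> \<le> e' * (2 * K + 1) * \<bar>s - t\<bar>"
        using e' by (intro mult_right_mono mult_left_mono) auto
      also have "e' * (2 * K + 1) = e" using wD(3) by (simp add: e'_def)
      finally show "norm (G s - G t - 0) \<le> e * norm (s - t)" by simp
    qed
  qed simp
  then obtain c where "\<And>t. t \<in> {x..y} \<Longrightarrow> G t = c"
    using has_derivative_zero_constant[of "{x..y}" G] by auto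
  then have "G y = G x" using \<open>x \<le> y\<close> by simp
  moreover have "I x = 0" using norm_set_integral_Icc_le[OF km, of x x "M * K"] kb \<open>x \<le> y\<close>
    by (simp add: I_def)
  ultimately show ?thesis by (simp add: G_def I_def k_def)
qed

lemma C1_bounded_primitive:
  fixes \<phi> \<phi>' :: "real \<Rightarrow> real"
  assumes "a \<le> b" "\<And>x. (\<phi> has_real_derivative \<phi>' x) (at x)" "continuous_on UNIV \<phi>'"
  obtains K where "bounded_primitive K (\<lambda>x. \<phi> (clip a b x)) (\<lambda>x. if x \<in> {a<..<b} then \<phi>' x else 0)"
proof -
  obtain K where K: "K > 0" "\<And>r. r \<in> {a..b} \<Longrightarrow> norm (\<phi>' r) \<le> K"
    using continuous_on_Icc_bound[OF continuous_on_subset[OF assms(3)]] by blast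
  have "bounded_primitive K (\<lambda>x. \<phi> (clip a b x)) (\<lambda>x. if x \<in> {a<..<b} then \<phi>' x else 0)"
  proof (rule clip_primitive)
    show "(\<lambda>x. if x \<in> {a<..<b} then \<phi>' x else 0) \<in> borel_measurable lebesgue"
      by (intro measurable_If_set continuous_imp_lebesgue_measurable assms) auto
    fix x y :: real assume "x \<le> y"
    have "(LBINT r:{x..y}. \<phi>' r) = \<phi> y - \<phi> x"
      using integral_FTC_Icc[of x y \<phi> \<phi>'] \<open>x \<le> y\<close> assms
      by (simp add: set_lebesgue_integral_def has_real_derivative_iff_has_vector_derivative
          has_vector_derivative_at_within continuous_on_subset)
    moreover have "(LBINT r:{x..y}. \<phi>' r) = (LINT r:{x..y}|lebesgue. \<phi>' r)"
      unfolding set_lebesgue_integral_def using assms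
      by (intro integral_completion[symmetric] borel_measurable_scaleR)
         (auto intro: borel_measurable_continuous_onI)
    ultimately show "\<phi> y - \<phi> x = (LINT r:{x..y}|lebesgue. \<phi>' r)" by simp
  qed (use K assms in auto)
  then show ?thesis by (rule that)
qed

lemma set_integral_Ioo_eq_Icc:
  fixes g :: "real \<Rightarrow> 'a::euclidean_space"
  shows "(LINT r:{a<..<b}|lebesgue. g r) = (LINT r:{a..b}|lebesgue. g r)"
  unfolding set_lebesgue_integral_def
  by (rule integral_discrete_difference[of "{a,b}"]) (auto simp: indicator_def)

lemma interval_integral_lebesgue_Icc:
  fixes f :: "real \<Rightarrow> 'a::euclidean_space"
  assumes "x \<le> y"
  shows "(LINT r=x..y|lebesgue. f r) = (LINT r:{x..y}|lebesgue. f r)"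
    "(LINT r=y..x|lebesgue. f r) = - (LINT r:{x..y}|lebesgue. f r)"
proof -
  show 1: "(LINT r=x..y|lebesgue. f r) = (LINT r:{x..y}|lebesgue. f r)"
    using assms by (simp add: interval_lebesgue_integral_def set_integral_Ioo_eq_Icc)
  show "(LINT r=y..x|lebesgue. f r) = - (LINT r:{x..y}|lebesgue. f r)"
    using assms set_integral_Ioo_eq_Icc[of y y f]
    by (cases "x = y") (auto simp: interval_lebesgue_integral_def set_integral_Ioo_eq_Icc)
qed

text \<open>The chain rule for the curve \<open>(\<phi>, f)\<close> and the function \<open>(p, v) \<mapsto> p * (v \<bullet> e)\<close>, for each basis vector \<open>e\<close>.\<close>

lemma bounded_primitive_integration_by_parts:
  fixes f g :: "real \<Rightarrow> 'a::euclidean_space"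
  assumes f: "bounded_primitive K f g" and "a \<le> b"
    and \<phi>: "\<And>x. (\<phi> has_real_derivative \<phi>' x) (at x)" "continuous_on UNIV \<phi>'" "\<phi> a = 0" "\<phi> b = 0"
  shows "(LINT x:{a<..<b}|lebesgue. \<phi>' x *\<^sub>R f x) = - (LINT x:{a<..<b}|lebesgue. \<phi> x *\<^sub>R g x)"
proof -
  note fD = bounded_primitiveD[OF f]
  obtain L where L: "bounded_primitive L (\<lambda>x. \<phi> (clip a b x)) (\<lambda>x. if x \<in> {a<..<b} then \<phi>' x else 0)"
    using C1_bounded_primitive[OF \<open>a \<le> b\<close> \<phi>(1,2)] by blast
  have c\<phi>: "continuous_on UNIV \<phi>" using \<phi>(1) by (intro continuous_at_imp_continuous_on) (auto dest: DERIV_isCont)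
  have i1: "set_integrable lebesgue {a<..<b} (\<lambda>x. \<phi>' x *\<^sub>R f x)"
  proof -
    have "continuous_on {a..b} (\<lambda>x. \<phi>' x *\<^sub>R f x)"
      by (intro continuous_intros continuous_on_subset[OF \<phi>(2)] continuous_on_subset[OF fD(6)]) auto
    then obtain M where "\<And>r. r \<in> {a..b} \<Longrightarrow> norm (\<phi>' r *\<^sub>R f r) \<le> M"
      using continuous_on_Icc_bound by blast
    then show ?thesis
      by (intro set_integrable_bounded[where K = M] borel_measurable_scaleR
          continuous_imp_lebesgue_measurable \<phi> fD) auto
  qed
  have i2: "set_integrable lebesgue {a<..<b} (\<lambda>x. \<phi> x *\<^sub>R g x)"
  proof -
    obtain M where M: "\<And>r. r \<in> {a..b} \<Longrightarrow> norm (\<phi> r) \<le> M"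
      using continuous_on_Icc_bound[OF continuous_on_subset[OF c\<phi>]] by blast
    have "norm (\<phi> r *\<^sub>R g r) \<le> M * K" if "r \<in> {a<..<b}" for r
      using mult_mono[OF M[of r] fD(2)[of r]] order_trans[OF norm_ge_zero M[of r]] that by simp
    then show ?thesis
      by (intro set_integrable_bounded[where K = "M * K"] borel_measurable_scaleR
          continuous_imp_lebesgue_measurable c\<phi> fD) auto
  qed
  have "(LINT x:{a<..<b}|lebesgue. \<phi>' x *\<^sub>R f x) + (LINT x:{a<..<b}|lebesgue. \<phi> x *\<^sub>R g x) = 0"
  proof (rule euclidean_eqI)
    fix e :: 'a assume "e \<in> Basis"
    define w where "w x = (\<phi> (clip a b x), f x)" for x
    define w' where "w' x = (if x \<in> {a<..<b} then \<phi>' x else 0, g x)" for x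
    have w: "bounded_primitive (L + K) w w'"
      unfolding w_def w'_def by (rule bounded_primitive_Pair[OF L f])
    have "GDERIV (\<lambda>(p, v). p * (v \<bullet> e)) q :> (snd q \<bullet> e, fst q *\<^sub>R e)" for q
      unfolding gderiv_def split_beta
      by (auto intro!: derivative_eq_intros ext simp: inner_prod_def algebra_simps)
    moreover have "continuous_on UNIV (\<lambda>q. (snd q \<bullet> e, fst q *\<^sub>R e))"
      by (intro continuous_intros)
    ultimately have "\<phi> b * (f b \<bullet> e) - \<phi> a * (f a \<bullet> e) =
        (LINT r:{a..b}|lebesgue. (f r \<bullet> e, \<phi> (clip a b r) *\<^sub>R e) \<bullet> w' r)"
      using chain_rule_primitive[of "\<lambda>(p, v). p * (v \<bullet> e)" "\<lambda>q. (snd q \<bullet> e, fst q *\<^sub>R e)", OF _ _ w \<open>a \<le> b\<close>] \<open>a \<le> b\<close>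
      by (simp add: w_def)
    also have "\<dots> = (LINT r:{a<..<b}|lebesgue. (\<phi>' r *\<^sub>R f r + \<phi> r *\<^sub>R g r) \<bullet> e)"
      unfolding set_integral_Ioo_eq_Icc[symmetric]
      by (rule set_lebesgue_integral_cong)
         (auto simp: w'_def inner_add_left inner_commute algebra_simps)
    also have "\<dots> = (LINT x:{a<..<b}|lebesgue. \<phi>' x *\<^sub>R f x + \<phi> x *\<^sub>R g x) \<bullet> e"
      using set_integral_add(1)[OF i1 i2] unfolding set_lebesgue_integral_def set_integrable_def
      by (subst integral_inner_left[symmetric]) auto
    also have "\<dots> = ((LINT x:{a<..<b}|lebesgue. \<phi>' x *\<^sub>R f x) + (LINT x:{a<..<b}|lebesgue. \<phi> x *\<^sub>R g x)) \<bullet> e"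
      using set_integral_add(2)[OF i1 i2] by simp
    finally show "((LINT x:{a<..<b}|lebesgue. \<phi>' x *\<^sub>R f x) + (LINT x:{a<..<b}|lebesgue. \<phi> x *\<^sub>R g x)) \<bullet> e = 0 \<bullet> e"
      using \<phi> by simp
  qed
  then show ?thesis by (simp add: eq_neg_iff_add_eq_0)
qed

lemma bounded_primitive_imp_W1inf:
  fixes f g :: "real \<Rightarrow> 'a::euclidean_space"
  assumes f: "bounded_primitive K f g" and "a \<le> b"
  shows "W1inf a b f g"
proof -
  note fD = bounded_primitiveD[OF f]
  obtain M where "\<And>r. r \<in> {a..b} \<Longrightarrow> norm (f r) \<le> M"
    using continuous_on_Icc_bound[OF continuous_on_subset[OF fD(6)]] by blast
  moreover have "has_weak_derivative a b f g"
    unfolding has_weak_derivative_def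
    using bounded_primitive_integration_by_parts[OF f \<open>a \<le> b\<close>] test_functionD[OF _ \<open>a \<le> b\<close>] by blast
  moreover have "AE x in lebesgue_on {a<..<b}. norm (f x) \<le> M"
    using calculation(1) by (intro AE_I2) (simp add: space_restrict_space)
  moreover have "AE x in lebesgue_on {a<..<b}. norm (g x) \<le> K"
    using fD(2) by (intro AE_I2)
  ultimately show ?thesis
    unfolding W1inf_def Linf_on_def
    using fD(1) continuous_imp_lebesgue_measurable[OF fD(6)] continuous_on_subset[OF fD(6)]
    by (blast intro: measurable_restrict_space1)
qed

section \<open>Functions with bounded weak derivative are primitives\<close>

text \<open>After rescaling, the derivatives of the smooth step form an approximate identity.\<close>

lemma smooth_step_concentrates:
  fixes F :: "real \<Rightarrow> 'a::euclidean_space"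
  assumes F: "continuous_on UNIV F" "\<And>t. norm (F t) \<le> B"
    and H: "\<And>x. (H has_real_derivative h x) (at x)" "continuous_on UNIV h" "\<And>x. h x \<ge> 0"
      "\<And>x. x \<le> 0 \<or> x \<ge> 1 \<Longrightarrow> h x = 0" "H 0 = 0" "H 1 = 1"
  shows "(\<lambda>n. LINT t|lebesgue. (real (Suc n) * h (real (Suc n) * (t - x))) *\<^sub>R F t) \<longlonglongrightarrow> F x"
proof -
  have hb [measurable]: "h \<in> borel_measurable borel" and Fb [measurable]: "F \<in> borel_measurable borel"
    using F H by (auto intro: borel_measurable_continuous_onI)
  have hs: "(\<lambda>s. indicator {0..1} s *\<^sub>R h s) = h"
  proof
    fix s show "indicator {0..1} s *\<^sub>R h s = h s" using H(4)[of s] by (cases "s \<in> {0..1}") auto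
  qed
  have "has_bochner_integral lborel (\<lambda>s. indicator {0..1} s *\<^sub>R h s) (H 1 - H 0)"
    using H(1,2)
    by (intro has_bochner_integral_FTC_Icc)
       (auto simp: has_real_derivative_iff_has_vector_derivative has_vector_derivative_at_within
          intro: continuous_on_subset)
  then have h1: "has_bochner_integral lborel h 1" by (simp only: hs H(5,6) diff_0_right)
  have eq: "(LINT t|lebesgue. (real (Suc n) * h (real (Suc n) * (t - x))) *\<^sub>R F t) =
      (LINT s|lborel. h s *\<^sub>R F (x + (1 / real (Suc n)) * s))" for n
  proof -
    have "(LINT t|lebesgue. (real (Suc n) * h (real (Suc n) * (t - x))) *\<^sub>R F t) =
        (LINT t|lborel. (real (Suc n) * h (real (Suc n) * (t - x))) *\<^sub>R F t)"
      by (rule integral_completion) measurable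
    also have "\<dots> = \<bar>1 / real (Suc n)\<bar> *\<^sub>R (LINT s|lborel. (real (Suc n) *
        h (real (Suc n) * ((x + (1 / real (Suc n)) * s) - x))) *\<^sub>R F (x + (1 / real (Suc n)) * s))"
      by (rule lborel_integral_real_affine) simp
    also have "\<dots> = (LINT s|lborel. h s *\<^sub>R F (x + (1 / real (Suc n)) * s))"
      by (subst integral_scaleR_right[symmetric]) (auto intro!: Bochner_Integration.integral_cong simp del: of_nat_Suc)
    finally show ?thesis .
  qed
  have "(\<lambda>n. LINT s|lborel. h s *\<^sub>R F (x + (1 / real (Suc n)) * s)) \<longlonglongrightarrow> (LINT s|lborel. h s *\<^sub>R F x)"
  proof (rule integral_dominated_convergence[where w = "\<lambda>s. h s * B"])
    show "integrable lborel (\<lambda>s. h s * B)"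
      using h1 by (auto intro: has_bochner_integral_integrable simp: has_bochner_integral_iff)
    have "(\<lambda>n. F (x + (1 / real (Suc n)) * s)) \<longlonglongrightarrow> F x" for s
    proof -
      have "(\<lambda>n. x + (1 / real (Suc n)) * s) \<longlonglongrightarrow> x + 0 * s"
        using LIMSEQ_inverse_real_of_nat by (intro tendsto_intros) (simp add: inverse_eq_divide)
      then show ?thesis
        using F(1) by (intro isCont_tendsto_compose[of _ F]) (auto simp: continuous_on_eq_continuous_at)
    qed
    then show "AE s in lborel. (\<lambda>n. h s *\<^sub>R F (x + (1 / real (Suc n)) * s)) \<longlonglongrightarrow> h s *\<^sub>R F x"
      by (intro AE_I2 tendsto_intros)
    show "AE s in lborel. norm (h s *\<^sub>R F (x + (1 / real (Suc n)) * s)) \<le> h s * B" for n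
      using H(3) F(2) by (intro AE_I2) (auto intro!: mult_left_mono)
  qed measurable
  moreover have "(LINT s|lborel. h s *\<^sub>R F x) = F x"
    using h1 by (subst integral_scaleR_left) (auto simp: has_bochner_integral_iff)
  ultimately show ?thesis by (simp only: eq)
qed

text \<open>The du Bois-Reymond lemma. Testing the weak derivative with the smoothed indicator function of \<open>(x, y]\<close> gives, in the
  limit, \<open>f x - f y\<close> on one side and minus the integral of \<open>g\<close> over \<open>[x, y]\<close> on the other.\<close>

lemma weak_derivative_interior:
  fixes f g :: "real \<Rightarrow> 'a::euclidean_space"
  assumes f: "continuous_on {a..b} f" and g: "g \<in> borel_measurable lebesgue" "\<And>t. norm (g t) \<le> K"
    and wd: "has_weak_derivative a b f g" and xy: "a < x" "x < y" "y < b"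
  shows "f y - f x = (LINT r:{x..y}|lebesgue. g r)"
proof -
  obtain H h :: "real \<Rightarrow> real" where
    H: "\<And>x. (H has_real_derivative h x) (at x)" "\<And>a b. (\<lambda>x. h (a * x + b)) \<in> flat_algebra"
      "continuous_on UNIV h" "\<And>x. h x \<ge> 0" "\<And>x. x \<le> 0 \<or> x \<ge> 1 \<Longrightarrow> h x = 0"
      "\<And>x. x \<le> 0 \<Longrightarrow> H x = 0" "\<And>x. x \<ge> 1 \<Longrightarrow> H x = 1" "\<And>x. 0 \<le> H x" "\<And>x. H x \<le> 1"
    using smooth_step by blast
  define F where "F t = f (clip a b t)" for t
  have ab: "a \<le> b" using xy by simp
  have Fc: "continuous_on UNIV F" unfolding F_def using ab f by (rule continuous_on_comp_clip)
  obtain B where B: "\<And>t. norm (F t) \<le> B"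
    using continuous_on_Icc_bound[OF f] ab unfolding F_def by (meson atLeastAtMost_iff clip_bounds)
  have cH: "continuous_on UNIV H"
    using H(1) by (intro continuous_at_imp_continuous_on) (auto dest: DERIV_isCont)
  define N where "N n = real (Suc n)" for n
  have N: "N n > 0" for n by (simp add: N_def)
  \<comment> \<open>Smooth approximations of the indicator function of \<open>(x, y]\<close>, with ramps of width \<open>1 / N n\<close>.\<close>
  define \<phi> where "\<phi> n t = H (N n * (t - x)) - H (N n * (t - y))" for n t
  define \<phi>' where "\<phi>' n t = N n * h (N n * (t - x)) - N n * h (N n * (t - y))" for n t
  have d: "(\<phi> n has_real_derivative \<phi>' n t) (at t)" for n t
    unfolding \<phi>_def \<phi>'_def
    by (auto intro!: derivative_eq_intros DERIV_chain'[where g = H, OF _ H(1)])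
  have alg: "\<phi>' n \<in> flat_algebra" for n
  proof -
    have "(\<lambda>t. N n * h (N n * t + (- N n * x)) + - N n * h (N n * t + (- N n * y))) \<in> flat_algebra"
      by (intro flat_algebra.intros H)
    moreover have "\<phi>' n t = N n * h (N n * t + (- N n * x)) + - N n * h (N n * t + (- N n * y))" for t
      by (simp add: \<phi>'_def right_diff_distrib)
    ultimately show ?thesis by presburger
  qed
  have lim: "(\<lambda>n. 1 / N n) \<longlonglongrightarrow> 0"
    using LIMSEQ_inverse_real_of_nat by (simp add: N_def inverse_eq_divide)
  then have ev: "\<forall>\<^sub>F n in sequentially. 1 / N n < b - y"
    using xy by (intro order_tendstoD) auto
  have key: "- (LINT t:{a<..<b}|lebesgue. \<phi> n t *\<^sub>R g t) =
      (LINT t|lebesgue. (N n * h (N n * (t - x))) *\<^sub>R F t) - (LINT t|lebesgue. (N n * h (N n * (t - y))) *\<^sub>R F t)"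
    if n: "1 / N n < b - y" for n
  proof -
    have "test_function a b (\<phi> n)"
    proof (rule test_functionI[OF d alg])
      show "a < x" "y + 1 / N n < b" using xy n by auto
      fix t assume "t \<notin> {x..y + 1 / N n}"
      then consider "t < x" | "t > y + 1 / N n" by fastforce
      then show "\<phi> n t = 0"
      proof cases
        case 1
        then have "N n * (t - x) \<le> 0" "N n * (t - y) \<le> 0"
          using N[of n] xy by (auto intro!: mult_nonneg_nonpos)
        then show ?thesis by (simp add: \<phi>_def H)
      next
        case 2
        then have "N n * (t - y) \<ge> 1" using N[of n] by (simp add: field_simps)
        moreover have "N n * (t - x) \<ge> N n * (t - y)" using N[of n] xy by simp
        ultimately show ?thesis by (simp add: \<phi>_def H)
      qed
    qed
    then have "(LINT t:{a<..<b}|lebesgue. deriv (\<phi> n) t *\<^sub>R f t) = - (LINT t:{a<..<b}|lebesgue. \<phi> n t *\<^sub>R g t)"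
      using wd unfolding has_weak_derivative_def by blast
    moreover have "deriv (\<phi> n) = \<phi>' n" using d by (auto intro!: ext DERIV_imp_deriv)
    moreover have "(LINT t:{a<..<b}|lebesgue. \<phi>' n t *\<^sub>R f t) = (LINT t|lebesgue. \<phi>' n t *\<^sub>R F t)"
      unfolding set_lebesgue_integral_def
    proof (rule Bochner_Integration.integral_cong)
      fix t
      show "indicat_real {a<..<b} t *\<^sub>R \<phi>' n t *\<^sub>R f t = \<phi>' n t *\<^sub>R F t"
      proof (cases "t \<in> {a<..<b}")
        case True then show ?thesis by (simp add: F_def)
      next
        case False
        then consider "t \<le> a" | "t \<ge> b" by force
        then have "\<phi>' n t = 0"
        proof cases
          case 1
          then have "N n * (t - x) \<le> 0" "N n * (t - y) \<le> 0"
            using N[of n] xy by (auto intro!: mult_nonneg_nonpos)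
          then show ?thesis by (simp add: \<phi>'_def H)
        next
          case 2
          then have "t - y > 1 / N n" using n by simp
          then have "N n * (t - y) \<ge> 1" using N[of n] by (simp add: field_simps)
          moreover have "N n * (t - x) \<ge> N n * (t - y)" using N[of n] xy by simp
          ultimately show ?thesis by (simp add: \<phi>'_def H)
        qed
        then show ?thesis by simp
      qed
    qed simp
    moreover have "(LINT t|lebesgue. \<phi>' n t *\<^sub>R F t) =
        (LINT t|lebesgue. (N n * h (N n * (t - x))) *\<^sub>R F t) - (LINT t|lebesgue. (N n * h (N n * (t - y))) *\<^sub>R F t)"
    proof -
      have "integrable lebesgue (\<lambda>t. (N n * h (N n * (t - z))) *\<^sub>R F t)" for z
      proof -
        define k where "k t = (N n * h (N n * (t - z))) *\<^sub>R F t" for t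
        have kc: "continuous_on UNIV k" unfolding k_def
          by (intro continuous_intros Fc continuous_on_compose2[OF H(3)]) auto
        obtain M where "\<And>t. t \<in> {z..z + 1 / N n} \<Longrightarrow> norm (k t) \<le> M"
          using continuous_on_Icc_bound[OF continuous_on_subset[OF kc]] by blast
        then have "set_integrable lebesgue {z..z + 1 / N n} k"
          by (intro set_integrable_bounded[where K = M] continuous_imp_lebesgue_measurable kc) auto
        moreover have "indicator {z..z + 1 / N n} t *\<^sub>R k t = k t" for t
        proof (cases "t \<in> {z..z + 1 / N n}")
          case False
          then have "N n * (t - z) \<le> 0 \<or> N n * (t - z) \<ge> 1"
            using N[of n] by (auto simp: field_simps mult_le_0_iff)
          then show ?thesis by (auto simp: k_def H)
        qed simp
        ultimately have "integrable lebesgue k" unfolding set_integrable_def by simp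
        then show ?thesis by (simp add: k_def[abs_def])
      qed
      then show ?thesis
        by (subst Bochner_Integration.integral_diff[symmetric]) (auto simp: \<phi>'_def scaleR_diff_left)
    qed
    ultimately show ?thesis by simp
  qed
  have evq: "\<forall>\<^sub>F n in sequentially. (LINT t|lebesgue. (N n * h (N n * (t - x))) *\<^sub>R F t) -
      (LINT t|lebesgue. (N n * h (N n * (t - y))) *\<^sub>R F t) = - (LINT t:{a<..<b}|lebesgue. \<phi> n t *\<^sub>R g t)"
    using ev by eventually_elim (simp add: key)
  have "(\<lambda>n. (LINT t|lebesgue. (N n * h (N n * (t - x))) *\<^sub>R F t) -
      (LINT t|lebesgue. (N n * h (N n * (t - y))) *\<^sub>R F t)) \<longlonglongrightarrow> F x - F y"
    unfolding N_def using H(6)[of 0] H(7)[of 1]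
    by (intro tendsto_diff smooth_step_concentrates[OF Fc B H(1,3,4,5)]) auto
  then have l1: "(\<lambda>n. - (LINT t:{a<..<b}|lebesgue. \<phi> n t *\<^sub>R g t)) \<longlonglongrightarrow> F x - F y"
    by (rule Lim_transform_eventually[OF _ evq])
  have "(\<lambda>n. LINT t:{a<..<b}|lebesgue. \<phi> n t *\<^sub>R g t) \<longlonglongrightarrow> (LINT t:{x..y}|lebesgue. g t)"
    unfolding set_lebesgue_integral_def
  proof (rule integral_dominated_convergence[where w = "\<lambda>t. indicator {a<..<b} t * K"])
    have "continuous_on UNIV (\<phi> n)" for n
      using d by (intro continuous_at_imp_continuous_on) (auto dest: DERIV_isCont)
    then show "(\<lambda>t. indicat_real {a<..<b} t *\<^sub>R \<phi> n t *\<^sub>R g t) \<in> borel_measurable lebesgue" for n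
      by (intro borel_measurable_scaleR borel_measurable_indicator continuous_imp_lebesgue_measurable g) auto
    show "(\<lambda>t. indicat_real {x..y} t *\<^sub>R g t) \<in> borel_measurable lebesgue"
      by (intro borel_measurable_scaleR borel_measurable_indicator g) auto
    show "integrable lebesgue (\<lambda>t. indicator {a<..<b} t * K)"
      using xy by (intro integrable_mult_left integrable_real_indicator) auto
    have \<phi>1: "\<bar>\<phi> n t\<bar> \<le> 1" for n t
      using H(8,9)[of "N n * (t - x)"] H(8,9)[of "N n * (t - y)"] unfolding \<phi>_def by linarith
    show "AE t in lebesgue. norm (indicat_real {a<..<b} t *\<^sub>R \<phi> n t *\<^sub>R g t) \<le> indicator {a<..<b} t * K" for n
      using mult_mono[OF \<phi>1 g(2)] by (intro AE_I2) (simp add: indicator_def)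
    have "(\<lambda>n. indicat_real {a<..<b} t *\<^sub>R \<phi> n t *\<^sub>R g t) \<longlonglongrightarrow> indicat_real {x..y} t *\<^sub>R g t" if tx: "t \<noteq> x" for t
    proof -
      have large: "\<forall>\<^sub>F n in sequentially. H (N n * (t - z)) = 1" if "t > z" for z
      proof -
        have "\<forall>\<^sub>F n in sequentially. 1 / N n < t - z" using lim that by (intro order_tendstoD) auto
        then show ?thesis
        proof eventually_elim
          case (elim n)
          then have "1 < N n * (t - z)" using N[of n] by (simp add: field_simps)
          then show ?case by (intro H) simp
        qed
      qed
      have small: "H (N n * (t - z)) = 0" if "t \<le> z" for z n
        using that N[of n] by (intro H) (auto simp: mult_le_0_iff)
      consider "t < x" | "x < t" "t \<le> y" | "y < t" using tx by linarith
      then have "\<forall>\<^sub>F n in sequentially. \<phi> n t = indicat_real {x..y} t"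
      proof cases
        case 1 then show ?thesis using small xy by (simp add: \<phi>_def)
      next
        case 2
        show ?thesis using large[OF 2(1)] by eventually_elim (use 2 small[of y] in \<open>auto simp: \<phi>_def\<close>)
      next
        case 3
        have "x < t" using 3 xy by simp
        show ?thesis using large[OF 3] large[OF \<open>x < t\<close>]
          by eventually_elim (use 3 in \<open>auto simp: \<phi>_def\<close>)
      qed
      then have "\<forall>\<^sub>F n in sequentially. indicat_real {x..y} t *\<^sub>R g t = indicat_real {a<..<b} t *\<^sub>R \<phi> n t *\<^sub>R g t"
        by eventually_elim (use xy in \<open>auto simp: indicator_def\<close>)
      then show ?thesis by (rule tendsto_eventually[OF eventually_mono]) (rule sym)
    qed
    moreover have "AE t in lebesgue. t \<noteq> x" by (rule AE_I'[of "{x}"]) auto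
    ultimately show "AE t in lebesgue. (\<lambda>n. indicat_real {a<..<b} t *\<^sub>R \<phi> n t *\<^sub>R g t) \<longlonglongrightarrow> indicat_real {x..y} t *\<^sub>R g t"
      by (auto elim: eventually_mono)
  qed
  then have "(\<lambda>n. - (LINT t:{a<..<b}|lebesgue. \<phi> n t *\<^sub>R g t)) \<longlonglongrightarrow> - (LINT t:{x..y}|lebesgue. g t)"
    by (rule tendsto_minus)
  from LIMSEQ_unique[OF l1 this] have "f x - f y = - (LINT t:{x..y}|lebesgue. g t)"
    using xy by (simp add: F_def)
  then have "- (f x - f y) = (LINT t:{x..y}|lebesgue. g t)" by simp
  then show ?thesis by simp
qed

text \<open>This converts the definition by weak derivatives into bounded primitives. The end points are reached by
  continuity, and the representative of the derivative is changed on a null set to make the bound hold everywhere.\<close>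

lemma W1inf_primitive:
  fixes f g :: "real \<Rightarrow> 'a::euclidean_space"
  assumes W: "W1inf a b f g" and "a < b" "K \<ge> 0" and gK: "AE x in lebesgue_on {a<..<b}. norm (g x) \<le> K"
  obtains g' where "bounded_primitive K (\<lambda>x. f (clip a b x)) g'" "\<And>x. x \<notin> {a<..<b} \<Longrightarrow> g' x = 0"
    "AE x in lebesgue. x \<in> {a<..<b} \<longrightarrow> g' x = g x"
proof -
  have f: "continuous_on {a..b} f" and wd: "has_weak_derivative a b f g"
    and gm: "g \<in> borel_measurable (lebesgue_on {a<..<b})"
    using W by (auto simp: W1inf_def Linf_on_def)
  define g0 where "g0 x = (if x \<in> {a<..<b} then g x else 0)" for x
  have g0m: "g0 \<in> borel_measurable lebesgue"
    unfolding g0_def[abs_def] using gm by (subst borel_measurable_if) auto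
  define g' where "g' x = (if norm (g0 x) \<le> K then g0 x else 0)" for x
  have g'm: "g' \<in> borel_measurable lebesgue"
    unfolding g'_def[abs_def] using g0m by measurable
  have g'K: "norm (g' x) \<le> K" for x using \<open>K \<ge> 0\<close> by (simp add: g'_def)
  have ae: "AE x in lebesgue. x \<in> {a<..<b} \<longrightarrow> g' x = g x"
    using gK by (simp add: AE_restrict_space_iff) (auto elim!: eventually_mono simp: g'_def g0_def)
  have "has_weak_derivative a b f g'"
    unfolding has_weak_derivative_def
  proof (intro allI impI)
    fix \<phi> assume t: "test_function a b \<phi>"
    have "continuous_on UNIV \<phi>"
      using test_functionD(1)[OF t] \<open>a < b\<close>
      by (intro continuous_at_imp_continuous_on) (auto dest: DERIV_isCont)
    note cm = continuous_imp_lebesgue_measurable[OF this]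
    have "(LINT x:{a<..<b}|lebesgue. \<phi> x *\<^sub>R g0 x) = (LINT x:{a<..<b}|lebesgue. \<phi> x *\<^sub>R g' x)"
    proof (rule set_lebesgue_integral_cong_AE)
      show "AE x\<in>{a<..<b} in lebesgue. \<phi> x *\<^sub>R g0 x = \<phi> x *\<^sub>R g' x"
        using ae by eventually_elim (auto simp: g0_def)
    qed (auto intro!: cm g'm g0m borel_measurable_scaleR)
    moreover have "(LINT x:{a<..<b}|lebesgue. \<phi> x *\<^sub>R g0 x) = (LINT x:{a<..<b}|lebesgue. \<phi> x *\<^sub>R g x)"
      by (rule set_lebesgue_integral_cong) (auto simp: g0_def)
    ultimately show "(LINT x:{a<..<b}|lebesgue. deriv \<phi> x *\<^sub>R f x) = - (LINT x:{a<..<b}|lebesgue. \<phi> x *\<^sub>R g' x)"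
      using wd t unfolding has_weak_derivative_def by simp
  qed
  note int = weak_derivative_interior[OF f g'm g'K this]
  define I where "I x = (LINT r:{a..x}|lebesgue. g' r)" for x
  have g'i: "set_integrable lebesgue {x..y} g'" for x y
    by (rule set_integrable_bounded[OF g'm g'K]) auto
  have Id: "I y - I x = (LINT r:{x..y}|lebesgue. g' r)" if "a \<le> x" "x \<le> y" for x y
    unfolding I_def using set_integral_Icc_add[OF g'i, of a x y] that by simp
  have "norm (I y - I x) \<le> K * \<bar>y - x\<bar>" if "a \<le> x" "a \<le> y" for x y
    using Id[of x y] Id[of y x] norm_set_integral_Icc_le[OF g'm g'K, of x y]
      norm_set_integral_Icc_le[OF g'm g'K, of y x] that
    by (cases "x \<le> y") (auto simp: norm_minus_commute[of "I y" "I x"])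
  then have "K-lipschitz_on {a..b} I"
    using \<open>K \<ge> 0\<close> by (auto simp: lipschitz_on_def dist_norm)
  then have Ic: "continuous_on {a..b} I" by (rule lipschitz_on_continuous_on)
  define m where "m = (a + b) / 2"
  have m: "a < m" "m < b" using \<open>a < b\<close> by (auto simp: m_def)
  have const: "f x - I x = f m - I m" if "x \<in> {a<..<b}" for x
    using int[of x m] int[of m x] Id[of x m] Id[of m x] m that
    by (cases x m rule: linorder_cases) (auto simp: algebra_simps)
  have const': "f x - I x = f m - I m" if "x \<in> {a..b}" for x
    using continuous_constant_on_closure[of "{a<..<b}" "\<lambda>x. f x - I x" "f m - I m" x] const that \<open>a < b\<close>
    by (simp add: continuous_on_diff f Ic)
  have "bounded_primitive K (\<lambda>x. f (clip a b x)) (\<lambda>x. if x \<in> {a<..<b} then g' x else 0)"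
  proof (rule clip_primitive)
    show "f y - f x = (LINT r:{x..y}|lebesgue. g' r)" if "a \<le> x" "x \<le> y" "y \<le> b" for x y
    proof -
      have "f x - I x = f y - I y" using const'[of x] const'[of y] that by simp
      then have "f y - f x = I y - I x" by (simp add: algebra_simps)
      then show ?thesis using Id that by simp
    qed
    show "(\<lambda>x. if x \<in> {a<..<b} then g' x else 0) \<in> borel_measurable lebesgue"
      by (intro measurable_If_set g'm) auto
  qed (use assms g'K in auto)
  moreover have "(\<lambda>x. if x \<in> {a<..<b} then g' x else 0) = g'"
    using \<open>K \<ge> 0\<close> by (auto simp: g'_def g0_def)
  ultimately have "bounded_primitive K (\<lambda>x. f (clip a b x)) g'" by simp
  moreover have "g' x = 0" if "x \<notin> {a<..<b}" for x using that by (auto simp: g'_def g0_def)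
  ultimately show ?thesis using that ae by blast
qed

section \<open>Weak-star convergence of bounded functions\<close>

text \<open>A Dynkin system argument. The uniform bound dominates the tails of countable disjoint unions, so that Tannery's theorem
  applies; completion then reaches all Lebesgue sets.\<close>

lemma interval_integrals_tendsto_imp_set_integrals_tendsto:
  fixes k :: "nat \<Rightarrow> real \<Rightarrow> real"
  assumes k: "\<And>n. k n \<in> borel_measurable lebesgue" "\<And>n x. \<bar>k n x\<bar> \<le> K"
    and l: "l \<in> borel_measurable lebesgue" "\<And>x. \<bar>l x\<bar> \<le> K"
    and lim: "\<And>x y. x \<le> y \<Longrightarrow> (\<lambda>n. LINT r:{x..y}|lebesgue. k n r) \<longlonglongrightarrow> (LINT r:{x..y}|lebesgue. l r)"
    and A: "A \<in> sets lebesgue"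
  shows "(\<lambda>n. LINT r:A \<inter> {a..b}|lebesgue. k n r) \<longlonglongrightarrow> (LINT r:A \<inter> {a..b}|lebesgue. l r)"
proof -
  have K: "K \<ge> 0" using k(2)[of 0 0] by simp
  have int: "set_integrable lebesgue B (k n)" "set_integrable lebesgue B l" if "B \<in> lmeasurable" for B n
    by (rule set_integrable_bounded[where K = K]; use k l that in simp)+
  have lm: "B \<inter> {a..b} \<in> lmeasurable" if "B \<in> sets lebesgue" for B
    using that by (rule fmeasurable_Int_fmeasurable[OF _ _, of "{a..b}", unfolded Int_commute[of "{a..b}"], rotated]) auto
  have borel: "(\<lambda>n. LINT r:B \<inter> {a..b}|lebesgue. k n r) \<longlonglongrightarrow> (LINT r:B \<inter> {a..b}|lebesgue. l r)"
    if B: "B \<in> sets borel" for B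
  proof -
    let ?G = "range (\<lambda>(a, b). {a..b::real})"
    have b: "sets borel = sigma_sets UNIV ?G"
      by (subst borel_eq_atLeastAtMost) simp
    have Is: "Int_stable ?G"
      by (auto simp: Int_stable_def)
    have B': "B \<in> sigma_sets UNIV ?G" using B by (simp add: b)
    have sub: "?G \<subseteq> Pow UNIV" by simp
    from Is sub B' show ?thesis
    proof (induction rule: sigma_sets_induct_disjoint)
      case (basic A)
      then obtain x y where "A = {x..y}" by auto
      then have "A \<inter> {a..b} = {max x a..min y b}" by auto
      then show ?case using lim[of "max x a" "min y b"] by (cases "max x a \<le> min y b") auto
    next
      case empty
      show ?case by simp
    next
      case (compl A)
      then have Am: "A \<in> sets lebesgue" by (simp flip: b)
      have eq: "(LINT r:(UNIV - A) \<inter> {a..b}|lebesgue. h r) =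
          (LINT r:{a..b}|lebesgue. h r) - (LINT r:A \<inter> {a..b}|lebesgue. h r)"
        if h: "\<And>B. B \<in> lmeasurable \<Longrightarrow> set_integrable lebesgue B h" for h :: "real \<Rightarrow> real"
      proof -
        have "(LINT r:(UNIV - A) \<inter> {a..b} \<union> A \<inter> {a..b}|lebesgue. h r) =
            (LINT r:(UNIV - A) \<inter> {a..b}|lebesgue. h r) + (LINT r:A \<inter> {a..b}|lebesgue. h r)"
          using Am by (intro set_integral_Un h lm) auto
        moreover have "(UNIV - A) \<inter> {a..b} \<union> A \<inter> {a..b} = {a..b}" by auto
        ultimately show ?thesis by simp
      qed
      have whole: "(\<lambda>n. LINT r:{a..b}|lebesgue. k n r) \<longlonglongrightarrow> (LINT r:{a..b}|lebesgue. l r)"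
        using lim[of a b] by (cases "a \<le> b") auto
      show ?case
        unfolding eq[of "k _", OF int(1), simplified] eq[of l, OF int(2), simplified]
        by (rule tendsto_diff[OF whole compl.IH])
    next
      case (union A)
      then have Am: "A i \<in> sets borel" for i by (auto simp: b)
      then have Aml: "A i \<in> sets lebesgue" for i by simp
      let ?A = "\<lambda>i. A i \<inter> {a..b}"
      have disj: "disjoint_family ?A"
        using union.hyps(1) by (auto simp: disjoint_family_on_def)
      have U: "(\<Union>i. A i) \<inter> {a..b} = (\<Union>i. ?A i)" by auto
      have eq: "(LINT r:(\<Union>i. A i) \<inter> {a..b}|lebesgue. h r) = (\<Sum>i. LINT r:?A i|lebesgue. h r)"
        if h: "\<And>B. B \<in> lmeasurable \<Longrightarrow> set_integrable lebesgue B h" for h :: "real \<Rightarrow> real"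
        unfolding U
      proof (rule lebesgue_integral_countable_add)
        show "set_integrable lebesgue (\<Union>i. ?A i) h"
          unfolding U[symmetric] by (intro h lm sets.countable_UN) (use Aml in auto)
      qed (use Aml disj in \<open>auto simp: disjoint_family_on_def\<close>)
      have bound: "\<bar>LINT r:?A i|lebesgue. k n r\<bar> \<le> K * measure lebesgue (?A i)" for n i
      proof -
        have "\<bar>LINT r:?A i|lebesgue. k n r\<bar> \<le> (LINT r|lebesgue. norm (indicator (?A i) r *\<^sub>R k n r))"
          unfolding set_lebesgue_integral_def using integral_norm_bound by force
        also have "\<dots> \<le> (LINT r|lebesgue. indicator (?A i) r * K)"
          using int(1)[OF lm[OF Aml[of i]]] lm[OF Aml[of i]] k(2)
          by (intro integral_mono integrable_norm integrable_mult_left integrable_real_indicator)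
             (auto simp: set_integrable_def indicator_def fmeasurable_def)
        finally show ?thesis using Aml[of i] by (simp add: mult.commute)
      qed
      have sm: "summable (\<lambda>i. K * measure lebesgue (?A i))"
      proof (intro summable_mult sums_summable[OF measure_UNION])
        show "emeasure lebesgue (\<Union>i. ?A i) \<noteq> \<infinity>"
          unfolding U[symmetric] using lm[of "\<Union>i. A i"] Aml by (auto simp: fmeasurable_def)
      qed (use Aml disj in auto)
      have ev: "\<forall>\<^sub>F (i, n) in sequentially \<times>\<^sub>F sequentially.
          norm (LINT r:?A i|lebesgue. k n r) \<le> K * measure lebesgue (?A i)"
        using bound by (intro always_eventually) auto
      show ?case
        unfolding eq[of "k _", OF int(1), simplified] eq[of l, OF int(2), simplified]
        by (rule conjunct2[OF conjunct2[OF tannerys_theorem[OF union.IH ev sm]]]) simp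
    qed
  qed
  obtain S N N' where S: "A = S \<union> N" "N \<subseteq> N'" "N' \<in> null_sets lborel" "S \<in> sets lborel"
    using sets_completionE[OF A] by blast
  have ae: "AE x in lebesgue. x \<in> S \<inter> {a..b} \<longleftrightarrow> x \<in> A \<inter> {a..b}"
  proof -
    have "AE x in lebesgue. x \<notin> N'" using S(3) by (intro AE_not_in) (auto intro: null_sets_completionI)
    then show ?thesis by eventually_elim (use S in auto)
  qed
  have eq: "(LINT r:A \<inter> {a..b}|lebesgue. h r) = (LINT r:S \<inter> {a..b}|lebesgue. h r)"
    if h: "h \<in> borel_measurable lebesgue" for h :: "real \<Rightarrow> real"
    using A S(4) h ae
    by (intro set_integral_cong_set)
       (auto simp: set_borel_measurable_def intro!: borel_measurable_times borel_measurable_indicator)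
  show ?thesis unfolding eq[OF k(1)] eq[OF l(1)] using S by (intro borel) simp
qed

lemma integrable_bounded_inner:
  fixes g \<psi> :: "real \<Rightarrow> 'a::euclidean_space"
  assumes g: "g \<in> borel_measurable lebesgue" "\<And>x. norm (g x) \<le> K" and \<psi>: "integrable lebesgue \<psi>"
    and A: "A \<in> sets lebesgue"
  shows "set_integrable lebesgue A (\<lambda>x. g x \<bullet> \<psi> x)"
    "\<bar>LINT x:A|lebesgue. g x \<bullet> \<psi> x\<bar> \<le> K * (LINT x|lebesgue. norm (\<psi> x))"
proof -
  have b: "norm (indicat_real A x *\<^sub>R (g x \<bullet> \<psi> x)) \<le> K * norm (\<psi> x)" for x
    using Cauchy_Schwarz_ineq2[of "g x" "\<psi> x"] mult_right_mono[OF g(2)[of x] norm_ge_zero[of "\<psi> x"]]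
    by (auto simp: indicator_def intro: order_trans[OF abs_ge_zero])
  show i: "set_integrable lebesgue A (\<lambda>x. g x \<bullet> \<psi> x)"
    unfolding set_integrable_def
    by (rule Bochner_Integration.integrable_bound[of _ "\<lambda>x. K * norm (\<psi> x)"])
       (use g \<psi> A b order_trans[OF norm_ge_zero g(2)] in \<open>auto intro!: borel_measurable_times borel_measurable_indicator borel_measurable_inner AE_I2 integrable_norm\<close>)
  have "\<bar>LINT x:A|lebesgue. g x \<bullet> \<psi> x\<bar> \<le> (LINT x|lebesgue. norm (indicat_real A x *\<^sub>R (g x \<bullet> \<psi> x)))"
    unfolding set_lebesgue_integral_def using integral_norm_bound by force
  also have "\<dots> \<le> (LINT x|lebesgue. K * norm (\<psi> x))"
    using i \<psi> b unfolding set_integrable_def by (intro integral_mono integrable_norm) auto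
  finally show "\<bar>LINT x:A|lebesgue. g x \<bullet> \<psi> x\<bar> \<le> K * (LINT x|lebesgue. norm (\<psi> x))" by simp
qed

text \<open>Pointwise convergence of the primitives is convergence of the integrals of the derivatives over intervals, hence over
  measurable sets, hence against every integrable function.\<close>

lemma weak_star_Linf_primitives:
  fixes f g :: "nat \<Rightarrow> real \<Rightarrow> 'a::euclidean_space"
  assumes f: "\<And>n. bounded_primitive K (f n) (g n)" and l: "bounded_primitive K fl gl"
    and lim: "\<And>x. (\<lambda>n. f n x) \<longlonglongrightarrow> fl x"
  shows "weak_star_Linf a b g gl"
  unfolding weak_star_Linf_def
proof (intro allI impI)
  fix \<psi> :: "real \<Rightarrow> 'a" assume "L1_on a b \<psi>"
  then have \<psi>: "integrable lebesgue (\<lambda>x. indicator {a<..<b} x *\<^sub>R \<psi> x)"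
    by (simp add: L1_on_def set_integrable_def)
  note fD = bounded_primitiveD[OF f] and lD = bounded_primitiveD[OF l]
  have "(\<lambda>n. LINT x:{a<..<b}|lebesgue. g n x \<bullet> (indicator {a<..<b} x *\<^sub>R \<psi> x))
     \<longlonglongrightarrow> (LINT x:{a<..<b}|lebesgue. gl x \<bullet> (indicator {a<..<b} x *\<^sub>R \<psi> x))"
    using \<psi>
  proof induction
    case (base A c)
    have ib: "\<bar>h x \<bullet> c\<bar> \<le> K * norm c" if "norm (h x) \<le> K" for h :: "real \<Rightarrow> 'a" and x
      by (rule order_trans[OF Cauchy_Schwarz_ineq2 mult_right_mono[OF that]]) simp
    have "(\<lambda>n. LINT r:A \<inter> {a..b}|lebesgue. g n r \<bullet> c) \<longlonglongrightarrow> (LINT r:A \<inter> {a..b}|lebesgue. gl r \<bullet> c)"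
    proof (rule interval_integrals_tendsto_imp_set_integrals_tendsto[where K = "K * norm c"])
      fix x y :: real assume xy: "x \<le> y"
      have eq: "(LINT r:{x..y}|lebesgue. h' r \<bullet> c) = (h y - h x) \<bullet> c"
        if h: "bounded_primitive K h h'" for h h' :: "real \<Rightarrow> 'a"
        unfolding bounded_primitiveD(4)[OF h xy]
        using bounded_primitiveD(7)[OF h, of "{x..y}"]
        unfolding set_lebesgue_integral_def set_integrable_def
        by (subst integral_inner_left[symmetric]) auto
      show "(\<lambda>n. LINT r:{x..y}|lebesgue. g n r \<bullet> c) \<longlonglongrightarrow> (LINT r:{x..y}|lebesgue. gl r \<bullet> c)"
        unfolding eq[OF f] eq[OF l] by (intro tendsto_intros lim)
    qed (use base fD(1,2) lD(1,2) ib in auto)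
    moreover have "(LINT x:{a<..<b}|lebesgue. h x \<bullet> (indicat_real A x *\<^sub>R c)) = (LINT r:A \<inter> {a..b}|lebesgue. h r \<bullet> c)"
      for h :: "real \<Rightarrow> 'a"
      unfolding set_lebesgue_integral_def
      by (rule integral_discrete_difference[of "{a, b}"]) (auto simp: indicator_def)
    ultimately show ?case by simp
  next
    case (add p q)
    have "(LINT x:{a<..<b}|lebesgue. h' x \<bullet> (p x + q x)) =
        (LINT x:{a<..<b}|lebesgue. h' x \<bullet> p x) + (LINT x:{a<..<b}|lebesgue. h' x \<bullet> q x)"
      if h: "bounded_primitive K h h'" for h h' :: "real \<Rightarrow> 'a"
      unfolding inner_add_right
      by (intro set_integral_add integrable_bounded_inner[OF bounded_primitiveD(1,2)[OF h]] add.hyps) auto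
    note eq = this
    show ?case unfolding eq[OF f] eq[OF l] by (intro tendsto_add add.IH)
  next
    case (lim p s)
    have d: "(\<lambda>i. LINT x|lebesgue. norm (s i x - p x)) \<longlonglongrightarrow> integral\<^sup>L lebesgue (\<lambda>x::real. 0)"
    proof (rule integral_dominated_convergence[where w = "\<lambda>x. 3 * norm (p x)"])
      have "norm (s i x - p x) \<le> 3 * norm (p x)" for i x
        using norm_triangle_ineq4[of "s i x" "p x"] lim.hyps(3)[of x i] by simp
      then show "AE x in lebesgue. norm (norm (s i x - p x)) \<le> 3 * norm (p x)" for i by simp
      show "AE x in lebesgue. (\<lambda>i. norm (s i x - p x)) \<longlonglongrightarrow> 0"
        using lim.hyps(2) by (intro AE_I2 tendsto_norm_zero) (simp add: LIM_zero)
    qed (use lim.hyps in auto)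
    have diff: "\<bar>(LINT x:{a<..<b}|lebesgue. h' x \<bullet> s i x) - (LINT x:{a<..<b}|lebesgue. h' x \<bullet> p x)\<bar>
        \<le> K * (LINT x|lebesgue. norm (s i x - p x))"
      if h: "bounded_primitive K h h'" for h h' :: "real \<Rightarrow> 'a" and i
    proof -
      note ib = integrable_bounded_inner[OF bounded_primitiveD(1,2)[OF h]]
      have "(LINT x:{a<..<b}|lebesgue. h' x \<bullet> s i x) - (LINT x:{a<..<b}|lebesgue. h' x \<bullet> p x) =
          (LINT x:{a<..<b}|lebesgue. h' x \<bullet> (s i x - p x))"
        unfolding inner_diff_right
        by (rule set_integral_diff(2)[symmetric]; intro ib lim.hyps) auto
      also have "\<bar>\<dots>\<bar> \<le> K * (LINT x|lebesgue. norm (s i x - p x))"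
        by (intro ib(2) Bochner_Integration.integrable_diff lim.hyps) auto
      finally show ?thesis .
    qed
    show ?case
    proof (rule LIMSEQ_I)
      fix e :: real assume "e > 0"
      have "(\<lambda>i. K * (LINT x|lebesgue. norm (s i x - p x))) \<longlonglongrightarrow> K * 0"
        using d by (intro tendsto_intros) simp
      then have "\<forall>\<^sub>F i in sequentially. K * (LINT x|lebesgue. norm (s i x - p x)) < e / 3"
        using \<open>e > 0\<close> by (intro order_tendstoD) auto
      then obtain i where i: "K * (LINT x|lebesgue. norm (s i x - p x)) < e / 3"
        by (auto simp: eventually_sequentially)
      obtain N where N: "\<And>n. n \<ge> N \<Longrightarrow> \<bar>(LINT x:{a<..<b}|lebesgue. g n x \<bullet> s i x) -
          (LINT x:{a<..<b}|lebesgue. gl x \<bullet> s i x)\<bar> < e / 3"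
        using LIMSEQ_D[OF lim.IH[of i], of "e / 3"] \<open>e > 0\<close> by auto
      show "\<exists>N. \<forall>n\<ge>N. norm ((LINT x:{a<..<b}|lebesgue. g n x \<bullet> p x) - (LINT x:{a<..<b}|lebesgue. gl x \<bullet> p x)) < e"
      proof (intro exI[of _ N] allI impI)
        fix n assume "n \<ge> N"
        then show "norm ((LINT x:{a<..<b}|lebesgue. g n x \<bullet> p x) - (LINT x:{a<..<b}|lebesgue. gl x \<bullet> p x)) < e"
          using N[of n] diff[OF f, of n i] diff[OF l, of i] i unfolding real_norm_def by linarith
      qed
    qed
  qed
  moreover have "(LINT x:{a<..<b}|lebesgue. h x \<bullet> (indicat_real {a<..<b} x *\<^sub>R \<psi> x)) =
      (LINT x:{a<..<b}|lebesgue. h x \<bullet> \<psi> x)" for h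
    by (rule set_lebesgue_integral_cong) auto
  ultimately show "(\<lambda>n. LINT x:{a<..<b}|lebesgue. g n x \<bullet> \<psi> x) \<longlonglongrightarrow> (LINT x:{a<..<b}|lebesgue. gl x \<bullet> \<psi> x)"
    by simp
qed

text \<open>The product of a bounded weak-star convergent and a boundedly pointwise convergent sequence.\<close>

lemma weak_star_Linf_times_strong:
  fixes g \<psi> :: "nat \<Rightarrow> real \<Rightarrow> 'a::euclidean_space"
  assumes w: "weak_star_Linf a b g gl" and g: "\<And>n. g n \<in> borel_measurable lebesgue" "\<And>n x. norm (g n x) \<le> K"
    and \<psi>: "\<And>n. \<psi> n \<in> borel_measurable lebesgue" "\<And>n x. x \<in> {a<..<b} \<Longrightarrow> norm (\<psi> n x) \<le> B"
    and \<psi>l: "\<psi>l \<in> borel_measurable lebesgue"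
    and lim: "\<And>x. x \<in> {a<..<b} \<Longrightarrow> (\<lambda>n. \<psi> n x) \<longlonglongrightarrow> \<psi>l x"
  shows "(\<lambda>n. LINT x:{a<..<b}|lebesgue. g n x \<bullet> \<psi> n x) \<longlonglongrightarrow> (LINT x:{a<..<b}|lebesgue. gl x \<bullet> \<psi>l x)"
proof -
  define p where "p n x = indicator {a<..<b} x *\<^sub>R \<psi> n x" for n x
  define pl where "pl x = indicator {a<..<b} x *\<^sub>R \<psi>l x" for x
  have \<psi>lB: "norm (\<psi>l x) \<le> B" if "x \<in> {a<..<b}" for x
    by (rule Lim_bounded[OF tendsto_norm[OF lim[OF that]]]) (use \<psi>(2) that in auto)
  have pi: "integrable lebesgue (p n)" for n
    using set_integrable_bounded[OF \<psi>, of "{a<..<b}"] by (simp add: set_integrable_def p_def[abs_def])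
  have pli: "integrable lebesgue pl"
    using set_integrable_bounded[OF \<psi>l \<psi>lB, of "{a<..<b}"] by (simp add: set_integrable_def pl_def[abs_def])
  have "(\<lambda>n. LINT x:{a<..<b}|lebesgue. g n x \<bullet> \<psi>l x) \<longlonglongrightarrow> (LINT x:{a<..<b}|lebesgue. gl x \<bullet> \<psi>l x)"
    using w pli unfolding weak_star_Linf_def L1_on_def set_integrable_def pl_def[abs_def] by blast
  moreover have "(\<lambda>n. LINT x:{a<..<b}|lebesgue. g n x \<bullet> (p n x - pl x)) \<longlonglongrightarrow> 0"
  proof (rule Lim_null_comparison)
    show "\<forall>\<^sub>F n in sequentially. norm (LINT x:{a<..<b}|lebesgue. g n x \<bullet> (p n x - pl x))
        \<le> K * (LINT x|lebesgue. norm (p n x - pl x))"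
      unfolding real_norm_def
      by (intro always_eventually allI integrable_bounded_inner g Bochner_Integration.integrable_diff pi pli) auto
    have "(\<lambda>n. LINT x|lebesgue. norm (p n x - pl x)) \<longlonglongrightarrow> integral\<^sup>L lebesgue (\<lambda>x::real. 0)"
    proof (rule integral_dominated_convergence[where w = "\<lambda>x. indicator {a<..<b} x * (2 * B)"])
      show "AE x in lebesgue. (\<lambda>n. norm (p n x - pl x)) \<longlonglongrightarrow> 0"
        using lim by (intro AE_I2 tendsto_norm_zero) (auto simp: p_def pl_def LIM_zero indicator_def)
      show "AE x in lebesgue. norm (norm (p n x - pl x)) \<le> indicator {a<..<b} x * (2 * B)" for n
      proof (rule AE_I2)
        fix x show "norm (norm (p n x - pl x)) \<le> indicator {a<..<b} x * (2 * B)"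
          using \<psi>(2)[of x n] \<psi>lB[of x] norm_triangle_ineq4[of "\<psi> n x" "\<psi>l x"]
          by (cases "x \<in> {a<..<b}") (auto simp: p_def pl_def)
      qed
    qed (use pi pli integrable_indicator_Ioo in auto)
    then have "(\<lambda>n. K * (LINT x|lebesgue. norm (p n x - pl x))) \<longlonglongrightarrow> K * 0"
      by (intro tendsto_intros) simp
    then show "(\<lambda>n. K * (LINT x|lebesgue. norm (p n x - pl x))) \<longlonglongrightarrow> 0" by simp
  qed
  ultimately have "(\<lambda>n. (LINT x:{a<..<b}|lebesgue. g n x \<bullet> \<psi>l x) + (LINT x:{a<..<b}|lebesgue. g n x \<bullet> (p n x - pl x)))
      \<longlonglongrightarrow> (LINT x:{a<..<b}|lebesgue. gl x \<bullet> \<psi>l x) + 0" by (rule tendsto_add)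
  moreover have "(LINT x:{a<..<b}|lebesgue. g n x \<bullet> \<psi>l x) + (LINT x:{a<..<b}|lebesgue. g n x \<bullet> (p n x - pl x)) =
      (LINT x:{a<..<b}|lebesgue. g n x \<bullet> \<psi> n x)" for n
  proof -
    have "(LINT x:{a<..<b}|lebesgue. g n x \<bullet> \<psi>l x) = (LINT x:{a<..<b}|lebesgue. g n x \<bullet> pl x)"
      "(LINT x:{a<..<b}|lebesgue. g n x \<bullet> \<psi> n x) = (LINT x:{a<..<b}|lebesgue. g n x \<bullet> pl x + g n x \<bullet> (p n x - pl x))"
      by (rule set_lebesgue_integral_cong; simp add: p_def pl_def inner_diff_right)+
    then show ?thesis
      by (simp add: set_integral_add integrable_bounded_inner[OF g] pi pli)
  qed
  ultimately show ?thesis by simp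
qed

lemma weak_star_Linf_times_strong_set:
  fixes g \<psi> :: "nat \<Rightarrow> real \<Rightarrow> 'a::euclidean_space"
  assumes w: "weak_star_Linf a b g gl" and g: "\<And>n. g n \<in> borel_measurable lebesgue" "\<And>n x. norm (g n x) \<le> K"
    and \<psi>: "\<And>n. \<psi> n \<in> borel_measurable lebesgue" "\<And>n x. x \<in> {a<..<b} \<Longrightarrow> norm (\<psi> n x) \<le> B"
    and \<psi>l: "\<psi>l \<in> borel_measurable lebesgue"
    and lim: "\<And>x. x \<in> {a<..<b} \<Longrightarrow> (\<lambda>n. \<psi> n x) \<longlonglongrightarrow> \<psi>l x"
    and A: "A \<in> sets lebesgue" "A \<subseteq> {a..b}"
  shows "(\<lambda>n. LINT x:A|lebesgue. g n x \<bullet> \<psi> n x) \<longlonglongrightarrow> (LINT x:A|lebesgue. gl x \<bullet> \<psi>l x)"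
proof -
  have "(\<lambda>n. LINT x:{a<..<b}|lebesgue. g n x \<bullet> (indicat_real A x *\<^sub>R \<psi> n x))
      \<longlonglongrightarrow> (LINT x:{a<..<b}|lebesgue. gl x \<bullet> (indicat_real A x *\<^sub>R \<psi>l x))"
  proof (rule weak_star_Linf_times_strong[OF w g, where B = "\<bar>B\<bar>"])
    show "norm (indicat_real A x *\<^sub>R \<psi> n x) \<le> \<bar>B\<bar>" if "x \<in> {a<..<b}" for n x
      using \<psi>(2)[OF that, of n] by (auto simp: indicator_def)
  qed (use \<psi>(1) \<psi>l lim A in \<open>auto intro!: borel_measurable_scaleR borel_measurable_indicator tendsto_intros\<close>)
  moreover have "(LINT x:{a<..<b}|lebesgue. h x \<bullet> (indicat_real A x *\<^sub>R k x)) = (LINT x:A|lebesgue. h x \<bullet> k x)"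
    for h k :: "real \<Rightarrow> 'a"
    unfolding set_lebesgue_integral_def
    by (rule integral_discrete_difference[of "{a, b}"]) (use A in \<open>auto simp: indicator_def\<close>)
  ultimately show ?thesis by simp
qed

lemma W1inf_cong:
  assumes "\<And>x. x \<in> {a..b} \<Longrightarrow> f x = f' x" "W1inf a b f g"
  shows "W1inf a b f' g"
proof -
  have "continuous_on {a..b} f'"
    using assms(2) continuous_on_cong[of "{a..b}" "{a..b}" f f', OF refl assms(1)] by (simp add: W1inf_def)
  moreover have "Linf_on a b f'"
  proof -
    have "f \<in> borel_measurable (lebesgue_on {a<..<b})" using assms(2) by (simp add: W1inf_def Linf_on_def)
    then have "f' \<in> borel_measurable (lebesgue_on {a<..<b})"
      by (rule measurable_cong[THEN iffD1, rotated]) (use assms(1) in \<open>auto simp: space_restrict_space\<close>)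
    moreover obtain C where "AE x in lebesgue_on {a<..<b}. norm (f x) \<le> C"
      using assms(2) by (auto simp: W1inf_def Linf_on_def)
    then have "AE x in lebesgue_on {a<..<b}. norm (f' x) \<le> C"
      by (rule lebesgue_on_mono) (use assms(1) in auto)
    ultimately show ?thesis by (auto simp: Linf_on_def)
  qed
  moreover have "(LINT x:{a<..<b}|lebesgue. deriv \<phi> x *\<^sub>R f x) = (LINT x:{a<..<b}|lebesgue. deriv \<phi> x *\<^sub>R f' x)" for \<phi>
    by (rule set_lebesgue_integral_cong) (use assms in auto)
  ultimately show ?thesis using assms(2) by (simp add: W1inf_def has_weak_derivative_def)
qed

lemma weak_star_W1inf_pointwise:
  fixes f g :: "nat \<Rightarrow> real \<Rightarrow> 'a::euclidean_space"
  assumes f: "\<And>n. bounded_primitive K (f n) (g n)" and l: "bounded_primitive K fl gl"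
    and lim: "\<And>x. (\<lambda>n. f n x) \<longlonglongrightarrow> fl x" and B: "\<And>n x. norm (f n x) \<le> B" and "a \<le> b"
    and f': "\<And>n x. x \<in> {a..b} \<Longrightarrow> f' n x = f n x"
  shows "weak_star_W1inf a b f' fl"
  unfolding weak_star_W1inf_def
proof (rule exI[of _ g], rule exI[of _ gl], intro conjI allI)
  show "W1inf a b (f' n) (g n)" for n
    by (rule W1inf_cong[OF _ bounded_primitive_imp_W1inf[OF f \<open>a \<le> b\<close>]]) (simp add: f')
  show "W1inf a b fl gl" by (rule bounded_primitive_imp_W1inf[OF l \<open>a \<le> b\<close>])
  show "weak_star_Linf a b g gl" by (rule weak_star_Linf_primitives[OF f l lim])
  show "weak_star_Linf a b f' fl"
    unfolding weak_star_Linf_def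
  proof (intro allI impI)
    fix \<psi> :: "real \<Rightarrow> 'a" assume "L1_on a b \<psi>"
    then have \<psi>: "integrable lebesgue (\<lambda>x. indicator {a<..<b} x *\<^sub>R \<psi> x)"
      by (simp add: L1_on_def set_integrable_def)
    note \<psi>m = borel_measurable_integrable[OF \<psi>]
    have fm: "f n \<in> borel_measurable lebesgue" "fl \<in> borel_measurable lebesgue" for n
      by (rule continuous_imp_lebesgue_measurable, rule bounded_primitiveD(6)[OF f] bounded_primitiveD(6)[OF l])+
    have "(\<lambda>n. LINT x|lebesgue. f n x \<bullet> (indicator {a<..<b} x *\<^sub>R \<psi> x)) \<longlonglongrightarrow>
        (LINT x|lebesgue. fl x \<bullet> (indicator {a<..<b} x *\<^sub>R \<psi> x))"
    proof (rule integral_dominated_convergence[where w = "\<lambda>x. B * norm (indicat_real {a<..<b} x *\<^sub>R \<psi> x)"])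
      show "AE x in lebesgue. norm (f n x \<bullet> (indicat_real {a<..<b} x *\<^sub>R \<psi> x)) \<le> B * norm (indicat_real {a<..<b} x *\<^sub>R \<psi> x)" for n
        unfolding real_norm_def
        by (intro AE_I2 order_trans[OF Cauchy_Schwarz_ineq2] mult_right_mono B) auto
      show "AE x in lebesgue. (\<lambda>n. f n x \<bullet> (indicat_real {a<..<b} x *\<^sub>R \<psi> x)) \<longlonglongrightarrow> fl x \<bullet> (indicat_real {a<..<b} x *\<^sub>R \<psi> x)"
        by (intro AE_I2 tendsto_intros lim)
      show "integrable lebesgue (\<lambda>x. B * norm (indicat_real {a<..<b} x *\<^sub>R \<psi> x))"
        by (intro integrable_mult_right integrable_norm \<psi>)
    qed (intro borel_measurable_inner fm \<psi>m)+
    moreover have "(LINT x|lebesgue. h x \<bullet> (indicat_real {a<..<b} x *\<^sub>R \<psi> x)) = (LINT x:{a<..<b}|lebesgue. h x \<bullet> \<psi> x)" for h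
      by (simp add: set_lebesgue_integral_def)
    moreover have "(LINT x:{a<..<b}|lebesgue. f' n x \<bullet> \<psi> x) = (LINT x:{a<..<b}|lebesgue. f n x \<bullet> \<psi> x)" for n
      by (rule set_lebesgue_integral_cong) (auto simp: f')
    ultimately show "(\<lambda>n. LINT x:{a<..<b}|lebesgue. f' n x \<bullet> \<psi> x) \<longlonglongrightarrow> (LINT x:{a<..<b}|lebesgue. fl x \<bullet> \<psi> x)"
      by simp
  qed
qed

section \<open>Almost everywhere statements from integrals\<close>

text \<open>Integrate over the set where \<open>g\<close> is negative.\<close>

lemma AE_nonneg_from_set_integrals:
  fixes g :: "real \<Rightarrow> real"
  assumes g: "g \<in> borel_measurable lebesgue" "\<And>x. x \<in> {a<..<b} \<Longrightarrow> \<bar>g x\<bar> \<le> K"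
    and nn: "\<And>A. A \<in> sets lebesgue \<Longrightarrow> A \<subseteq> {a<..<b} \<Longrightarrow> (LINT x:A|lebesgue. g x) \<ge> 0"
  shows "AE x in lebesgue. x \<in> {a<..<b} \<longrightarrow> 0 \<le> g x"
proof -
  define A where "A = {a<..<b} \<inter> {x. g x < 0}"
  have "{x \<in> space lebesgue. g x < 0} \<in> sets lebesgue" using g(1) by measurable
  then have A: "A \<in> sets lebesgue" unfolding A_def by (intro sets.Int) auto
  have sub: "A \<subseteq> {a<..<b}" by (auto simp: A_def)
  have Al: "A \<in> lmeasurable"
    by (rule fmeasurableI2[OF _ sub A]) auto
  have int: "integrable lebesgue (\<lambda>x. - (indicat_real A x * g x))"
  proof -
    have "norm (g x) \<le> K" if "x \<in> A" for x using g(2)[of x] sub that by auto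
    from set_integrable_bounded[OF g(1) this Al] show ?thesis by (simp add: set_integrable_def)
  qed
  have nonneg: "0 \<le> - (indicat_real A x * g x)" for x by (auto simp: A_def indicator_def)
  have "(LINT x|lebesgue. - (indicat_real A x * g x)) \<le> 0"
    using nn[OF A sub] by (simp add: set_lebesgue_integral_def)
  moreover have "(LINT x|lebesgue. - (indicat_real A x * g x)) \<ge> 0" using nonneg by (intro integral_nonneg_AE AE_I2)
  ultimately have "AE x in lebesgue. - (indicat_real A x * g x) = 0"
    using integral_nonneg_eq_0_iff_AE[OF int] nonneg by simp
  then show ?thesis by eventually_elim (auto simp: A_def indicator_def split: if_splits)
qed

lemma AE_zero_from_set_integrals:
  fixes g :: "real \<Rightarrow> real"
  assumes g: "g \<in> borel_measurable lebesgue" "\<And>x. x \<in> {a<..<b} \<Longrightarrow> \<bar>g x\<bar> \<le> K"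
    and zero: "\<And>A. A \<in> sets lebesgue \<Longrightarrow> A \<subseteq> {a<..<b} \<Longrightarrow> (LINT x:A|lebesgue. g x) = 0"
  shows "AE x in lebesgue. x \<in> {a<..<b} \<longrightarrow> g x = 0"
proof -
  have "AE x in lebesgue. x \<in> {a<..<b} \<longrightarrow> 0 \<le> g x"
    by (rule AE_nonneg_from_set_integrals[OF g]) (use zero in auto)
  moreover have "AE x in lebesgue. x \<in> {a<..<b} \<longrightarrow> 0 \<le> - g x"
  proof (rule AE_nonneg_from_set_integrals[where K = K])
    show "0 \<le> (LINT x:A|lebesgue. - g x)" if "A \<in> sets lebesgue" "A \<subseteq> {a<..<b}" for A
      using zero[OF that] by (simp add: set_lebesgue_integral_def)
  qed (use g in auto)
  ultimately show ?thesis by eventually_elim auto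
qed

text \<open>The passage from intervals to measurable sets is the Dynkin argument above, applied to a constant sequence.\<close>

lemma AE_zero_from_interval_integrals:
  fixes g :: "real \<Rightarrow> real"
  assumes g: "g \<in> borel_measurable lebesgue" "\<And>x. x \<in> {a<..<b} \<Longrightarrow> \<bar>g x\<bar> \<le> K" and "a \<le> b"
    and zero: "\<And>x y. a \<le> x \<Longrightarrow> x \<le> y \<Longrightarrow> y \<le> b \<Longrightarrow> (LINT r:{x..y}|lebesgue. g r) = 0"
  shows "AE x in lebesgue. x \<in> {a<..<b} \<longrightarrow> g x = 0"
proof (rule AE_zero_from_set_integrals[OF g])
  fix A :: "real set" assume A: "A \<in> sets lebesgue" "A \<subseteq> {a<..<b}"
  define h where "h x = (if x \<in> {a<..<b} then g x else 0)" for x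
  have hm: "h \<in> borel_measurable lebesgue" unfolding h_def[abs_def] by (intro measurable_If_set g) auto
  have hb: "\<bar>h x\<bar> \<le> \<bar>K\<bar>" for x using g(2)[of x] by (auto simp: h_def)
  have "(LINT r:{x..y}|lebesgue. h r) = 0" if "x \<le> y" for x y
  proof -
    have "(LINT r:{x..y}|lebesgue. h r) = (LINT r:{clip a b x..clip a b y}|lebesgue. h r)"
      by (rule set_integral_clip[OF \<open>a \<le> b\<close> that, symmetric]) (auto simp: h_def)
    also have "\<dots> = (LINT r:{clip a b x..clip a b y}|lebesgue. g r)"
      unfolding set_integral_Ioo_eq_Icc[symmetric]
      by (rule set_lebesgue_integral_cong) (use \<open>a \<le> b\<close> in \<open>auto simp: h_def clip_def\<close>)
    also have "\<dots> = 0" using \<open>a \<le> b\<close> clip_mono[OF that] by (intro zero) auto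
    finally show ?thesis .
  qed
  then have "(\<lambda>n::nat. LINT r:A \<inter> {a..b}|lebesgue. h r) \<longlonglongrightarrow> (LINT r:A \<inter> {a..b}|lebesgue. 0)"
    using interval_integrals_tendsto_imp_set_integrals_tendsto[of "\<lambda>_. h" "\<bar>K\<bar>" "\<lambda>_. 0" A a b] hm hb A(1) by simp
  then have "(LINT r:A \<inter> {a..b}|lebesgue. h r) = 0" by (simp add: LIMSEQ_const_iff)
  moreover have "A \<inter> {a..b} = A" using A(2) by auto
  moreover have "(LINT r:A|lebesgue. h r) = (LINT r:A|lebesgue. g r)"
    by (rule set_lebesgue_integral_cong) (use A in \<open>auto simp: h_def\<close>)
  ultimately show "(LINT r:A|lebesgue. g r) = 0" by simp
qed

section \<open>Lipschitz functions are primitives\<close>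

text \<open>The one-dimensional core of Rademacher's theorem, with the derivative obtained as a Radon-Nikodym density.\<close>

lemma two_monotone_summands_of_identity:
  assumes u: "\<And>x y. x \<le> y \<Longrightarrow> u x \<le> (u y :: real)" "\<And>x y. x \<le> y \<Longrightarrow> u y - u x \<le> y - x"
  obtains h :: "real \<Rightarrow> real" where "h \<in> borel_measurable borel" "\<And>x. 0 \<le> h x" "\<And>x. h x \<le> 1"
    "\<And>x y. x \<le> y \<Longrightarrow> u y - u x = (LINT r:{x..y}|lborel. h r)"
proof -
  \<comment> \<open>The Stieltjes measures of \<open>u\<close> and \<open>v\<close> add up to Lebesgue measure, so that of \<open>u\<close> is dominated
    by it and has a density between \<open>0\<close> and \<open>1\<close>.\<close>
  define v where "v x = x - u x" for x
  have v: "x \<le> y \<Longrightarrow> v x \<le> v y" for x y using u(2)[of x y] by (simp add: v_def)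
  have "1-lipschitz_on UNIV u"
  proof (rule lipschitz_onI)
    fix x y show "dist (u x) (u y) \<le> 1 * dist x y"
      using u[of x y] u[of y x] by (cases "x \<le> y") (auto simp: dist_real_def)
  qed simp
  then have uc: "continuous_on UNIV u" by (rule lipschitz_on_continuous_on)
  have vc: "continuous_on UNIV v" unfolding v_def by (intro continuous_intros uc)
  have ucr: "continuous (at_right a) u" "continuous (at_right a) v" for a
    using uc vc by (meson continuous_on_eq_continuous_at open_UNIV UNIV_I continuous_at_imp_continuous_at_within)+
  define \<nu> where "\<nu> = interval_measure u"
  define \<nu>' where "\<nu>' = interval_measure v"
  have e: "emeasure \<nu> {a<..b} = u b - u a" "emeasure \<nu>' {a<..b} = v b - v a" if "a \<le> b" for a b
    unfolding \<nu>_def \<nu>'_def using that u(1) v ucr by (auto intro!: emeasure_interval_measure_Ioc)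
  have sets\<nu>[simp]: "sets \<nu> = sets borel" "sets \<nu>' = sets borel" by (auto simp: \<nu>_def \<nu>'_def)
  define \<mu> where "\<mu> = measure_of UNIV (sets borel) (\<lambda>A. emeasure \<nu> A + emeasure \<nu>' A)"
  have \<mu>: "emeasure \<mu> A = emeasure \<nu> A + emeasure \<nu>' A" if "A \<in> sets borel" for A
    unfolding \<mu>_def
  proof (rule emeasure_measure_of_sigma)
    show "sigma_algebra UNIV (sets borel)" using sets.sigma_algebra_axioms[of borel] by simp
    show "countably_additive (sets borel) (\<lambda>A. emeasure \<nu> A + emeasure \<nu>' A)"
    proof (rule countably_additiveI)
      fix X :: "nat \<Rightarrow> real set"
      assume "range X \<subseteq> sets borel" "disjoint_family X"
      then show "(\<Sum>i. emeasure \<nu> (X i) + emeasure \<nu>' (X i)) = emeasure \<nu> (\<Union>i. X i) + emeasure \<nu>' (\<Union>i. X i)"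
        by (subst suminf_add[symmetric]) (auto simp: suminf_emeasure)
    qed
  qed (use that in \<open>auto simp: positive_def\<close>)
  have "lborel = \<mu>"
  proof (rule measure_eqI_generator_eq[where E = "range (\<lambda>(a, b). {a <.. b::real})" and \<Omega> = UNIV
        and A = "\<lambda>i. {- real i <.. real i}"])
    show "Int_stable (range (\<lambda>(a, b). {a <.. b::real}))" by (auto simp: Int_stable_def)
    show "sets lborel = sigma_sets UNIV (range (\<lambda>(a, b). {a <.. b::real}))"
      by (simp, subst borel_sigma_sets_Ioc, simp)
    moreover have "sets \<mu> = sets borel"
      unfolding \<mu>_def using sets.sigma_sets_eq[of borel] by (simp add: sets_measure_of_conv)
    ultimately show "sets \<mu> = sigma_sets UNIV (range (\<lambda>(a, b). {a <.. b::real}))" by simp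
    show "(\<Union>i. {- real i <.. real i}) = UNIV"
    proof safe
      fix x :: real
      obtain i where "\<bar>x\<bar> < real i" using reals_Archimedean2 by blast
      then show "x \<in> (\<Union>i. {- real i <.. real i})" by (auto simp: abs_less_iff intro!: exI[of _ i])
    qed auto
    fix X :: "real set" assume "X \<in> range (\<lambda>(a, b). {a<..b})"
    then obtain a b where X: "X = {a<..b}" by auto
    show "emeasure lborel X = emeasure \<mu> X"
    proof (cases "a \<le> b")
      case True
      have "ennreal (b - a) = ennreal (u b - u a) + ennreal (v b - v a)"
        using True u v by (subst ennreal_plus[symmetric]) (auto simp: v_def)
      then show ?thesis unfolding X using True by (simp add: \<mu> e)
    qed (simp add: X)
  qed auto
  then have le: "emeasure \<nu> A \<le> emeasure lborel A" if "A \<in> sets borel" for A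
    using \<mu>[OF that] by simp
  have "absolutely_continuous lborel \<nu>"
    unfolding absolutely_continuous_def null_sets_def using le by auto (metis le_zero_eq le)
  then obtain H where Hm [measurable]: "H \<in> borel_measurable lborel" and H: "density lborel H = \<nu>"
    using sigma_finite_measure.Radon_Nikodym[OF sigma_finite_lborel, of \<nu>] by auto
  have "AE x\<in>{-real i<..real i} in lborel. H x \<le> 1" for i
  proof -
    define A where "A = {x\<in>{-real i<..real i}. H x > 1}"
    have Am [measurable]: "A \<in> sets borel" unfolding A_def by measurable
    have fin: "emeasure lborel A < \<infinity>"
      by (rule le_less_trans[OF emeasure_mono[of _ "{-real i<..real i}"]]) (auto simp: A_def)
    have "AE x in lborel. H x * indicator A x \<le> indicator A x"
    proof (rule ccontr)
      assume "\<not> ?thesis"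
      moreover have "(\<integral>\<^sup>+x. indicator A x \<partial>lborel) \<noteq> \<infinity>" using fin by simp
      moreover have "AE x in lborel. indicator A x \<le> H x * indicator A x"
        by (intro AE_I2) (auto simp: A_def indicator_def)
      ultimately have "(\<integral>\<^sup>+x. indicator A x \<partial>lborel) < (\<integral>\<^sup>+x. H x * indicator A x \<partial>lborel)"
        by (intro nn_integral_less) auto
      also have "\<dots> = emeasure \<nu> A" by (simp add: H[symmetric] emeasure_density)
      also have "\<dots> \<le> (\<integral>\<^sup>+x. indicator A x \<partial>lborel)" using le by simp
      finally show False by simp
    qed
    then show ?thesis
    proof eventually_elim
      case (elim x)
      then show ?case by (cases "H x > 1") (auto simp: A_def indicator_def)
    qed
  qed
  then have "AE x in lborel. \<forall>i. x \<in> {-real i<..real i} \<longrightarrow> H x \<le> 1"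
    by (subst AE_all_countable) blast
  then have H1: "AE x in lborel. H x \<le> 1"
  proof eventually_elim
    case (elim x)
    obtain i where "\<bar>x\<bar> < real i" using reals_Archimedean2 by blast
    then show ?case using elim[rule_format, of i] by (auto simp: abs_less_iff)
  qed
  define h where "h x = (if H x \<le> 1 then enn2real (H x) else 0)" for x
  have hm [measurable]: "h \<in> borel_measurable borel" unfolding h_def[abs_def] using Hm by measurable
  have h01: "0 \<le> h x" "h x \<le> 1" for x
    by (auto simp: h_def enn2real_leI)
  have hH: "AE x in lborel. H x = ennreal (h x)"
    using H1 by eventually_elim (auto simp: h_def ennreal_enn2real_if top_unique)
  show ?thesis
  proof (rule that[of h])
    fix x y :: real assume xy: "x \<le> y"
    have "(LINT r:{x..y}|lborel. h r) = (LINT r:{x<..y}|lborel. h r)"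
      unfolding set_lebesgue_integral_def
      by (rule integral_discrete_difference[of "{x}"]) (auto simp: indicator_def)
    also have "\<dots> = enn2real (\<integral>\<^sup>+r. ennreal (indicator {x<..y} r * h r) \<partial>lborel)"
      unfolding set_lebesgue_integral_def using h01 by (subst integral_eq_nn_integral) auto
    also have "(\<integral>\<^sup>+r. ennreal (indicator {x<..y} r * h r) \<partial>lborel) = (\<integral>\<^sup>+r. H r * indicator {x<..y} r \<partial>lborel)"
      by (rule nn_integral_cong_AE) (use hH in \<open>eventually_elim, auto simp: indicator_def\<close>)
    also have "\<dots> = emeasure \<nu> {x<..y}" by (simp add: H[symmetric] emeasure_density)
    also have "\<dots> = ennreal (u y - u x)" by (rule e[OF xy])
    finally show "u y - u x = (LINT r:{x..y}|lborel. h r)" using u(1)[OF xy] by simp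
  qed (use h01 hm in auto)
qed

lemma lipschitz_real_primitive:
  fixes f :: "real \<Rightarrow> real"
  assumes "K > 0" "\<And>x y. \<bar>f y - f x\<bar> \<le> K * \<bar>y - x\<bar>"
  obtains g where "bounded_primitive K f g"
proof -
  \<comment> \<open>Adding \<open>K * x\<close> makes \<open>f\<close> monotone with slopes in \<open>[0, 2 * K]\<close>.\<close>
  define u where "u x = (f x + K * x) / (2 * K)" for x
  have "u x \<le> u y" "u y - u x \<le> y - x" if "x \<le> y" for x y
  proof -
    have "\<bar>f y - f x\<bar> \<le> K * (y - x)" using assms(2)[of x y] that by simp
    moreover have "u y - u x = ((f y - f x) + K * (y - x)) / (2 * K)"
      by (simp add: u_def diff_divide_distrib[symmetric] algebra_simps)
    ultimately have "u y - u x \<ge> 0 / (2 * K)" "u y - u x \<le> (2 * (K * (y - x))) / (2 * K)"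
      using \<open>K > 0\<close> by (simp_all only:) (intro divide_right_mono; simp add: abs_le_iff)+
    then show "u x \<le> u y" "u y - u x \<le> y - x" using \<open>K > 0\<close> by auto
  qed
  then obtain h :: "real \<Rightarrow> real" where h: "h \<in> borel_measurable borel" "\<And>x. 0 \<le> h x" "\<And>x. h x \<le> 1"
    "\<And>x y. x \<le> y \<Longrightarrow> u y - u x = (LINT r:{x..y}|lborel. h r)"
    using two_monotone_summands_of_identity[of u] by blast
  have hl: "h \<in> borel_measurable lebesgue" using h(1) by (auto intro: measurable_completion)
  have hi: "set_integrable lebesgue {x..y} h" for x y
    by (rule set_integrable_bounded[OF hl, where K = 1]) (use h in auto)
  have "bounded_primitive K f (\<lambda>x. 2 * K * h x - K)"
    unfolding bounded_primitive_def
  proof (intro conjI allI impI)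
    show "(\<lambda>x. 2 * K * h x - K) \<in> borel_measurable lebesgue" using hl by measurable
    show "norm (2 * K * h x - K) \<le> K" for x
      using h(2,3)[of x] \<open>K > 0\<close> by (simp add: abs_le_iff)
    fix x y :: real assume xy: "x \<le> y"
    have "(LINT r:{x..y}|lebesgue. 2 * K * h r - K) = 2 * K * (LINT r:{x..y}|lebesgue. h r) - (LINT r:{x..y}|lebesgue. K)"
      using set_integral_diff(2)[of lebesgue "{x..y}" "\<lambda>r. 2 * K * h r" "\<lambda>r. K"] hi[of x y]
        set_integrable_bounded[of "\<lambda>r. K" "{x..y}" K] \<open>K > 0\<close> by simp
    also have "(LINT r:{x..y}|lebesgue. h r) = (LINT r:{x..y}|lborel. h r)"
      unfolding set_lebesgue_integral_def using h(1) by (intro integral_completion) auto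
    also have "\<dots> = u y - u x" by (rule h(4)[OF xy, symmetric])
    also have "(LINT r:{x..y}|lebesgue. K) = K * (y - x)"
      using xy by (simp add: set_lebesgue_integral_def)
    also have "2 * K * (u y - u x) - K * (y - x) = f y - f x"
      using \<open>K > 0\<close> by (simp add: u_def field_simps)
    finally show "f y - f x = (LINT r:{x..y}|lebesgue. 2 * K * h r - K)" by simp
  qed
  then show ?thesis by (rule that)
qed

lemma lipschitz_primitive:
  fixes f :: "real \<Rightarrow> 'a::euclidean_space"
  assumes "K > 0" "\<And>x y. norm (f y - f x) \<le> K * \<bar>y - x\<bar>"
  obtains g where "bounded_primitive (K * DIM('a)) f g"
proof -
  have "\<exists>g. bounded_primitive K (\<lambda>x. f x \<bullet> e) g" if "e \<in> Basis" for e
    using lipschitz_real_primitive[OF \<open>K > 0\<close>, of "\<lambda>x. f x \<bullet> e"]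
      order_trans[OF Basis_le_norm[OF that] assms(2)] by (metis inner_diff_left)
  then obtain G where G: "\<And>e. e \<in> Basis \<Longrightarrow> bounded_primitive K (\<lambda>x. f x \<bullet> e) (G e)" by metis
  define g where "g x = (\<Sum>e\<in>Basis. G e x *\<^sub>R e)" for x
  have "bounded_primitive (K * DIM('a)) f g"
    unfolding bounded_primitive_def
  proof (intro conjI allI impI)
    show "g \<in> borel_measurable lebesgue" unfolding g_def[abs_def]
      by (intro borel_measurable_sum borel_measurable_scaleR bounded_primitiveD(1)[OF G]) auto
    show "norm (g x) \<le> K * DIM('a)" for x
    proof -
      have "norm (g x) \<le> (\<Sum>e\<in>(Basis :: 'a set). K)"
        unfolding g_def using bounded_primitiveD(2)[OF G] by (intro sum_norm_le) auto
      then show ?thesis by (simp add: mult.commute)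
    qed
    fix x y :: real assume xy: "x \<le> y"
    have i: "integrable lebesgue (\<lambda>r. indicat_real {x..y} r * G e r)" if "e \<in> Basis" for e
      using bounded_primitiveD(7)[OF G[OF that], of "{x..y}"] by (simp add: set_integrable_def)
    have "(LINT r:{x..y}|lebesgue. g r) = (LINT r|lebesgue. (\<Sum>e\<in>Basis. (indicat_real {x..y} r * G e r) *\<^sub>R e))"
      by (simp add: set_lebesgue_integral_def g_def scaleR_sum_right)
    also have "\<dots> = (\<Sum>e\<in>Basis. (LINT r:{x..y}|lebesgue. G e r) *\<^sub>R e)"
      by (subst Bochner_Integration.integral_sum) (use i in \<open>auto simp: set_lebesgue_integral_def intro!: sum.cong\<close>)
    also have "\<dots> = (\<Sum>e\<in>Basis. ((f y - f x) \<bullet> e) *\<^sub>R e)"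
      using bounded_primitiveD(4)[OF G xy] by (intro sum.cong) (auto simp: inner_diff_left)
    also have "\<dots> = f y - f x" by (rule euclidean_representation)
    finally show "f y - f x = (LINT r:{x..y}|lebesgue. g r)" by simp
  qed
  then show ?thesis by (rule that)
qed

lemma bounded_primitive_pointwise_limit:
  fixes f :: "nat \<Rightarrow> real \<Rightarrow> 'a::euclidean_space"
  assumes f: "\<And>n. bounded_primitive K (f n) (g n)" and "K > 0" and lim: "\<And>x. (\<lambda>n. f n x) \<longlonglongrightarrow> fl x"
  obtains gl where "bounded_primitive (K * DIM('a)) fl gl"
proof -
  have "norm (fl y - fl x) \<le> K * \<bar>y - x\<bar>" for x y
    by (rule Lim_bounded[OF tendsto_norm[OF tendsto_diff[OF lim lim]]]) (use bounded_primitiveD(5)[OF f] in auto)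
  then show ?thesis using lipschitz_primitive[OF \<open>K > 0\<close>] that by blast
qed

section \<open>Functions of bounded variation\<close>

text \<open>The variation function of \<open>f\<close> is the smallest such \<open>V\<close>, up to a constant. Admitting any majorant makes the notion stable under
  pairing of functions, so that several curves can be treated as one.\<close>

definition dominates_increments :: "(real \<Rightarrow> real) \<Rightarrow> (real \<Rightarrow> 'a::real_normed_vector) \<Rightarrow> bool" where
  "dominates_increments V f \<longleftrightarrow> (\<forall>x y. x \<le> y \<longrightarrow> norm (f y - f x) \<le> V y - V x)"

lemma dominates_incrementsD:
  assumes "dominates_increments V f"
  shows "x \<le> y \<Longrightarrow> norm (f y - f x) \<le> V y - V x" "mono V"
proof -
  show *: "x \<le> y \<Longrightarrow> norm (f y - f x) \<le> V y - V x" for x y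
    using assms by (simp add: dominates_increments_def)
  show "mono V" using order_trans[OF norm_ge_zero *] by (auto intro!: monoI)
qed

lemma norm_fst_le_norm: "norm (fst p) \<le> norm p" and norm_snd_le_norm: "norm (snd p) \<le> norm p"
  using norm_fst_le[of "fst p" "snd p"] norm_snd_le[of "snd p" "fst p"] by simp_all

lemma dominates_increments_Pair:
  "dominates_increments V f \<Longrightarrow> dominates_increments W g \<Longrightarrow>
    dominates_increments (\<lambda>x. V x + W x) (\<lambda>x. (f x, g x))"
  unfolding dominates_increments_def
proof (intro allI impI)
  fix x y :: real
  assume *: "\<forall>x y. x \<le> y \<longrightarrow> norm (f y - f x) \<le> V y - V x" "\<forall>x y. x \<le> y \<longrightarrow> norm (g y - g x) \<le> W y - W x"
    and "x \<le> y"
  then have "norm (f y - f x) \<le> V y - V x" "norm (g y - g x) \<le> W y - W x" by blast+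
  then show "norm ((f y, g y) - (f x, g x)) \<le> V y + W y - (V x + W x)"
    using norm_Pair_le[of "f y - f x" "g y - g x"] by simp
qed

lemma dominates_increments_const: "dominates_increments (\<lambda>x. 0) (\<lambda>x. a)"
  by (simp add: dominates_increments_def)

lemma dominates_increments_clip:
  assumes f: "bounded_primitive K f g" and clip: "\<And>x. f x = f (clip a b x)"
  shows "dominates_increments (\<lambda>x. K * clip a b x) f"
  unfolding dominates_increments_def
proof (intro allI impI)
  fix x y :: real assume "x \<le> y"
  then show "norm (f y - f x) \<le> K * clip a b y - K * clip a b x"
    using bounded_primitiveD(5)[OF f, of "clip a b y" "clip a b x"] clip_mono[of x y a b] clip[of x] clip[of y]
    by (simp add: right_diff_distrib)
qed

text \<open>The Jordan decomposition: \<open>f \<bullet> e\<close> is the difference of the monotone functions \<open>V\<close> and \<open>V - f \<bullet> e\<close>.\<close>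

lemma mono_minus_inner:
  fixes f :: "real \<Rightarrow> 'a::euclidean_space"
  assumes "dominates_increments V f" "norm e \<le> 1"
  shows "mono (\<lambda>x. V x - f x \<bullet> e)"
proof (rule monoI)
  fix x y :: real assume "x \<le> y"
  have "(f y - f x) \<bullet> e \<le> norm (f y - f x) * norm e" by (rule norm_cauchy_schwarz)
  also have "\<dots> \<le> V y - V x"
    using dominates_incrementsD(1)[OF assms(1) \<open>x \<le> y\<close>] mult_left_mono[OF assms(2) norm_ge_zero[of "f y - f x"]]
    by simp
  finally show "V x - f x \<bullet> e \<le> V y - f y \<bullet> e" by (simp add: inner_diff_left)
qed

lemma dominates_increments_measurable:
  fixes f :: "real \<Rightarrow> 'a::euclidean_space"
  assumes "dominates_increments V f"
  shows "f \<in> borel_measurable borel"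
proof (subst borel_measurable_euclidean_space, safe)
  fix e :: 'a assume "e \<in> Basis"
  then have "(\<lambda>x. V x - (V x - f x \<bullet> e)) \<in> borel_measurable borel"
    using dominates_incrementsD(2)[OF assms] mono_minus_inner[OF assms, of e]
    by (intro borel_measurable_diff borel_measurable_mono) auto
  then show "(\<lambda>x. f x \<bullet> e) \<in> borel_measurable borel" by simp
qed

lemma variation_ge_sum:
  assumes "p 0 = a" "p n = b" "\<And>i. i < n \<Longrightarrow> p i \<le> p (Suc i)"
  shows "(\<Sum>i<n. ennreal (norm (f (p (Suc i)) - f (p i)))) \<le> variation a b f"
  unfolding variation_def by (rule SUP_upper2[of "(n, p)"]) (use assms in auto)

text \<open>Append \<open>y\<close> to a partition of \<open>[a, x]\<close>.\<close>

lemma variation_add_le: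
  assumes "a \<le> x" "x \<le> y"
  shows "variation a x f + ennreal (norm (f y - f x)) \<le> variation a y f"
proof -
  let ?I = "{(n::nat, p::nat \<Rightarrow> real). p 0 = a \<and> p n = x \<and> (\<forall>i<n. p i \<le> p (Suc i))}"
  have "(1, \<lambda>i. if i = 0 then a else x) \<in> ?I" using assms by simp
  then have ne: "?I \<noteq> {}" by blast
  have "variation a x f + ennreal (norm (f y - f x)) =
      (SUP (n, p) \<in> ?I. (\<Sum>i<n. ennreal (norm (f (p (Suc i)) - f (p i)))) + ennreal (norm (f y - f x)))"
    unfolding variation_def using ne
    by (subst ennreal_SUP_add_left[symmetric]) (auto simp: split_beta)
  also have "\<dots> \<le> variation a y f"
  proof (rule SUP_least, safe)
    fix n p assume p: "a = p 0" "x = p n" "\<forall>i<n. p i \<le> p (Suc i)"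
    have "(\<Sum>i<Suc n. ennreal (norm (f ((p(Suc n := y)) (Suc i)) - f ((p(Suc n := y)) i)))) \<le> variation a y f"
      by (rule variation_ge_sum) (use p assms in \<open>auto simp: less_Suc_eq\<close>)
    then show "(\<Sum>i<n. ennreal (norm (f (p (Suc i)) - f (p i)))) + ennreal (norm (f y - f (p n))) \<le> variation (p 0) y f"
      using p by simp
  qed
  finally show ?thesis .
qed

lemma BV_on_dominated:
  fixes f :: "real \<Rightarrow> 'a::real_normed_vector"
  assumes "BV_on a b f" "a \<le> b"
  obtains V where "dominates_increments V (\<lambda>x. f (clip a b x))"
    "\<And>x. 0 \<le> V x" "\<And>x. V x \<le> enn2real (variation a b f)"
proof -
  define V where "V x = enn2real (variation a (clip a b x) f)" for x
  have fin: "variation a y f < \<infinity>" and le: "variation a y f \<le> variation a b f" if "a \<le> y" "y \<le> b" for y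
  proof -
    have "variation a y f + 0 \<le> variation a y f + ennreal (norm (f b - f y))" by (intro add_mono) auto
    also have "\<dots> \<le> variation a b f" using that by (rule variation_add_le)
    finally show "variation a y f \<le> variation a b f" by simp
    then show "variation a y f < \<infinity>" using assms(1) by (auto simp: BV_on_def intro: le_less_trans)
  qed
  have "dominates_increments V (\<lambda>x. f (clip a b x))"
    unfolding dominates_increments_def
  proof (intro allI impI)
    fix x y :: real assume "x \<le> y"
    let ?x = "clip a b x" and ?y = "clip a b y"
    have c: "a \<le> ?x" "?x \<le> ?y" "?y \<le> b" using assms(2) clip_mono[OF \<open>x \<le> y\<close>] by auto
    have "ennreal (V x + norm (f ?y - f ?x)) \<le> ennreal (V y)"
      using variation_add_le[OF c(1,2), of f] fin[of ?x] fin[of ?y] c unfolding V_def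
      by (simp add: ennreal_plus)
    then show "norm (f ?y - f ?x) \<le> V y - V x"
      by (subst (asm) ennreal_le_iff) (auto simp: V_def)
  qed
  moreover have "V x \<le> enn2real (variation a b f)" for x
    unfolding V_def using le[of "clip a b x"] fin[of b] assms(2) by (intro enn2real_mono) auto
  ultimately show ?thesis using that[of V] by (auto simp: V_def)
qed

text \<open>The value at \<open>s\<close> differs from every other value by at most the variation; averaging over the interval compares it with
  the \<open>L\<^sup>1\<close> norm.\<close>

lemma BV_norm_bounds_values:
  fixes f :: "real \<Rightarrow> 'a::euclidean_space"
  assumes "BV_on a b f" "a < b" "s \<in> {a..b}"
  shows "norm (f s) \<le> BV_norm a b f / (b - a) + BV_norm a b f"
    "enn2real (variation a b f) \<le> BV_norm a b f" "set_integrable lebesgue {a<..<b} f"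
    "(LINT s:{a<..<b}|lebesgue. norm (f s)) \<le> BV_norm a b f"
proof -
  define v where "v = enn2real (variation a b f)"
  obtain V where V: "dominates_increments V (\<lambda>x. f (clip a b x))"
    "\<And>x. 0 \<le> V x" "\<And>x. V x \<le> v"
    unfolding v_def using BV_on_dominated[OF assms(1) less_imp_le[OF assms(2)]] by blast
  have osc: "norm (f s - f r) \<le> v" if "s \<in> {a..b}" "r \<in> {a..b}" for s r
    using dominates_incrementsD(1)[OF V(1), of s r] dominates_incrementsD(1)[OF V(1), of r s]
      V(2,3)[of r] V(2,3)[of s] that
    by (cases "r \<le> s") (auto simp: norm_minus_commute)
  have m: "(\<lambda>x. f (clip a b x)) \<in> borel_measurable lebesgue"
    using dominates_increments_measurable[OF V(1)] by (auto intro: measurable_completion)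
  have bd: "norm (f r) \<le> norm (f s) + v" if "r \<in> {a..b}" "s \<in> {a..b}" for r s
    using norm_triangle_ineq2[of "f r" "f s"] osc[OF that] by simp
  have "set_integrable lebesgue {a<..<b} (\<lambda>x. f (clip a b x))"
    by (rule set_integrable_bounded[OF m, where K = "norm (f a) + v"]) (use bd[of _ a] assms(2) in auto)
  then show int: "set_integrable lebesgue {a<..<b} f"
    by (rule set_integrable_cong[THEN iffD1, rotated -1]) auto
  have L: "(LINT s:{a<..<b}|lebesgue. norm (f s)) \<ge> 0"
    unfolding set_lebesgue_integral_def by (intro integral_nonneg_AE) auto
  have v: "v \<ge> 0" by (simp add: v_def)
  show "enn2real (variation a b f) \<le> BV_norm a b f" "(LINT s:{a<..<b}|lebesgue. norm (f s)) \<le> BV_norm a b f"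
    using L v by (auto simp: BV_norm_def v_def)
  have "norm (f s) - v \<le> norm (f r)" if "r \<in> {a<..<b}" for r
    using bd[OF assms(3), of r] that by simp
  then have "(LINT r:{a<..<b}|lebesgue. norm (f s) - v) \<le> (LINT r:{a<..<b}|lebesgue. norm (f r))"
    by (intro set_integral_mono set_integrable_norm int)
       (auto intro: set_integrable_bounded[where K = "norm (norm (f s) - v)"])
  then have "(b - a) * (norm (f s) - v) \<le> (LINT r:{a<..<b}|lebesgue. norm (f r))"
    using assms(2) by (simp add: set_lebesgue_integral_def)
  also have "\<dots> \<le> BV_norm a b f" by (simp add: BV_norm_def)
  finally have "(b - a) * (norm (f s) - v) \<le> BV_norm a b f" .
  then have "norm (f s) - v \<le> BV_norm a b f / (b - a)"
    using assms(2) by (simp add: field_simps)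
  then show "norm (f s) \<le> BV_norm a b f / (b - a) + BV_norm a b f"
    using L by (simp add: BV_norm_def v_def)
qed

text \<open>The sum over a fixed partition passes to the limit.\<close>

lemma BV_on_pointwise_limit:
  fixes f :: "nat \<Rightarrow> real \<Rightarrow> 'a::real_normed_vector"
  assumes V: "\<And>n. dominates_increments (V n) (f n)" "\<And>n. V n b - V n a \<le> M"
    and lim: "\<And>x. x \<in> {a..b} \<Longrightarrow> (\<lambda>n. f n x) \<longlonglongrightarrow> fl x"
  shows "BV_on a b fl"
proof -
  have "variation a b fl \<le> ennreal M"
    unfolding variation_def
  proof (rule SUP_least, safe)
    fix m and p :: "nat \<Rightarrow> real" assume p: "a = p 0" "b = p m" "\<forall>i<m. p i \<le> p (Suc i)"
    have mono: "p i \<le> p j" if "i \<le> j" "j \<le> m" for i j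
      using that
    proof (induction j)
      case (Suc j)
      then show ?case using p(3)[rule_format, of j] by (cases "i = Suc j") (auto intro: order_trans)
    qed simp
    have "(\<lambda>n. \<Sum>i<m. norm (f n (p (Suc i)) - f n (p i))) \<longlonglongrightarrow> (\<Sum>i<m. norm (fl (p (Suc i)) - fl (p i)))"
      by (intro tendsto_intros lim) (use p mono in auto)
    moreover have "(\<Sum>i<m. norm (f n (p (Suc i)) - f n (p i))) \<le> M" for n
    proof -
      have "(\<Sum>i<m. norm (f n (p (Suc i)) - f n (p i))) \<le> (\<Sum>i<m. V n (p (Suc i)) - V n (p i))"
        by (intro sum_mono dominates_incrementsD(1)[OF V(1)]) (use p in auto)
      also have "\<dots> = V n b - V n a" using p sum_lessThan_telescope[of "\<lambda>i. V n (p i)" m] by simp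
      finally show ?thesis using V(2)[of n] by simp
    qed
    ultimately have "(\<Sum>i<m. norm (fl (p (Suc i)) - fl (p i))) \<le> M"
      by (intro LIMSEQ_le_const2) auto
    then show "(\<Sum>i<m. ennreal (norm (fl (p (Suc i)) - fl (p i)))) \<le> ennreal M"
      by (simp add: sum_ennreal ennreal_leI)
  qed
  then show ?thesis by (auto simp: BV_on_def intro: le_less_trans)
qed

section \<open>Helly's selection theorem\<close>

text \<open>Cantor's diagonal argument.\<close>

lemma countable_pointwise_subsequence:
  fixes g :: "nat \<Rightarrow> 'c \<Rightarrow> 'a::euclidean_space"
  assumes "countable D" "\<And>n x. x \<in> D \<Longrightarrow> norm (g n x) \<le> M"
  obtains r where "strict_mono r" "\<And>x. x \<in> D \<Longrightarrow> convergent (\<lambda>n. g (r n) x)"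
proof (cases "D = {}")
  case True
  then show ?thesis using that[of id] by (auto simp: strict_mono_def)
next
  case False
  define e where "e = from_nat_into D"
  have e: "e k \<in> D" for k using False by (simp add: e_def from_nat_into)
  have surj: "\<exists>k. e k = x" if "x \<in> D" for x
    using from_nat_into_surj[OF assms(1) that] by (simp add: e_def)
  interpret subseqs "\<lambda>k s. convergent (\<lambda>n. g (s n) (e k))"
  proof
    fix k and s :: "nat \<Rightarrow> nat" assume "strict_mono s"
    have "\<forall>n. g (s n) (e k) \<in> cball 0 M" using assms(2)[OF e] by simp
    then obtain l r where "strict_mono r" "((\<lambda>n. g (s n) (e k)) \<circ> r) \<longlonglongrightarrow> l"
      using compact_cball[of "0::'a" M] unfolding compact_def by meson
    then show "\<exists>r'. strict_mono r' \<and> convergent (\<lambda>n. g ((s \<circ> r') n) (e k))"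
      by (intro exI[of _ r]) (auto simp: convergent_def o_def)
  qed
  have "convergent (\<lambda>n. g (diagseq n) (e k))" for k
  proof -
    have "convergent (\<lambda>n. g ((diagseq \<circ> (+) (Suc k)) n) (e k))"
    proof (rule diagseq_holds)
      fix r s :: "nat \<Rightarrow> nat" and m assume "strict_mono r" "convergent (\<lambda>n. g (s n) (e m))"
      then show "convergent (\<lambda>n. g ((s \<circ> r) n) (e m))"
        using convergent_subseq_convergent[of "\<lambda>n. g (s n) (e m)" r] by (simp add: o_def)
    qed
    then have "convergent (\<lambda>n. g (diagseq (n + Suc k)) (e k))"
      by (simp add: o_def add.commute)
    then show ?thesis
      using convergent_ignore_initial_segment[of "\<lambda>n. g (diagseq n) (e k)" "Suc k"] by simp
  qed
  then show ?thesis using that[OF subseq_diagseq] surj by metis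
qed

text \<open>Helly's selection theorem. First the functions \<open>V n\<close> converge on the rationals along a subsequence, to a monotone function
  \<open>w\<close>. Where \<open>w\<close> is continuous, the oscillation of \<open>V n\<close>, and thus of \<open>f n\<close>, over a small neighbourhood is eventually small;
  so convergence of \<open>f n\<close> on the rationals and on the countable set \<open>C\<close> of discontinuities gives convergence everywhere.
  The last conclusion, continuous convergence off \<open>C\<close>, permits evaluation along convergent sequences of arguments.\<close>

lemma Helly_selection_dominated:
  fixes f :: "nat \<Rightarrow> real \<Rightarrow> 'a::euclidean_space"
  assumes V: "\<And>n. dominates_increments (V n) (f n)" "\<And>n x. \<bar>V n x\<bar> \<le> M" and f: "\<And>n x. norm (f n x) \<le> M"
  obtains r fl C where "strict_mono r" "countable C" "\<And>x. (\<lambda>n. f (r n) x) \<longlonglongrightarrow> fl x"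
    "\<And>x e. x \<notin> C \<Longrightarrow> e > 0 \<Longrightarrow> \<exists>d>0. \<forall>\<^sub>F n in sequentially. \<forall>y. \<bar>y - x\<bar> < d \<longrightarrow> norm (f (r n) y - fl x) < e"
proof -
  obtain r1 where r1: "strict_mono r1" "\<And>q. q \<in> \<rat> \<Longrightarrow> convergent (\<lambda>n. V (r1 n) q)"
    using countable_pointwise_subsequence[of \<rat> V M] V(2) countable_rat by auto
  define w where "w q = lim (\<lambda>n. V (r1 n) q)" for q
  have w: "(\<lambda>n. V (r1 n) q) \<longlonglongrightarrow> w q" if "q \<in> \<rat>" for q
    unfolding w_def using r1(2)[OF that] by (rule convergent_LIMSEQ_iff[THEN iffD1])
  have wmono: "w p \<le> w q" if "p \<in> \<rat>" "q \<in> \<rat>" "p \<le> q" for p q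
    by (rule LIMSEQ_le[OF w[OF that(1)] w[OF that(2)]])
       (use monoD[OF dominates_incrementsD(2)[OF V(1)] that(3)] in blast)
  have wbd: "w q \<le> M" if "q \<in> \<rat>" for q
    using V(2) by (intro LIMSEQ_le_const2[OF w[OF that]]) (auto simp: abs_le_iff)
  \<comment> \<open>A monotone extension of \<open>w\<close> from the rationals; its discontinuities form the exceptional set.\<close>
  define W where "W x = (SUP q\<in>{q\<in>\<rat>. q \<le> x}. w q)" for x
  have bdd: "bdd_above (w ` {q\<in>\<rat>. q \<le> x})" for x using wbd by (auto intro!: bdd_aboveI2)
  have ne: "{q\<in>\<rat>. q \<le> x} \<noteq> {}" for x :: real
    using Rats_no_bot_less[of x] by (auto intro: less_imp_le)
  have Wmono: "mono W"
    unfolding W_def by (intro monoI cSUP_subset_mono bdd ne) auto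
  have WQ: "W q = w q" if "q \<in> \<rat>" for q
    unfolding W_def using that wmono by (intro cSup_eq_maximum) auto
  define C where "C = {x. \<not> isCont W x}"
  have C: "countable C" unfolding C_def using mono_ctble_discont[OF Wmono] by simp
  have "countable (C \<union> \<rat>)" using C countable_rat by auto
  then obtain r2 where r2: "strict_mono r2" "\<And>x. x \<in> C \<union> \<rat> \<Longrightarrow> convergent (\<lambda>n. f (r1 (r2 n)) x)"
    using countable_pointwise_subsequence[of "C \<union> \<rat>" "\<lambda>n. f (r1 n)" M] f by auto
  define r where "r n = r1 (r2 n)" for n
  have r: "strict_mono r" using strict_mono_o[OF r1(1) r2(1)] by (simp add: r_def[abs_def] o_def)
  have wr: "(\<lambda>n. V (r n) q) \<longlonglongrightarrow> w q" if "q \<in> \<rat>" for q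
    using LIMSEQ_subseq_LIMSEQ[OF w[OF that] r2(1)] by (simp add: r_def o_def)
  have osc: "\<exists>p q. p \<in> \<rat> \<and> p < x \<and> x < q \<and> (\<forall>\<^sub>F n in sequentially. \<forall>y z. p \<le> y \<and> y \<le> q \<and> p \<le> z \<and> z \<le> q \<longrightarrow>
      norm (f (r n) y - f (r n) z) < e)" if xC: "x \<notin> C" and e: "e > 0" for x e
  proof -
    have "isCont W x" using xC by (simp add: C_def)
    then obtain d where d: "d > 0" "\<And>y. \<bar>y - x\<bar> < d \<Longrightarrow> \<bar>W y - W x\<bar> < e / 2"
      using e unfolding continuous_at_eps_delta dist_real_def by (meson half_gt_zero)
    obtain p where p: "p \<in> \<rat>" "x - d < p" "p < x" using Rats_dense_in_real[of "x - d" x] d by auto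
    obtain q where q: "q \<in> \<rat>" "x < q" "q < x + d" using Rats_dense_in_real[of x "x + d"] d by auto
    have "w q - w p < e"
    proof -
      have "\<bar>W p - W x\<bar> < e / 2" "\<bar>W q - W x\<bar> < e / 2" using p q by (intro d(2); simp)+
      then show ?thesis unfolding WQ[OF p(1)] WQ[OF q(1)] by linarith
    qed
    then have "\<forall>\<^sub>F n in sequentially. V (r n) q - V (r n) p < e"
      by (intro order_tendstoD(2)[OF tendsto_diff[OF wr[OF q(1)] wr[OF p(1)]]])
    then have "\<forall>\<^sub>F n in sequentially. \<forall>y z. p \<le> y \<and> y \<le> q \<and> p \<le> z \<and> z \<le> q \<longrightarrow> norm (f (r n) y - f (r n) z) < e"
    proof eventually_elim
      case (elim n)
      have *: "norm (f (r n) y - f (r n) z) < e" if "p \<le> z" "z \<le> y" "y \<le> q" for y z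
        using dominates_incrementsD(1)[OF V(1) that(2), of "r n"] monoD[OF dominates_incrementsD(2)[OF V(1)] that(1), of "r n"]
          monoD[OF dominates_incrementsD(2)[OF V(1)] that(3), of "r n"] elim by linarith
      show ?case
      proof (intro allI impI)
        fix y z assume "p \<le> y \<and> y \<le> q \<and> p \<le> z \<and> z \<le> q"
        then show "norm (f (r n) y - f (r n) z) < e"
          using *[of y z] *[of z y] by (cases "z \<le> y") (auto simp: norm_minus_commute)
      qed
    qed
    then show ?thesis using p q by blast
  qed
  have conv: "convergent (\<lambda>n. f (r n) x)" for x
  proof (cases "x \<in> C")
    case True then show ?thesis using r2(2)[of x] by (simp add: r_def)
  next
    case False
    have "Cauchy (\<lambda>n. f (r n) x)"
    proof (rule metric_CauchyI)
      fix e :: real assume "e > 0"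
      then obtain p q where pq: "p \<in> \<rat>" "p < x" "x < q"
        "\<forall>\<^sub>F n in sequentially. \<forall>y z. p \<le> y \<and> y \<le> q \<and> p \<le> z \<and> z \<le> q \<longrightarrow> norm (f (r n) y - f (r n) z) < e / 3"
        using osc[OF False, of "e / 3"] by auto
      then obtain N1 where N1: "\<And>n. n \<ge> N1 \<Longrightarrow> norm (f (r n) x - f (r n) p) < e / 3"
        unfolding eventually_sequentially by force
      have "Cauchy (\<lambda>n. f (r n) p)"
        using r2(2)[of p] pq(1) by (simp add: r_def convergent_Cauchy)
      then obtain N2 where N2: "\<And>m n. m \<ge> N2 \<Longrightarrow> n \<ge> N2 \<Longrightarrow> norm (f (r m) p - f (r n) p) < e / 3"
        using \<open>e > 0\<close> unfolding Cauchy_def dist_norm by (meson zero_less_divide_iff zero_less_numeral)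
      show "\<exists>N. \<forall>m\<ge>N. \<forall>n\<ge>N. dist (f (r m) x) (f (r n) x) < e"
      proof (intro exI[of _ "max N1 N2"] allI impI)
        fix m n assume "max N1 N2 \<le> m" "max N1 N2 \<le> n"
        then have "norm (f (r m) x - f (r m) p) < e / 3" "norm (f (r n) x - f (r n) p) < e / 3"
          "norm (f (r m) p - f (r n) p) < e / 3" using N1 N2 by auto
        moreover have "f (r m) x - f (r n) x = (f (r m) x - f (r m) p) + (f (r m) p - f (r n) p) - (f (r n) x - f (r n) p)"
          by simp
        ultimately show "dist (f (r m) x) (f (r n) x) < e"
          unfolding dist_norm
          using norm_triangle_ineq4[of "(f (r m) x - f (r m) p) + (f (r m) p - f (r n) p)" "f (r n) x - f (r n) p"]
            norm_triangle_ineq[of "f (r m) x - f (r m) p" "f (r m) p - f (r n) p"] by simp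
      qed
    qed
    then show ?thesis by (rule Cauchy_convergent)
  qed
  define fl where "fl x = lim (\<lambda>n. f (r n) x)" for x
  have lim: "(\<lambda>n. f (r n) x) \<longlonglongrightarrow> fl x" for x
    unfolding fl_def using conv by (rule convergent_LIMSEQ_iff[THEN iffD1])
  show ?thesis
  proof (rule that[OF r C lim])
    fix x e :: real assume "x \<notin> C" "e > 0"
    then obtain p q where pq: "p \<in> \<rat>" "p < x" "x < q"
      "\<forall>\<^sub>F n in sequentially. \<forall>y z. p \<le> y \<and> y \<le> q \<and> p \<le> z \<and> z \<le> q \<longrightarrow> norm (f (r n) y - f (r n) z) < e / 2"
      using osc[of x "e / 2"] by auto
    have "\<forall>\<^sub>F n in sequentially. norm (f (r n) x - fl x) < e / 2"
      using tendstoD[OF lim[of x], of "e / 2"] \<open>e > 0\<close> by (simp add: dist_norm)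
    with pq(4) have "\<forall>\<^sub>F n in sequentially. \<forall>y. \<bar>y - x\<bar> < min (x - p) (q - x) \<longrightarrow> norm (f (r n) y - fl x) < e"
    proof eventually_elim
      case (elim n)
      show ?case
      proof (intro allI impI)
        fix y assume "\<bar>y - x\<bar> < min (x - p) (q - x)"
        then have "norm (f (r n) y - f (r n) x) < e / 2" using pq by (intro elim(1)[rule_format]) auto
        then show "norm (f (r n) y - fl x) < e"
          using elim(2) norm_triangle_ineq[of "f (r n) y - f (r n) x" "f (r n) x - fl x"] by simp
      qed
    qed
    then show "\<exists>d>0. \<forall>\<^sub>F n in sequentially. \<forall>y. \<bar>y - x\<bar> < d \<longrightarrow> norm (f (r n) y - fl x) < e"
      using pq by (intro exI[of _ "min (x - p) (q - x)"]) auto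
  qed
qed

section \<open>Distributional derivatives of functions of bounded variation\<close>

text \<open>\<open>P\<close> is the distributional derivative of \<open>u\<close> on the open interval, tested with \<open>C\<^sup>1\<close> functions that vanish at the end points.\<close>

definition derivative_measure :: "real \<Rightarrow> real \<Rightarrow> (real \<Rightarrow> real) \<Rightarrow> real measure \<Rightarrow> bool" where
  "derivative_measure a b u P \<longleftrightarrow>
    finite_measure P \<and> sets P = sets (restrict_space borel {a<..<b}) \<and> measure P (space P) \<le> u b - u a \<and>
    (\<forall>\<phi> \<phi>'. (\<forall>x. (\<phi> has_real_derivative \<phi>' x) (at x)) \<longrightarrow> continuous_on UNIV \<phi>' \<longrightarrow> \<phi> a = 0 \<longrightarrow> \<phi> b = 0 \<longrightarrow>
       (LINT x|P. \<phi> x) = - (LINT x:{a<..<b}|lebesgue. \<phi>' x * u x))"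

text \<open>\<open>P\<close> is the image of Lebesgue measure on \<open>(u a, u b)\<close> under the generalized inverse \<open>g\<close> of \<open>u\<close>. For fixed \<open>s\<close>, the conditions \<open>g s \<le> x\<close> and \<open>s \<le> u x\<close> differ at most for the single point \<open>x = g s\<close>, so the values of \<open>u\<close> at its jumps are
  irrelevant and Fubini's theorem yields the integration by parts.\<close>

lemma monotone_derivative_measure:
  assumes "mono u" "a < b"
  shows "\<exists>P. derivative_measure a b u P"
proof -
  have um [measurable]: "u \<in> borel_measurable borel" using assms(1) by (rule borel_measurable_mono)
  \<comment> \<open>\<open>g\<close> is the generalized inverse of \<open>u\<close> on \<open>[a, b]\<close>; the alternative \<open>b \<le> x\<close> keeps \<open>Q s\<close> nonempty.\<close>
  define Q where "Q s = {x. a \<le> x \<and> (b \<le> x \<or> s \<le> u x)}" for s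
  define g where "g s = Inf (Q s)" for s
  have Qb: "b \<in> Q s" for s using assms by (auto simp: Q_def)
  have Qbdd: "bdd_below (Q s)" for s by (rule bdd_belowI[of _ a]) (auto simp: Q_def)
  have ga: "a \<le> g s" for s unfolding g_def using Qb by (intro cInf_greatest) (auto simp: Q_def)
  have gb: "g s \<le> b" for s unfolding g_def using Qb Qbdd by (intro cInf_lower)
  have gmono: "mono g"
  proof (rule monoI)
    fix s t :: real assume "s \<le> t"
    then have "Q t \<subseteq> Q s" by (auto simp: Q_def)
    then show "g s \<le> g t" unfolding g_def using Qb[of t] Qbdd[of s] by (intro cInf_superset_mono) auto
  qed
  have gm [measurable]: "g \<in> borel_measurable borel" using gmono by (rule borel_measurable_mono)
  have above: "s \<le> u x" if gx: "g s < x" and xb: "x < b" for s x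
  proof -
    obtain y where "y \<in> Q s" "y < x" using cInf_lessD[of "Q s" x] gx Qb[of s] unfolding g_def by blast
    then show ?thesis using xb monoD[OF assms(1), of y x] by (auto simp: Q_def)
  qed
  have below: "u x < s" if "x < g s" "a \<le> x" for s x
  proof (rule ccontr)
    assume "\<not> u x < s"
    then have "x \<in> Q s" using that by (auto simp: Q_def)
    then show False using cInf_lower[OF _ Qbdd] that(1) unfolding g_def by fastforce
  qed
  define G where "G = {s. u a < s \<and> s < u b \<and> a < g s \<and> g s < b}"
  have Gm [measurable]: "G \<in> sets borel" unfolding G_def by measurable
  define N where "N = restrict_space lborel G"
  define P where "P = distr N (restrict_space borel {a<..<b}) g"
  have gN: "g \<in> N \<rightarrow>\<^sub>M restrict_space borel {a<..<b}"
  proof (rule measurable_restrict_space2)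
    show "g \<in> space N \<rightarrow> {a<..<b}" by (auto simp: N_def G_def space_restrict_space)
    show "g \<in> borel_measurable N" unfolding N_def by (rule measurable_restrict_space1) simp
  qed
  have ua_ub: "u a \<le> u b" using monoD[OF assms(1), of a b] assms(2) by simp
  have "emeasure P (space P) \<le> emeasure N (space N)"
    unfolding P_def space_distr emeasure_distr[OF gN sets.top] by (rule emeasure_space)
  also have "\<dots> = emeasure lborel G"
    unfolding N_def by (simp add: space_restrict_space emeasure_restrict_space)
  also have "\<dots> \<le> emeasure lborel {u a..u b}" by (intro emeasure_mono) (auto simp: G_def)
  finally have eP: "emeasure P (space P) \<le> ennreal (u b - u a)" using ua_ub by simp
  then have fin: "finite_measure P" by (intro finite_measureI) (auto simp: top_unique)
  have mP: "measure P (space P) \<le> u b - u a"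
    using eP ua_ub unfolding measure_def by (intro enn2real_leI) auto
  have int: "(LINT x|P. \<phi> x) = - (LINT x:{a<..<b}|lebesgue. \<phi>' x * u x)"
    if d: "\<And>x. (\<phi> has_real_derivative \<phi>' x) (at x)" and c: "continuous_on UNIV \<phi>'" and 0: "\<phi> a = 0" "\<phi> b = 0"
    for \<phi> \<phi>'
  proof -
    have c\<phi>: "continuous_on UNIV \<phi>" using d by (intro continuous_at_imp_continuous_on) (auto dest: DERIV_isCont)
    have \<phi>m [measurable]: "\<phi> \<in> borel_measurable borel" and \<phi>'m [measurable]: "\<phi>' \<in> borel_measurable borel"
      using c c\<phi> by (auto intro: borel_measurable_continuous_onI)
    obtain M where M: "M > 0" "\<And>r. r \<in> {a..b} \<Longrightarrow> norm (\<phi>' r) \<le> M"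
      using continuous_on_Icc_bound[OF continuous_on_subset[OF c]] by blast
    define J where "J = {u a<..<u b}"
    define k where "k s x = indicat_real J s * (indicat_real {a<..<b} x * (indicat_real {..u x} s * \<phi>' x))" for s x
    have FTC: "(LINT x:{p..q}|lborel. \<phi>' x) = \<phi> q - \<phi> p" if "p \<le> q" for p q
      using integral_FTC_Icc[of p q \<phi> \<phi>'] that d c
      by (simp add: set_lebesgue_integral_def has_real_derivative_iff_has_vector_derivative
          has_vector_derivative_at_within continuous_on_subset)
    \<comment> \<open>Fubini's theorem for \<open>k\<close>: integrating in \<open>x\<close> first gives \<open>\<phi> (g s)\<close>, integrating in \<open>s\<close> first
      gives \<open>\<phi>' x * (u x - u a)\<close>.\<close>
    have inner: "indicat_real J s * \<phi> (g s) = - (LINT x|lborel. k s x)" for s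
    proof -
      have "(LINT x|lborel. k s x) = (LINT x|lborel. indicat_real J s * (indicat_real {g s..b} x * \<phi>' x))"
      proof (rule integral_discrete_difference[of "{a, b, g s}"])
        fix x assume "x \<notin> {a, b, g s}"
        then consider "x < a" | "x > b" | "a < x" "x < b" "g s < x" | "a < x" "x < b" "x < g s" by force
        then show "k s x = indicat_real J s * (indicat_real {g s..b} x * \<phi>' x)"
        proof cases
          case 3
          then show ?thesis using above[of s x] by (simp add: k_def)
        next
          case 4
          then show ?thesis using below[of x s] by (simp add: k_def)
        qed (use ga[of s] in \<open>auto simp: k_def\<close>)
      qed auto
      also have "\<dots> = indicat_real J s * (\<phi> b - \<phi> (g s))"
        using FTC[OF gb[of s]] by (simp add: set_lebesgue_integral_def)
      finally show ?thesis using 0 by simp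
    qed
    have outer: "(LINT s|lborel. k s x) = indicat_real {a<..<b} x * (\<phi>' x * (u x - u a))" for x
    proof (cases "x \<in> {a<..<b}")
      case True
      then have ux: "u a \<le> u x" "u x \<le> u b"
        using monoD[OF assms(1), of a x] monoD[OF assms(1), of x b] by auto
      have "(LINT s|lborel. k s x) = (LINT s|lborel. indicat_real {u a..u x} s * \<phi>' x)"
        by (rule integral_discrete_difference[of "{u a, u b}"]) (use True ux in \<open>auto simp: k_def J_def indicator_def\<close>)
      then show ?thesis using True ux by simp
    qed (simp add: k_def)
    have "(LINT x|P. \<phi> x) = (LINT s|N. \<phi> (g s))"
      unfolding P_def by (rule integral_distr[OF gN]) (auto intro: measurable_restrict_space1)
    also have "\<dots> = (LINT s|lborel. indicat_real G s * \<phi> (g s))"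
      unfolding N_def by (subst integral_restrict_space) auto
    also have "\<dots> = (LINT s|lborel. indicat_real J s * \<phi> (g s))"
    proof (rule Bochner_Integration.integral_cong)
      fix s
      show "indicat_real G s * \<phi> (g s) = indicat_real J s * \<phi> (g s)"
        using ga[of s] gb[of s] 0 by (cases "g s = a \<or> g s = b") (auto simp: G_def J_def indicator_def)
    qed simp
    also have "\<dots> = - (LINT s|lborel. (LINT x|lborel. k s x))" by (simp add: inner)
    also have "(LINT s|lborel. (LINT x|lborel. k s x)) = (LINT x|lborel. (LINT s|lborel. k s x))"
    proof (rule lborel_pair.Fubini_integral[symmetric])
      have km: "case_prod k \<in> borel_measurable (lborel \<Otimes>\<^sub>M lborel)"
      proof -
        have "(\<lambda>z. indicat_real J (fst z) * (indicat_real {a<..<b} (snd z) *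
            ((if fst z \<le> u (snd z) then 1 else 0) * \<phi>' (snd z)))) \<in> borel_measurable (borel \<Otimes>\<^sub>M borel)"
          unfolding J_def by measurable
        moreover have "case_prod k = (\<lambda>z. indicat_real J (fst z) * (indicat_real {a<..<b} (snd z) *
            ((if fst z \<le> u (snd z) then 1 else 0) * \<phi>' (snd z))))"
          by (auto simp: fun_eq_iff k_def indicator_def)
        moreover have "sets (lborel \<Otimes>\<^sub>M lborel) = sets (borel \<Otimes>\<^sub>M (borel :: real measure) :: (real \<times> real) measure)"
          by (intro sets_pair_measure_cong) auto
        ultimately show ?thesis by (simp cong: measurable_cong_sets)
      qed
      have kb: "\<bar>k s x\<bar> \<le> M" for s x
        using M(1) M(2)[of x] by (auto simp: k_def indicator_def)
      have "integrable (lborel \<Otimes>\<^sub>M lborel) (\<lambda>z. indicator ({u a..u b} \<times> {a..b}) z *\<^sub>R case_prod k z)"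
      proof (rule integrableI_bounded_set_indicator[OF _ km, where B = M])
        have "emeasure (lborel \<Otimes>\<^sub>M lborel) ({u a..u b} \<times> {a..b}) = emeasure lborel {u a..u b} * emeasure lborel {a..b}"
          by (rule lborel.emeasure_pair_measure_Times) auto
        then show "emeasure (lborel \<Otimes>\<^sub>M lborel) ({u a..u b} \<times> {a..b}) < \<infinity>"
          by (simp add: emeasure_lborel_Icc_eq ennreal_mult_less_top)
      qed (use kb in \<open>auto intro!: AE_I2\<close>)
      moreover have "(\<lambda>z. indicator ({u a..u b} \<times> {a..b}) z *\<^sub>R case_prod k z) = case_prod k"
        by (auto simp: fun_eq_iff k_def J_def indicator_def)
      ultimately show "integrable (lborel \<Otimes>\<^sub>M lborel) (case_prod k)" by (simp only:)
    qed
    also have "\<dots> = (LINT x|lborel. indicat_real {a<..<b} x * (\<phi>' x * u x) - u a * (indicat_real {a<..<b} x * \<phi>' x))"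
      by (simp add: outer algebra_simps)
    also have "\<dots> = (LINT x|lborel. indicat_real {a<..<b} x * (\<phi>' x * u x)) - u a * (LINT x|lborel. indicat_real {a<..<b} x * \<phi>' x)"
    proof (subst Bochner_Integration.integral_diff)
      have ub: "\<bar>u x\<bar> \<le> \<bar>u a\<bar> + \<bar>u b\<bar>" if "x \<in> {a<..<b}" for x
        using monoD[OF assms(1), of a x] monoD[OF assms(1), of x b] that by auto
      have "integrable lborel (\<lambda>x. indicat_real {a<..<b} x *\<^sub>R (\<phi>' x * u x))"
        by (rule integrableI_bounded_set_indicator[where B = "M * (\<bar>u a\<bar> + \<bar>u b\<bar>)"])
           (use assms M ub in \<open>auto simp: abs_mult intro!: mult_mono\<close>)
      then show "integrable lborel (\<lambda>x. indicat_real {a<..<b} x * (\<phi>' x * u x))" by simp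
      have "integrable lborel (\<lambda>x. indicat_real {a<..<b} x *\<^sub>R \<phi>' x)"
        by (rule integrableI_bounded_set_indicator[where B = M]) (use assms M in auto)
      then show "integrable lborel (\<lambda>x. u a * (indicat_real {a<..<b} x * \<phi>' x))" by simp
    qed simp
    also have "(LINT x|lborel. indicat_real {a<..<b} x * \<phi>' x) = (LINT x:{a..b}|lborel. \<phi>' x)"
      unfolding set_lebesgue_integral_def
      by (rule integral_discrete_difference[of "{a, b}"]) (auto simp: indicator_def)
    also have "\<dots> = 0" using FTC[of a b] assms 0 by simp
    also have "(LINT x|lborel. indicat_real {a<..<b} x * (\<phi>' x * u x)) = (LINT x:{a<..<b}|lebesgue. \<phi>' x * u x)"
      unfolding set_lebesgue_integral_def by (subst integral_completion) auto
    finally show ?thesis by simp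
  qed
  show ?thesis
    unfolding derivative_measure_def
    by (rule exI[of _ P], intro conjI allI impI fin mP int) (simp add: P_def, blast)
qed

lemma continuous_on_integrable_finite_measure:
  fixes \<phi> :: "real \<Rightarrow> real"
  assumes "finite_measure P" "sets P = sets (restrict_space borel {a<..<b})" "continuous_on {a..b} \<phi>"
  shows "integrable P \<phi>"
proof -
  obtain M where M: "\<And>r. r \<in> {a..b} \<Longrightarrow> norm (\<phi> r) \<le> M" using continuous_on_Icc_bound[OF assms(3)] by blast
  have "\<phi> \<in> borel_measurable (restrict_space borel {a<..<b})"
    by (rule borel_measurable_continuous_on_restrict) (rule continuous_on_subset[OF assms(3)], auto)
  then have "\<phi> \<in> borel_measurable P" using assms(2) by (simp cong: measurable_cong_sets)
  moreover have "space P = {a<..<b}" using sets_eq_imp_space_eq[OF assms(2)] by (simp add: space_restrict_space)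
  ultimately show ?thesis
    using M by (intro finite_measure.integrable_const_bound[OF assms(1), of _ M] AE_I2) auto
qed

text \<open>\<open>\<mu>\<close> is a vector measure representing the distributional derivative of \<open>f\<close>, and \<open>J\<close> is integration against it. The third
  clause makes \<open>J\<close> Lipschitz in the supremum norm, with a constant that is uniform along sequences of bounded variation.\<close>

definition derivative_functional ::
  "real \<Rightarrow> real \<Rightarrow> (real \<Rightarrow> real) \<Rightarrow> (real \<Rightarrow> 'a::euclidean_space) \<Rightarrow> (real set \<Rightarrow> 'a) \<Rightarrow> ((real \<Rightarrow> real) \<Rightarrow> 'a) \<Rightarrow> bool" where
  "derivative_functional a b V f \<mu> J \<longleftrightarrow> vector_measure a b \<mu> \<and>
    (\<forall>\<phi>. continuous_on {a..b} \<phi> \<longrightarrow> has_vm_integral a b \<mu> \<phi> (J \<phi>)) \<and>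
    (\<forall>\<phi> \<psi> B. continuous_on {a..b} \<phi> \<longrightarrow> continuous_on {a..b} \<psi> \<longrightarrow> (\<forall>x\<in>{a..b}. \<bar>\<phi> x - \<psi> x\<bar> \<le> B) \<longrightarrow>
        norm (J \<phi> - J \<psi>) \<le> real DIM('a) * (3 * (V b - V a) * B)) \<and>
    (\<forall>\<phi> \<phi>'. (\<forall>x. (\<phi> has_real_derivative \<phi>' x) (at x)) \<longrightarrow> continuous_on UNIV \<phi>' \<longrightarrow> \<phi> a = 0 \<longrightarrow> \<phi> b = 0 \<longrightarrow>
       J \<phi> = - (LINT x:{a<..<b}|lebesgue. \<phi>' x *\<^sub>R f x))"

text \<open>Apply the monotone case to both parts of the Jordan decomposition of each component. The total masses are at most
  \<open>V b - V a\<close> and \<open>2 * (V b - V a)\<close>, whence the factor \<open>3\<close>.\<close>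

lemma BV_derivative_functional:
  fixes f :: "real \<Rightarrow> 'a::euclidean_space"
  assumes V: "dominates_increments V f" and "a < b"
  shows "\<exists>\<mu> J. derivative_functional a b V f \<mu> J"
proof -
  obtain P where P: "derivative_measure a b V P"
    using monotone_derivative_measure[OF dominates_incrementsD(2)[OF V] \<open>a < b\<close>] by blast
  define N where "N e = (SOME N. derivative_measure a b (\<lambda>x. V x - f x \<bullet> e) N)" for e
  have N: "derivative_measure a b (\<lambda>x. V x - f x \<bullet> e) (N e)" if "e \<in> Basis" for e
    unfolding N_def by (rule someI_ex, rule monotone_derivative_measure[OF mono_minus_inner[OF V] \<open>a < b\<close>]) (use that in simp)
  note P = P[unfolded derivative_measure_def] and N = N[unfolded derivative_measure_def]
  define \<mu> where "\<mu> X = (\<Sum>e\<in>Basis. (measure P X - measure (N e) X) *\<^sub>R e)" for X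
  define J where "J \<phi> = (\<Sum>e\<in>Basis. ((LINT x|P. \<phi> x) - (LINT x|N e. \<phi> x)) *\<^sub>R e)" for \<phi> :: "real \<Rightarrow> real"
  have \<mu>e: "\<mu> X \<bullet> e = measure P X - measure (N e) X" if "e \<in> Basis" for X e
    using that by (simp add: \<mu>_def inner_sum_left_Basis)
  have Je: "J \<phi> \<bullet> e = (LINT x|P. \<phi> x) - (LINT x|N e. \<phi> x)" if "e \<in> Basis" for \<phi> e
    using that by (simp add: J_def inner_sum_left_Basis)
  have int: "integrable P \<phi>" "e \<in> Basis \<Longrightarrow> integrable (N e) \<phi>" if "continuous_on {a..b} \<phi>" for \<phi> :: "real \<Rightarrow> real" and e
    by (rule continuous_on_integrable_finite_measure[OF _ _ that]; use P N[of e] in simp)+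
  have spP: "space P = {a<..<b}" using sets_eq_imp_space_eq[of P] P by (simp add: space_restrict_space)
  have spN: "space (N e) = {a<..<b}" if "e \<in> Basis" for e
    using sets_eq_imp_space_eq[of "N e"] N[OF that] by (simp add: space_restrict_space)
  have intm: "\<bar>(LINT x|Q. \<phi> x) - (LINT x|Q. \<psi> x)\<bar> \<le> B * measure Q (space Q)"
    if "finite_measure Q" "space Q = {a<..<b}" "integrable Q \<phi>" "integrable Q \<psi>"
      "\<And>x. x \<in> {a..b} \<Longrightarrow> \<bar>\<phi> x - \<psi> x\<bar> \<le> B" for Q \<phi> \<psi> B
  proof -
    interpret finite_measure Q by fact
    have "\<bar>(LINT x|Q. \<phi> x) - (LINT x|Q. \<psi> x)\<bar> = \<bar>LINT x|Q. \<phi> x - \<psi> x\<bar>" using that by simp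
    also have "\<dots> \<le> (LINT x|Q. \<bar>\<phi> x - \<psi> x\<bar>)" by (rule integral_abs_bound)
    also have "\<dots> \<le> (LINT x|Q. B)" using that by (intro integral_mono) auto
    finally show ?thesis by (simp add: mult.commute)
  qed
  show ?thesis
    unfolding derivative_functional_def
  proof (rule exI[of _ \<mu>], rule exI[of _ J], intro conjI allI impI)
    show "vector_measure a b \<mu>"
      unfolding vector_measure_def \<mu>_def
    proof (intro allI impI sums_sum sums_scaleR_left sums_diff)
      fix X :: "nat \<Rightarrow> real set" and e :: 'a
      assume X: "range X \<subseteq> sets (restrict_space borel {a<..<b})" "disjoint_family X" and e: "e \<in> Basis"
      show "(\<lambda>i. measure P (X i)) sums measure P (\<Union>i. X i)"
        using P X by (intro finite_measure.finite_measure_UNION) auto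
      show "(\<lambda>i. measure (N e) (X i)) sums measure (N e) (\<Union>i. X i)"
        using N[OF e] X by (intro finite_measure.finite_measure_UNION) auto
    qed
    show "has_vm_integral a b \<mu> \<phi> (J \<phi>)" if "continuous_on {a..b} \<phi>" for \<phi>
      unfolding has_vm_integral_def
    proof
      fix e :: 'a assume e: "e \<in> Basis"
      show "\<exists>P N. finite_measure P \<and> sets P = sets (restrict_space borel {a<..<b}) \<and>
        finite_measure N \<and> sets N = sets (restrict_space borel {a<..<b}) \<and>
        (\<forall>X\<in>sets (restrict_space borel {a<..<b}). \<mu> X \<bullet> e = measure P X - measure N X) \<and>
        integrable P \<phi> \<and> integrable N \<phi> \<and> J \<phi> \<bullet> e = (LINT x|P. \<phi> x) - (LINT x|N. \<phi> x)"
        by (rule exI[of _ P], rule exI[of _ "N e"]) (use P N[OF e] \<mu>e[OF e] Je[OF e] int[OF that] e in auto)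
    qed
    show "norm (J \<phi> - J \<psi>) \<le> real DIM('a) * (3 * (V b - V a) * B)"
      if c: "continuous_on {a..b} \<phi>" "continuous_on {a..b} \<psi>" and bd: "\<forall>x\<in>{a..b}. \<bar>\<phi> x - \<psi> x\<bar> \<le> B" for \<phi> \<psi> B
    proof -
      note B = bd[rule_format]
      have B0: "B \<ge> 0" using B[of a] \<open>a < b\<close> by auto
      have "norm (J \<phi> - J \<psi>) \<le> (\<Sum>e\<in>Basis. \<bar>(J \<phi> - J \<psi>) \<bullet> e\<bar>)" by (rule norm_le_l1)
      also have "\<dots> \<le> (\<Sum>e\<in>(Basis::'a set). 3 * (V b - V a) * B)"
      proof (rule sum_mono)
        fix e :: 'a assume e: "e \<in> Basis"
        have "\<bar>(LINT x|P. \<phi> x) - (LINT x|P. \<psi> x)\<bar> \<le> B * measure P (space P)"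
          by (rule intm) (use P spP int c B in auto)
        also have "\<dots> \<le> B * (V b - V a)" using P B0 by (intro mult_left_mono) auto
        finally have 1: "\<bar>(LINT x|P. \<phi> x) - (LINT x|P. \<psi> x)\<bar> \<le> B * (V b - V a)" .
        have "\<bar>(LINT x|N e. \<phi> x) - (LINT x|N e. \<psi> x)\<bar> \<le> B * measure (N e) (space (N e))"
          by (rule intm) (use N[OF e] spN[OF e] int c B e in auto)
        also have "\<dots> \<le> B * (2 * (V b - V a))"
        proof (intro mult_left_mono B0)
          have "\<bar>(f b - f a) \<bullet> e\<bar> \<le> V b - V a"
            using Basis_le_norm[OF e, of "f b - f a"] dominates_incrementsD(1)[OF V, of a b] \<open>a < b\<close> by simp
          moreover have "measure (N e) (space (N e)) \<le> (V b - f b \<bullet> e) - (V a - f a \<bullet> e)" using N[OF e] by blast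
          ultimately show "measure (N e) (space (N e)) \<le> 2 * (V b - V a)" by (simp add: inner_diff_left abs_le_iff)
        qed
        finally have 2: "\<bar>(LINT x|N e. \<phi> x) - (LINT x|N e. \<psi> x)\<bar> \<le> B * (2 * (V b - V a))" .
        have "\<bar>(J \<phi> - J \<psi>) \<bullet> e\<bar> \<le> B * (V b - V a) + B * (2 * (V b - V a))"
          using 1 2 by (simp add: inner_diff_left Je[OF e] abs_le_iff)
        then show "\<bar>(J \<phi> - J \<psi>) \<bullet> e\<bar> \<le> 3 * (V b - V a) * B" by (simp add: algebra_simps)
      qed
      finally show ?thesis by simp
    qed
    show "J \<phi> = - (LINT x:{a<..<b}|lebesgue. \<phi>' x *\<^sub>R f x)"
      if d: "\<forall>x. (\<phi> has_real_derivative \<phi>' x) (at x)" and c: "continuous_on UNIV \<phi>'" and 0: "\<phi> a = 0" "\<phi> b = 0" for \<phi> \<phi>'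
    proof (rule euclidean_eqI)
      fix e :: 'a assume e: "e \<in> Basis"
      obtain M where M: "\<And>r. r \<in> {a..b} \<Longrightarrow> norm (\<phi>' r) \<le> M"
        using continuous_on_Icc_bound[OF continuous_on_subset[OF c]] by blast
      have \<phi>'m: "\<phi>' \<in> borel_measurable lebesgue" using c by (rule continuous_imp_lebesgue_measurable)
      have bi: "set_integrable lebesgue {a<..<b} (\<lambda>x. \<phi>' x *\<^sub>R h x)"
        if h: "h \<in> borel_measurable borel" "\<And>x. x \<in> {a<..<b} \<Longrightarrow> norm (h x) \<le> L" for h :: "real \<Rightarrow> 'c::euclidean_space" and L
      proof (rule set_integrable_bounded[where K = "M * L"])
        show "(\<lambda>x. \<phi>' x *\<^sub>R h x) \<in> borel_measurable lebesgue"
          by (intro borel_measurable_scaleR \<phi>'m measurable_completion) (use h in auto)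
        show "norm (\<phi>' x *\<^sub>R h x) \<le> M * L" if "x \<in> {a<..<b}" for x
          using mult_mono[OF M[of x] h(2)[OF that]] that order_trans[OF norm_ge_zero M[of x]] by simp
      qed auto
      have Vb: "norm (V x) \<le> \<bar>V a\<bar> + \<bar>V b\<bar>" if "x \<in> {a<..<b}" for x
        using monoD[OF dominates_incrementsD(2)[OF V], of a x] monoD[OF dominates_incrementsD(2)[OF V], of x b] that by auto
      have Vm: "V \<in> borel_measurable borel" by (rule borel_measurable_mono[OF dominates_incrementsD(2)[OF V]])
      have fb: "norm (f x) \<le> norm (f a) + (V b - V a)" if "x \<in> {a<..<b}" for x
        using norm_triangle_ineq2[of "f x" "f a"] dominates_incrementsD(1)[OF V, of a x]
          monoD[OF dominates_incrementsD(2)[OF V], of x b] that by auto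
      note fm = dominates_increments_measurable[OF V]
      have i1: "set_integrable lebesgue {a<..<b} (\<lambda>x. \<phi>' x * V x)"
        using bi[OF Vm Vb] by simp
      have i2: "set_integrable lebesgue {a<..<b} (\<lambda>x. \<phi>' x *\<^sub>R f x)" by (rule bi[OF fm fb])
      have i3: "set_integrable lebesgue {a<..<b} (\<lambda>x. (\<phi>' x *\<^sub>R f x) \<bullet> e)"
        using i2 unfolding set_integrable_def by (auto simp flip: inner_scaleR_left)
      have "(LINT x|P. \<phi> x) = - (LINT x:{a<..<b}|lebesgue. \<phi>' x * V x)" using P d c 0 by blast
      moreover have "(LINT x|N e. \<phi> x) = - (LINT x:{a<..<b}|lebesgue. \<phi>' x * (V x - f x \<bullet> e))"
        using N[OF e] d c 0 by blast
      ultimately have "J \<phi> \<bullet> e = - (LINT x:{a<..<b}|lebesgue. \<phi>' x * V x) + (LINT x:{a<..<b}|lebesgue. \<phi>' x * (V x - f x \<bullet> e))"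
        by (simp add: Je[OF e])
      also have "(LINT x:{a<..<b}|lebesgue. \<phi>' x * (V x - f x \<bullet> e)) =
          (LINT x:{a<..<b}|lebesgue. \<phi>' x * V x) - (LINT x:{a<..<b}|lebesgue. (\<phi>' x *\<^sub>R f x) \<bullet> e)"
        using set_integral_diff(2)[OF i1 i3] by (simp add: right_diff_distrib)
      also have "(LINT x:{a<..<b}|lebesgue. (\<phi>' x *\<^sub>R f x) \<bullet> e) = (LINT x:{a<..<b}|lebesgue. \<phi>' x *\<^sub>R f x) \<bullet> e"
        using i2 unfolding set_lebesgue_integral_def set_integrable_def
        by (subst integral_inner_left[symmetric]) (auto simp: mult.assoc)
      finally show "J \<phi> \<bullet> e = - (LINT x:{a<..<b}|lebesgue. \<phi>' x *\<^sub>R f x) \<bullet> e" by simp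
    qed
  qed
qed

text \<open>A Weierstrass polynomial, corrected by the affine function \<open>L\<close> with the same end values.\<close>

lemma C1_approximation_zero_ends:
  fixes \<phi> :: "real \<Rightarrow> real"
  assumes "continuous_on {a..b} \<phi>" "\<phi> a = 0" "\<phi> b = 0" "a < b" "e > 0"
  obtains \<psi> \<psi>' where "\<And>x. (\<psi> has_real_derivative \<psi>' x) (at x)" "continuous_on UNIV \<psi>'" "\<psi> a = 0" "\<psi> b = 0"
    "\<And>x. x \<in> {a..b} \<Longrightarrow> \<bar>\<phi> x - \<psi> x\<bar> \<le> e"
proof -
  obtain p where p: "real_polynomial_function p" "\<And>x. x \<in> {a..b} \<Longrightarrow> \<bar>\<phi> x - p x\<bar> < e / 2"
    using Stone_Weierstrass_real_polynomial_function[of "{a..b}" \<phi> "e / 2"] assms by auto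
  define L where "L x = p a + (x - a) * ((p b - p a) / (b - a))" for x
  obtain p' where p': "real_polynomial_function p'" "\<And>x. (p has_real_derivative p' x) (at x)"
    using has_real_derivative_polynomial_function[OF p(1)] by blast
  have L': "(L has_real_derivative (p b - p a) / (b - a)) (at x)" for x
    unfolding L_def[abs_def] using \<open>a < b\<close> by (auto intro!: derivative_eq_intros)
  show ?thesis
  proof (rule that[of "\<lambda>x. p x - L x" "\<lambda>x. p' x - (p b - p a) / (b - a)"])
    show "((\<lambda>x. p x - L x) has_real_derivative p' x - (p b - p a) / (b - a)) (at x)" for x
      by (intro derivative_intros p' L')
    show "continuous_on UNIV (\<lambda>x. p' x - (p b - p a) / (b - a))"
      using p'(1) by (intro continuous_intros continuous_on_polymonial_function) (simp add: real_polynomial_function_eq)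
    show "p a - L a = 0" "p b - L b = 0" using \<open>a < b\<close> by (auto simp: L_def)
    fix x assume x: "x \<in> {a..b}"
    define t where "t = (x - a) / (b - a)"
    have t: "0 \<le> t" "t \<le> 1" using x \<open>a < b\<close> by (auto simp: t_def)
    have pe: "\<bar>p a\<bar> \<le> e / 2" "\<bar>p b\<bar> \<le> e / 2" using p(2)[of a] p(2)[of b] assms by auto
    have "L x = p a + t * (p b - p a)" by (simp add: L_def t_def)
    also have "\<dots> = (1 - t) * p a + t * p b" by (simp add: algebra_simps)
    also have "\<bar>\<dots>\<bar> \<le> (1 - t) * \<bar>p a\<bar> + t * \<bar>p b\<bar>"
      using t abs_triangle_ineq[of "(1 - t) * p a" "t * p b"] by (simp add: abs_mult)
    also have "\<dots> \<le> (1 - t) * (e / 2) + t * (e / 2)"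
      using t pe by (intro add_mono mult_left_mono) auto
    also have "\<dots> = e / 2" by (simp add: field_simps)
    finally have "\<bar>L x\<bar> \<le> e / 2" .
    then show "\<bar>\<phi> x - (p x - L x)\<bar> \<le> e" using p(2)[OF x] by linarith
  qed
qed

text \<open>Dominated convergence gives convergence in \<open>L\<^sup>1\<close> and, after integration by parts, convergence of the derivatives
  tested with \<open>C\<^sup>1\<close> functions. The uniform bound on the masses extends this to continuous functions by density.\<close>

lemma weak_star_BV_pointwise:
  fixes f :: "nat \<Rightarrow> real \<Rightarrow> 'a::euclidean_space"
  assumes V: "\<And>n. dominates_increments (V n) (f n)" "\<And>n. V n b - V n a \<le> M"
    and Vl: "dominates_increments Vl fl" and "a < b"
    and fB: "\<And>n x. x \<in> {a<..<b} \<Longrightarrow> norm (f n x) \<le> B" and lim: "\<And>x. x \<in> {a<..<b} \<Longrightarrow> (\<lambda>n. f n x) \<longlonglongrightarrow> fl x"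
  shows "weak_star_BV a b f fl"
proof -
  have fm: "f n \<in> borel_measurable lebesgue" for n
    using dominates_increments_measurable[OF V(1)] by (auto intro: measurable_completion)
  have flm: "fl \<in> borel_measurable lebesgue"
    using dominates_increments_measurable[OF Vl] by (auto intro: measurable_completion)
  have flB: "norm (fl x) \<le> B" if "x \<in> {a<..<b}" for x
    by (rule Lim_bounded[OF tendsto_norm[OF lim[OF that]]]) (use fB that in auto)
  have ind: "integrable lebesgue (\<lambda>x. indicat_real {a<..<b} x * c)" for c by (rule integrable_indicator_Ioo)
  have i: "set_integrable lebesgue {a<..<b} (f n)" "set_integrable lebesgue {a<..<b} fl" for n
    by (rule set_integrable_bounded[where K = B]; use fm flm fB flB in simp)+
  have conv: "(\<lambda>n. LINT x:{a<..<b}|lebesgue. \<phi> x *\<^sub>R f n x) \<longlonglongrightarrow> (LINT x:{a<..<b}|lebesgue. \<phi> x *\<^sub>R fl x)"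
    if c: "continuous_on UNIV \<phi>" for \<phi> :: "real \<Rightarrow> real"
  proof -
    obtain L where L: "\<And>r. r \<in> {a..b} \<Longrightarrow> norm (\<phi> r) \<le> L"
      using continuous_on_Icc_bound[OF continuous_on_subset[OF c]] by blast
    note \<phi>m = continuous_imp_lebesgue_measurable[OF c]
    show ?thesis unfolding set_lebesgue_integral_def
    proof (rule integral_dominated_convergence[where w = "\<lambda>x. indicator {a<..<b} x * (L * B)"])
      show "AE x in lebesgue. (\<lambda>n. indicat_real {a<..<b} x *\<^sub>R \<phi> x *\<^sub>R f n x) \<longlonglongrightarrow> indicat_real {a<..<b} x *\<^sub>R \<phi> x *\<^sub>R fl x"
      proof (rule AE_I2)
        fix x show "(\<lambda>n. indicat_real {a<..<b} x *\<^sub>R \<phi> x *\<^sub>R f n x) \<longlonglongrightarrow> indicat_real {a<..<b} x *\<^sub>R \<phi> x *\<^sub>R fl x"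
          using lim[of x] by (cases "x \<in> {a<..<b}") (auto intro!: tendsto_intros)
      qed
      show "AE x in lebesgue. norm (indicat_real {a<..<b} x *\<^sub>R \<phi> x *\<^sub>R f n x) \<le> indicator {a<..<b} x * (L * B)" for n
      proof (rule AE_I2)
        fix x
        have "norm (\<phi> x *\<^sub>R f n x) \<le> L * B" if "x \<in> {a<..<b}"
          using mult_mono[OF L[of x] fB[OF that, of n]] that order_trans[OF norm_ge_zero L[of x]] by simp
        then show "norm (indicat_real {a<..<b} x *\<^sub>R \<phi> x *\<^sub>R f n x) \<le> indicator {a<..<b} x * (L * B)"
          by (cases "x \<in> {a<..<b}") auto
      qed
    qed (use fm flm \<phi>m ind in \<open>auto intro!: borel_measurable_scaleR borel_measurable_indicator borel_measurable_times\<close>)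
  qed
  have "(\<lambda>n. LINT x:{a<..<b}|lebesgue. norm (f n x - fl x)) \<longlonglongrightarrow> integral\<^sup>L lebesgue (\<lambda>x::real. 0)"
    unfolding set_lebesgue_integral_def
  proof (rule integral_dominated_convergence[where w = "\<lambda>x. indicator {a<..<b} x * (2 * B)"])
    show "AE x in lebesgue. (\<lambda>n. indicat_real {a<..<b} x *\<^sub>R norm (f n x - fl x)) \<longlonglongrightarrow> 0"
    proof (rule AE_I2)
      fix x show "(\<lambda>n. indicat_real {a<..<b} x *\<^sub>R norm (f n x - fl x)) \<longlonglongrightarrow> 0"
        using lim[of x] by (cases "x \<in> {a<..<b}") (auto intro!: tendsto_norm_zero simp: LIM_zero)
    qed
    show "AE x in lebesgue. norm (indicat_real {a<..<b} x *\<^sub>R norm (f n x - fl x)) \<le> indicator {a<..<b} x * (2 * B)" for n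
    proof (rule AE_I2)
      fix x show "norm (indicat_real {a<..<b} x *\<^sub>R norm (f n x - fl x)) \<le> indicator {a<..<b} x * (2 * B)"
        using fB[of x n] flB[of x] norm_triangle_ineq4[of "f n x" "fl x"] by (cases "x \<in> {a<..<b}") auto
    qed
  qed (use fm flm ind in \<open>auto intro!: borel_measurable_times borel_measurable_indicator borel_measurable_norm borel_measurable_diff\<close>)
  then have L1: "(\<lambda>n. LINT x:{a<..<b}|lebesgue. norm (f n x - fl x)) \<longlonglongrightarrow> 0" by simp
  note ex = BV_derivative_functional[OF _ \<open>a < b\<close>]
  define \<mu>n where "\<mu>n n = (SOME \<mu>. \<exists>J. derivative_functional a b (V n) (f n) \<mu> J)" for n
  define Jn where "Jn n = (SOME J. derivative_functional a b (V n) (f n) (\<mu>n n) J)" for n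
  have n: "derivative_functional a b (V n) (f n) (\<mu>n n) (Jn n)" for n
  proof -
    have "\<exists>J. derivative_functional a b (V n) (f n) (\<mu>n n) J"
      unfolding \<mu>n_def by (rule someI_ex[OF ex[OF V(1)[of n]]])
    then show ?thesis unfolding Jn_def by (rule someI_ex)
  qed
  obtain \<mu> J where l: "derivative_functional a b Vl fl \<mu> J" using ex[OF Vl] by blast
  have dd: "distributional_derivative a b f \<mu>" if "derivative_functional a b V f \<mu> J" for V f \<mu> J
    unfolding distributional_derivative_def
  proof (intro conjI allI impI)
    show "vector_measure a b \<mu>" using that unfolding derivative_functional_def by blast
    fix \<phi> assume t: "test_function a b \<phi>"
    note tD = test_functionD[OF t less_imp_le[OF \<open>a < b\<close>]]
    have "J \<phi> = - (LINT x:{a<..<b}|lebesgue. deriv \<phi> x *\<^sub>R f x)"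
      using that tD unfolding derivative_functional_def by blast
    moreover have "continuous_on {a..b} \<phi>"
      using tD(1) by (intro continuous_at_imp_continuous_on) (auto dest: DERIV_isCont)
    ultimately show "has_vm_integral a b \<mu> \<phi> (- (LINT x:{a<..<b}|lebesgue. deriv \<phi> x *\<^sub>R f x))"
      using that unfolding derivative_functional_def by metis
  qed
  have "weak_star_measure a b \<mu>n \<mu>"
    unfolding weak_star_measure_def
  proof (intro allI impI)
    fix \<phi> :: "real \<Rightarrow> real" assume \<phi>: "continuous_on {a..b} \<phi>" "\<phi> a = 0" "\<phi> b = 0"
    define Z where "Z = 1 + \<bar>real DIM('a) * (3 * M)\<bar> + \<bar>real DIM('a) * (3 * (Vl b - Vl a))\<bar>"
    have Z: "Z > 0" by (simp add: Z_def add_pos_nonneg)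
    have "(\<lambda>n. Jn n \<phi>) \<longlonglongrightarrow> J \<phi>"
    proof (rule LIMSEQ_I)
      fix e :: real assume "e > 0"
      define d where "d = e / (3 * Z)"
      have d: "d > 0" using \<open>e > 0\<close> Z by (simp add: d_def)
      obtain \<psi> \<psi>' where \<psi>: "\<And>x. (\<psi> has_real_derivative \<psi>' x) (at x)" "continuous_on UNIV \<psi>'" "\<psi> a = 0" "\<psi> b = 0"
        "\<And>x. x \<in> {a..b} \<Longrightarrow> \<bar>\<phi> x - \<psi> x\<bar> \<le> d"
        using C1_approximation_zero_ends[OF \<phi> \<open>a < b\<close> d] by blast
      have c\<psi>: "continuous_on {a..b} \<psi>"
        using \<psi>(1) by (intro continuous_at_imp_continuous_on) (auto dest: DERIV_isCont)
      have "(\<lambda>n. - (LINT x:{a<..<b}|lebesgue. \<psi>' x *\<^sub>R f n x)) \<longlonglongrightarrow> - (LINT x:{a<..<b}|lebesgue. \<psi>' x *\<^sub>R fl x)"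
        by (intro tendsto_minus conv \<psi>)
      moreover have "Jn n \<psi> = - (LINT x:{a<..<b}|lebesgue. \<psi>' x *\<^sub>R f n x)" for n using n[of n] \<psi> unfolding derivative_functional_def by blast
      moreover have "J \<psi> = - (LINT x:{a<..<b}|lebesgue. \<psi>' x *\<^sub>R fl x)" using l \<psi> unfolding derivative_functional_def by blast
      ultimately have "(\<lambda>n. Jn n \<psi>) \<longlonglongrightarrow> J \<psi>" by simp
      then obtain N where N: "\<And>n. n \<ge> N \<Longrightarrow> norm (Jn n \<psi> - J \<psi>) < e / 3"
        using LIMSEQ_D[of _ _ "e / 3"] \<open>e > 0\<close> by (metis divide_pos_pos zero_less_numeral)
      have dZ: "d * Z = e / 3" using Z by (simp add: d_def)
      have 1: "norm (Jn n \<phi> - Jn n \<psi>) \<le> e / 3" for n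
      proof -
        have "norm (Jn n \<phi> - Jn n \<psi>) \<le> real DIM('a) * (3 * (V n b - V n a) * d)"
          using n[of n] \<phi>(1) c\<psi> \<psi>(5) unfolding derivative_functional_def by blast
        also have "\<dots> \<le> real DIM('a) * (3 * M * d)"
          using V(2)[of n] d by (intro mult_left_mono mult_right_mono) auto
        also have "\<dots> = d * (real DIM('a) * (3 * M))" by simp
        also have "\<dots> \<le> d * Z" using d by (intro mult_left_mono) (auto simp: Z_def)
        finally show ?thesis by (simp add: dZ)
      qed
      have 2: "norm (J \<phi> - J \<psi>) \<le> e / 3"
      proof -
        have "norm (J \<phi> - J \<psi>) \<le> real DIM('a) * (3 * (Vl b - Vl a) * d)"
          using l \<phi>(1) c\<psi> \<psi>(5) unfolding derivative_functional_def by blast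
        also have "\<dots> = d * (real DIM('a) * (3 * (Vl b - Vl a)))" by simp
        also have "\<dots> \<le> d * Z" using d by (intro mult_left_mono) (auto simp: Z_def)
        finally show ?thesis by (simp add: dZ)
      qed
      show "\<exists>N. \<forall>n\<ge>N. norm (Jn n \<phi> - J \<phi>) < e"
      proof (intro exI[of _ N] allI impI)
        fix m assume "N \<le> m"
        have "norm (Jn m \<phi> - J \<phi>) \<le> norm (Jn m \<phi> - Jn m \<psi>) + norm (Jn m \<psi> - J \<psi>) + norm (J \<phi> - J \<psi>)"
          using norm_triangle_ineq[of "Jn m \<phi> - Jn m \<psi>" "Jn m \<psi> - J \<psi>"]
            norm_triangle_ineq4[of "Jn m \<phi> - J \<psi>" "J \<phi> - J \<psi>"] by simp
        then show "norm (Jn m \<phi> - J \<phi>) < e" using 1[of m] 2 N[OF \<open>N \<le> m\<close>] by simp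
      qed
    qed
    then show "\<exists>Jn J. (\<forall>n. has_vm_integral a b (\<mu>n n) \<phi> (Jn n)) \<and> has_vm_integral a b \<mu> \<phi> J \<and> Jn \<longlonglongrightarrow> J"
      using n l \<phi>(1) unfolding derivative_functional_def by (intro exI[of _ "\<lambda>n. Jn n \<phi>"] exI[of _ "J \<phi>"]) blast
  qed
  then show ?thesis
    unfolding weak_star_BV_def L1_on_def using i L1 dd[OF n] dd[OF l] by blast
qed

lemma weak_star_BV_cong:
  assumes "\<And>n x. x \<in> {a<..<b} \<Longrightarrow> f n x = f' n x" "\<And>x. x \<in> {a<..<b} \<Longrightarrow> fl x = fl' x"
  shows "weak_star_BV a b f fl \<longleftrightarrow> weak_star_BV a b f' fl'"
proof -
  have 1: "L1_on a b g \<longleftrightarrow> L1_on a b g'" and 2: "distributional_derivative a b g \<mu> \<longleftrightarrow> distributional_derivative a b g' \<mu>"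
    if "\<And>x. x \<in> {a<..<b} \<Longrightarrow> g x = g' x" for g g' :: "real \<Rightarrow> 'a" and \<mu>
  proof -
    show "L1_on a b g \<longleftrightarrow> L1_on a b g'"
      unfolding L1_on_def by (rule set_integrable_cong) (use that in auto)
    have "(LINT x:{a<..<b}|lebesgue. deriv \<phi> x *\<^sub>R g x) = (LINT x:{a<..<b}|lebesgue. deriv \<phi> x *\<^sub>R g' x)" for \<phi>
      by (rule set_lebesgue_integral_cong) (use that in auto)
    then show "distributional_derivative a b g \<mu> \<longleftrightarrow> distributional_derivative a b g' \<mu>"
      by (simp add: distributional_derivative_def)
  qed
  have "(LINT x:{a<..<b}|lebesgue. norm (f n x - fl x)) = (LINT x:{a<..<b}|lebesgue. norm (f' n x - fl' x))" for n
    by (rule set_lebesgue_integral_cong) (use assms in auto)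
  then show ?thesis
    unfolding weak_star_BV_def using 1[OF assms(1)] 1[OF assms(2)] 2[OF assms(1)] 2[OF assms(2)] by simp
qed

section \<open>Gradients and positively homogeneous convex functions\<close>

lemma GDERIV_unique: "GDERIV f z :> g \<Longrightarrow> GDERIV f z :> g' \<Longrightarrow> g = g'"
proof -
  assume "GDERIV f z :> g" "GDERIV f z :> g'"
  then have "(\<lambda>h. h \<bullet> g) = (\<lambda>h. h \<bullet> g')"
    unfolding gderiv_def by (rule has_derivative_unique)
  then have "(g - g') \<bullet> (g - g') = 0" by (metis inner_diff_right right_minus_eq)
  then show "g = g'" by simp
qed

lemma grad_eqI: "GDERIV f z :> g \<Longrightarrow> grad f z = g"
  unfolding grad_def using GDERIV_unique by blast

lemma differentiable_imp_GDERIV_grad: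
  fixes f :: "'a::euclidean_space \<Rightarrow> real"
  assumes "f differentiable (at z)"
  shows "GDERIV f z :> grad f z"
proof -
  obtain D where D: "(f has_derivative D) (at z)" using assms by (auto simp: differentiable_def)
  then interpret D: bounded_linear D by (rule has_derivative_bounded_linear)
  have "D h = h \<bullet> (\<Sum>e\<in>Basis. D e *\<^sub>R e)" for h
  proof -
    have "D h = D (\<Sum>e\<in>Basis. (h \<bullet> e) *\<^sub>R e)" by (simp add: euclidean_representation)
    also have "\<dots> = (\<Sum>e\<in>Basis. (h \<bullet> e) * D e)" by (simp add: D.sum D.scaleR)
    finally show ?thesis by (simp add: inner_sum_right mult.commute)
  qed
  then have "GDERIV f z :> (\<Sum>e\<in>Basis. D e *\<^sub>R e)"
    unfolding gderiv_def using D by (metis (no_types, lifting) ext)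
  then show ?thesis using grad_eqI by metis
qed

lemma homogeneous_at_0:
  fixes R :: "'a::real_vector \<Rightarrow> real"
  assumes "\<forall>a>0. \<forall>z. R (a *\<^sub>R z) = a * R z"
  shows "R 0 = 0"
  using assms[rule_format, of 2 0] by simp

lemma closed_subdifferential: "closed (subdifferential R x)"
proof -
  have "subdifferential R x = (\<Inter>y. {\<xi>. R x + \<xi> \<bullet> (y - x) \<le> R y})" by (auto simp: subdifferential_def)
  moreover have "closed {\<xi>. R x + \<xi> \<bullet> (y - x) \<le> R y}" for y
    by (intro closed_Collect_le continuous_intros)
  ultimately show ?thesis by auto
qed

text \<open>Split \<open>w\<close> into its projection onto the subdifferential and the remainder.\<close>

lemma inner_le_dissipation:
  fixes R :: "'a::euclidean_space \<Rightarrow> real"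
  assumes "R 0 = 0" "subdifferential R 0 \<noteq> {}"
  shows "w \<bullet> v \<le> R v + norm v * infdist w (subdifferential R 0)"
proof -
  obtain \<xi> where \<xi>: "\<xi> \<in> subdifferential R 0" "infdist w (subdifferential R 0) = dist w \<xi>"
    using infdist_attains_inf[OF closed_subdifferential assms(2)] by blast
  have "w \<bullet> v = \<xi> \<bullet> v + (w - \<xi>) \<bullet> v" by (simp add: inner_diff_left)
  moreover have "\<xi> \<bullet> v \<le> R v" using \<xi>(1) assms(1) by (simp add: subdifferential_def)
  moreover have "(w - \<xi>) \<bullet> v \<le> norm v * dist w \<xi>"
    using norm_cauchy_schwarz[of "w - \<xi>" v] by (simp add: dist_norm mult.commute)
  ultimately show ?thesis using \<xi>(2) by simp
qed

text \<open>A convex positively homogeneous function is the support function of its subdifferential at \<open>0\<close>. Separate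
  \<open>(v, R v - e)\<close> from the epigraph; since the epigraph is a cone, the separating functional is nonnegative on it.\<close>

lemma homogeneous_convex_support:
  fixes R :: "'a::euclidean_space \<Rightarrow> real"
  assumes "convex_on UNIV R" and hom: "\<forall>a>0. \<forall>z. R (a *\<^sub>R z) = a * R z" and "e > 0"
  obtains \<xi> where "\<xi> \<in> subdifferential R 0" "R v - e < \<xi> \<bullet> v"
proof -
  note R0 = homogeneous_at_0[OF hom]
  have "continuous_on UNIV R" using assms(1) by (intro convex_on_continuous) auto
  then have "closed (epigraph UNIV R)"
    unfolding epigraph_def by (auto intro!: closed_Collect_le continuous_intros intro: continuous_on_compose2)
  moreover have "convex (epigraph UNIV R)" using assms(1) by (rule convex_epigraphI)
  moreover have "(v, R v - e) \<notin> epigraph UNIV R" using \<open>e > 0\<close> by (simp add: mem_epigraph)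
  ultimately obtain p b where pb: "p \<bullet> (v, R v - e) < b" "\<forall>x\<in>epigraph UNIV R. b < p \<bullet> x"
    using separating_hyperplane_closed_point by meson
  obtain p1 p2 where p: "p = (p1, p2)" by (cases p)
  have sep: "b < p1 \<bullet> x + p2 * R x" for x
    using pb(2)[rule_format, of "(x, R x)"] by (simp add: p mem_epigraph)
  have b0: "b < 0" using sep[of 0] R0 by simp
  have nonneg: "p1 \<bullet> x + p2 * R x \<ge> 0" for x
  proof (rule ccontr)
    assume neg: "\<not> ?thesis"
    define t where "t = b / (p1 \<bullet> x + p2 * R x)"
    have t: "t > 0" unfolding t_def using neg b0 by (intro divide_neg_neg) auto
    have "p1 \<bullet> (t *\<^sub>R x) + p2 * R (t *\<^sub>R x) = t * (p1 \<bullet> x + p2 * R x)"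
      using hom t by (simp add: algebra_simps)
    also have "\<dots> = b" using neg by (simp add: t_def)
    finally show False using sep[of "t *\<^sub>R x"] by simp
  qed
  have lt: "p1 \<bullet> v + p2 * (R v - e) < 0" using pb(1) b0 by (simp add: p)
  then have "0 < p2 * e" using nonneg[of v] by (simp add: algebra_simps)
  then have p2: "p2 > 0" using \<open>e > 0\<close> by (simp add: zero_less_mult_iff)
  show ?thesis
  proof (rule that[of "- (1 / p2) *\<^sub>R p1"])
    have "- (p1 \<bullet> y) \<le> p2 * R y" for y using nonneg[of y] by linarith
    then show "- (1 / p2) *\<^sub>R p1 \<in> subdifferential R 0"
      using p2 by (simp add: subdifferential_def R0 field_simps)
    show "R v - e < - (1 / p2) *\<^sub>R p1 \<bullet> v"
      using lt p2 by (simp add: field_simps)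
  qed
qed

text \<open>The dissipation density \<open>R v + norm v * \<rho>\<close> is the supremum of \<open>(\<xi> + \<rho> *\<^sub>R e) \<bullet> v\<close> over subgradients \<open>\<xi>\<close> and vectors \<open>e\<close> of the unit
  ball. By continuity a dense set of pairs suffices, so that countably many almost everywhere inequalities can be combined.\<close>

lemma dissipation_le_from_dense:
  fixes R :: "'a::euclidean_space \<Rightarrow> real"
  assumes R: "convex_on UNIV R" "\<forall>a>0. \<forall>z. R (a *\<^sub>R z) = a * R z"
    and D: "subdifferential R 0 \<times> cball 0 1 \<subseteq> closure D"
    and le: "\<And>\<xi> e. (\<xi>, e) \<in> D \<Longrightarrow> (\<xi> + \<rho> *\<^sub>R e) \<bullet> v \<le> m"
  shows "R v + norm v * \<rho> \<le> m"
proof -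
  have "closed {p. (fst p + \<rho> *\<^sub>R snd p) \<bullet> v \<le> m}"
    by (intro closed_Collect_le continuous_intros)
  then have "closure D \<subseteq> {p. (fst p + \<rho> *\<^sub>R snd p) \<bullet> v \<le> m}"
    using le by (intro closure_minimal) auto
  then have le': "(\<xi> + \<rho> *\<^sub>R e) \<bullet> v \<le> m" if "\<xi> \<in> subdifferential R 0" "norm e \<le> 1" for \<xi> e
    using D that by fastforce
  define e where "e = (1 / norm v) *\<^sub>R v"
  have e: "norm e \<le> 1" "e \<bullet> v = norm v"
    by (auto simp: e_def power2_norm_eq_inner[symmetric] power2_eq_square)
  show ?thesis
  proof (rule field_le_epsilon)
    fix \<epsilon> :: real assume "\<epsilon> > 0"
    then obtain \<xi> where \<xi>: "\<xi> \<in> subdifferential R 0" "R v - \<epsilon> < \<xi> \<bullet> v"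
      using homogeneous_convex_support[OF R] by blast
    show "R v + norm v * \<rho> \<le> m + \<epsilon>"
      using le'[OF \<xi>(1) e(1)] \<xi>(2) by (simp add: inner_add_left e(2) mult.commute)
  qed
qed

section \<open>Relaxed solutions on the whole line\<close>

locale rate_independent_system =
  fixes A :: "real^'n^'n" and F R :: "real^'n \<Rightarrow> real" and c :: real
  assumes A: "symmetric_positive_definite A" and F: "C2_function F" "\<forall>z. F z \<ge> 0"
    and R: "convex_on UNIV R" "\<forall>a>0. \<forall>z. R (a *\<^sub>R z) = a * R z"
    and c: "c > 0" and R_coercive: "\<forall>z. c * norm z \<le> R z"
begin

abbreviation "E \<equiv> energy A F"
abbreviation "K \<equiv> subdifferential R 0"

definition "DE z = A *v z + grad F z"

lemma R0: "R 0 = 0" using R(2) by (rule homogeneous_at_0)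

lemma R_nonneg: "R z \<ge> 0"
  using R_coercive c norm_ge_zero[of z] by (meson mult_nonneg_nonneg less_imp_le order_trans)

lemma zero_in_K: "0 \<in> K" using R_nonneg by (simp add: subdifferential_def R0)

lemma K_ne: "K \<noteq> {}" using zero_in_K by blast

lemma continuous_R: "continuous_on UNIV R"
  using R(1) by (intro convex_on_continuous) auto

lemma energy_nonneg: "E z \<ge> 0"
proof -
  have "(A *v z) \<bullet> z \<ge> 0" using A by (cases "z = 0") (auto simp: symmetric_positive_definite_def less_imp_le)
  then show ?thesis using F(2) by (simp add: energy_def)
qed

lemma GDERIV_energy: "GDERIV E z :> DE z"
proof -
  have sym: "(A *v h) \<bullet> z = h \<bullet> (A *v z)" for h
    using A dot_lmul_matrix[of h "transpose A" z] by (simp add: symmetric_positive_definite_def)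
      (metis dot_lmul_matrix vector_transpose_matrix)
  have "((\<lambda>z. A *v z) has_derivative (\<lambda>h. A *v h)) (at z)"
    by (rule bounded_linear_imp_has_derivative) (rule matrix_vector_mul_bounded_linear)
  then have "((\<lambda>z. 1/2 * ((A *v z) \<bullet> z)) has_derivative (\<lambda>h. 1/2 * ((A *v z) \<bullet> h + (A *v h) \<bullet> z))) (at z)"
    by (auto intro!: derivative_eq_intros)
  moreover have "(\<lambda>h. 1/2 * ((A *v z) \<bullet> h + (A *v h) \<bullet> z)) = (\<lambda>h. h \<bullet> (A *v z))"
    by (simp add: sym inner_commute[of "A *v z"])
  ultimately have "GDERIV (\<lambda>z. 1/2 * ((A *v z) \<bullet> z)) z :> A *v z" by (simp add: gderiv_def)
  moreover have "GDERIV F z :> grad F z"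
    using F(1) by (intro differentiable_imp_GDERIV_grad) (auto simp: C2_function_def)
  ultimately show ?thesis unfolding energy_def[abs_def] DE_def by (rule GDERIV_add)
qed

lemma continuous_DE: "continuous_on UNIV DE"
proof -
  have "continuous_on UNIV (grad F)"
    using F(1) by (auto simp: C2_function_def intro!: continuous_at_imp_continuous_on differentiable_imp_continuous_within)
  then show ?thesis
    unfolding DE_def[abs_def]
    by (rule continuous_on_add[OF linear_continuous_on[OF matrix_vector_mul_bounded_linear]])
qed

lemma continuous_E: "continuous_on UNIV E"
  using GDERIV_energy
  by (auto simp: gderiv_def intro!: continuous_at_imp_continuous_on has_derivative_continuous)

text \<open>The residual as a function of the load and the state at a single instant.\<close>

definition \<rho> :: "real^'n \<Rightarrow> real^'n \<Rightarrow> real" where "\<rho> lv z = infdist (lv - DE z) K"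

lemma residual_eq: "residual A F R lh zh s = \<rho> (lh s) (zh s)"
proof -
  have "GDERIV (\<lambda>z. lh s \<bullet> z) (zh s) :> lh s"
    unfolding gderiv_def by (auto intro!: derivative_eq_intros simp: inner_commute)
  then have "GDERIV (load_energy A F lh s) (zh s) :> DE (zh s) - lh s"
    unfolding load_energy_def[abs_def] by (intro GDERIV_diff GDERIV_energy)
  then have "grad (load_energy A F lh s) (zh s) = DE (zh s) - lh s" by (rule grad_eqI)
  then show ?thesis by (simp add: residual_def \<rho>_def)
qed

lemma \<rho>_nonneg: "\<rho> lv z \<ge> 0" by (simp add: \<rho>_def infdist_nonneg)

lemma \<rho>_le: "\<rho> lv z \<le> norm lv + norm (DE z)"
  using infdist_le[OF zero_in_K, of "lv - DE z"] norm_triangle_ineq4[of lv "DE z"]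
  by (simp add: \<rho>_def)

lemma \<rho>_tendsto:
  assumes "(\<lambda>n. lv n) \<longlonglongrightarrow> (lvl :: real^'n)" "(\<lambda>n. z n) \<longlonglongrightarrow> zl"
  shows "(\<lambda>n. \<rho> (lv n) (z n)) \<longlonglongrightarrow> \<rho> lvl zl"
  unfolding \<rho>_def using continuous_DE assms
  by (intro tendsto_infdist tendsto_diff isCont_tendsto_compose[of zl DE]) (auto simp: continuous_on_eq_continuous_at)

lemma \<rho>_measurable:
  assumes "lv \<in> borel_measurable lebesgue" "z \<in> borel_measurable lebesgue"
  shows "(\<lambda>x. \<rho> (lv x) (z x)) \<in> borel_measurable (lebesgue :: real measure)"
proof -
  have "continuous_on UNIV (\<lambda>w. infdist w K)" by (intro continuous_intros)
  from borel_measurable_continuous_on[OF this] borel_measurable_continuous_on[OF continuous_DE assms(2)]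
  show ?thesis unfolding \<rho>_def using assms(1) by (metis (no_types) borel_measurable_diff)
qed

text \<open>A relaxed solution extended constantly to the whole line, with derivatives that vanish outside \<open>(0, S)\<close>. The number \<open>1\<close> in the
  normalization becomes the indicator function of \<open>(0, S)\<close>, and the normalization turns the dissipation in the energy
  identity into this indicator minus \<open>dt\<close>: the identity becomes affine in the derivatives.\<close>

definition extended_solution ::
  "real^'n \<Rightarrow> real \<Rightarrow> real \<Rightarrow> (real \<Rightarrow> real) \<Rightarrow> (real \<Rightarrow> real) \<Rightarrow> (real \<Rightarrow> real^'n) \<Rightarrow> (real \<Rightarrow> real^'n) \<Rightarrow> (real \<Rightarrow> real^'n) \<Rightarrow> bool"
  where "extended_solution z0 T S te dt ze dz le \<longleftrightarrow>
    S > 0 \<and> bounded_primitive 1 te dt \<and> bounded_primitive (1 / c) ze dz \<and> le \<in> borel_measurable lebesgue \<and>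
    (\<forall>x. te x = te (clip 0 S x)) \<and> (\<forall>x. ze x = ze (clip 0 S x)) \<and>
    te 0 = 0 \<and> te S = T \<and> ze 0 = z0 \<and>
    (AE x in lebesgue. 0 \<le> dt x \<and> dt x * \<rho> (le x) (ze x) = 0 \<and>
       dt x + R (dz x) + norm (dz x) * \<rho> (le x) (ze x) = indicator {0<..<S} x) \<and>
    (\<forall>x y. x \<le> y \<longrightarrow> (LINT r:{x..y}|lebesgue. indicator {0<..<S} r - dt r) =
       E (ze x) - E (ze y) + (LINT r:{x..y}|lebesgue. le r \<bullet> dz r))"

text \<open>The normalization bounds the derivatives: \<open>dt\<close> by \<open>1\<close> and, by coercivity of \<open>R\<close>, the norm of \<open>dz\<close> by \<open>1 / c\<close>.\<close>

lemma relaxed_solution_extended: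
  assumes sol: "relaxed_solution A F R z0 T l S th zh lh"
  obtains dt dz where
    "extended_solution z0 T S (\<lambda>x. th (clip 0 S x)) dt (\<lambda>x. zh (clip 0 S x)) dz (\<lambda>x. lh (clip 0 S x))"
proof -
  let ?t = "\<lambda>x. th (clip 0 S x)" and ?z = "\<lambda>x. zh (clip 0 S x)" and ?l = "\<lambda>x. lh (clip 0 S x)"
  let ?r = "\<lambda>x. \<rho> (?l x) (?z x)"
  have S: "S > 0" and BV: "BV_on 0 S lh" using sol by (auto simp: relaxed_solution_def)
  obtain dt0 dz0 where W: "W1inf 0 S th dt0" "W1inf 0 S zh dz0"
    and init: "th 0 = 0" "th S = T" "zh 0 = z0"
    and ae0: "AE s in lebesgue_on {0<..<S}. dt0 s \<ge> 0 \<and> dt0 s * \<rho> (lh s) (zh s) = 0 \<and>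
           dt0 s + R (dz0 s) + norm (dz0 s) * \<rho> (lh s) (zh s) = 1"
    and en: "\<And>s1 s2. s1 \<in> {0..S} \<Longrightarrow> s2 \<in> {0..S} \<Longrightarrow>
           E (zh s2) + (LINT r=s1..s2|lebesgue. (R (dz0 r) + norm (dz0 r) * \<rho> (lh r) (zh r))) =
           E (zh s1) + (LINT r=s1..s2|lebesgue. (lh r \<bullet> dz0 r))"
    using sol unfolding relaxed_solution_def residual_eq by blast
  have "AE s in lebesgue_on {0<..<S}. norm (dt0 s) \<le> 1 \<and> norm (dz0 s) \<le> 1 / c"
    using ae0
  proof eventually_elim
    case (elim s)
    have "norm (dz0 s) * \<rho> (lh s) (zh s) \<ge> 0" using \<rho>_nonneg by simp
    then have "R (dz0 s) \<le> 1" "dt0 s \<le> 1" using elim R_nonneg[of "dz0 s"] by linarith+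
    moreover have "c * norm (dz0 s) \<le> R (dz0 s)" using R_coercive by blast
    ultimately show ?case using elim c by (simp add: field_simps)
  qed
  then have bt: "AE s in lebesgue_on {0<..<S}. norm (dt0 s) \<le> 1" and bz: "AE s in lebesgue_on {0<..<S}. norm (dz0 s) \<le> 1 / c"
    by (auto elim: eventually_mono)
  obtain dt where dt: "bounded_primitive 1 ?t dt" "\<And>x. x \<notin> {0<..<S} \<Longrightarrow> dt x = 0"
    "AE x in lebesgue. x \<in> {0<..<S} \<longrightarrow> dt x = dt0 x"
    using W1inf_primitive[OF W(1) S zero_le_one bt] by blast
  have "0 \<le> 1 / c" using c by simp
  obtain dz where dz: "bounded_primitive (1 / c) ?z dz" "\<And>x. x \<notin> {0<..<S} \<Longrightarrow> dz x = 0"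
    "AE x in lebesgue. x \<in> {0<..<S} \<longrightarrow> dz x = dz0 x"
    using W1inf_primitive[OF W(2) S \<open>0 \<le> 1 / c\<close> bz] by blast
  note tD = bounded_primitiveD[OF dt(1)] and zD = bounded_primitiveD[OF dz(1)]
  obtain V where V: "dominates_increments V ?l" "\<And>x. 0 \<le> V x" "\<And>x. V x \<le> enn2real (variation 0 S lh)"
    using BV_on_dominated[OF BV less_imp_le[OF S]] by blast
  have lm: "?l \<in> borel_measurable lebesgue"
    using dominates_increments_measurable[OF V(1)] by (auto intro: measurable_completion)
  have ae0': "AE x in lebesgue. x \<in> {0<..<S} \<longrightarrow> dt0 x \<ge> 0 \<and> dt0 x * \<rho> (lh x) (zh x) = 0 \<and>
           dt0 x + R (dz0 x) + norm (dz0 x) * \<rho> (lh x) (zh x) = 1"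
    by (rule AE_restrict_space_iff[THEN iffD1, OF _ ae0]) simp
  have ae: "AE x in lebesgue. 0 \<le> dt x \<and> dt x * ?r x = 0 \<and> dt x + R (dz x) + norm (dz x) * ?r x = indicator {0<..<S} x"
    using dt(3) dz(3) ae0'
  proof eventually_elim
    case (elim x)
    then show ?case using dt(2)[of x] dz(2)[of x] by (cases "x \<in> {0<..<S}") (auto simp: R0)
  qed
  define h where "h x = R (dz x) + norm (dz x) * ?r x" for x
  define k where "k x = ?l x \<bullet> dz x" for x
  \<comment> \<open>A representative of the given derivative that is measurable on the whole line.\<close>
  define dz1 where "dz1 x = (if x \<in> {0<..<S} then dz0 x else 0)" for x
  have dz1m: "dz1 \<in> borel_measurable lebesgue"
    unfolding dz1_def[abs_def] using W(2) by (subst borel_measurable_if) (auto simp: W1inf_def Linf_on_def)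
  have dz1: "AE x in lebesgue. dz1 x = dz x"
    using dz(3) by eventually_elim (use dz(2) in \<open>auto simp: dz1_def\<close>)
  have zm: "?z \<in> borel_measurable lebesgue" by (rule continuous_imp_lebesgue_measurable[OF zD(6)])
  note rm = \<rho>_measurable[OF lm zm]
  have Rm: "(\<lambda>x. R (f x)) \<in> borel_measurable lebesgue" if "f \<in> borel_measurable lebesgue" for f :: "real \<Rightarrow> real^'n"
    by (rule borel_measurable_continuous_on[OF continuous_R that])
  have hm: "(\<lambda>x. R (f x) + norm (f x) * ?r x) \<in> borel_measurable lebesgue" if "f \<in> borel_measurable lebesgue" for f
  proof -
    have "(\<lambda>x. norm (f x)) \<in> borel_measurable lebesgue" using that by measurable
    then show ?thesis by (intro borel_measurable_add borel_measurable_times Rm that rm)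
  qed
  have local: "(LINT r:{x..y}|lebesgue. indicator {0<..<S} r - dt r) =
       E (zh x) - E (zh y) + (LINT r:{x..y}|lebesgue. k r)" if xy: "0 \<le> x" "x \<le> y" "y \<le> S" for x y
  proof -
    have "(LINT r=x..y|lebesgue. (R (dz0 r) + norm (dz0 r) * \<rho> (lh r) (zh r))) =
        (LINT r:{x<..<y}|lebesgue. R (dz1 r) + norm (dz1 r) * ?r r)"
      unfolding interval_lebesgue_integral_def using xy
      by (simp, intro set_lebesgue_integral_cong) (auto simp: dz1_def)
    also have "\<dots> = (LINT r:{x<..<y}|lebesgue. indicator {0<..<S} r - dt r)"
    proof (rule set_lebesgue_integral_cong_AE)
      show "AE r\<in>{x<..<y} in lebesgue. R (dz1 r) + norm (dz1 r) * ?r r = indicator {0<..<S} r - dt r"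
        using dz1 ae by eventually_elim auto
    qed (use hm[OF dz1m] tD(1) in \<open>auto intro!: borel_measurable_diff borel_measurable_indicator\<close>)
    finally have 1: "(LINT r=x..y|lebesgue. (R (dz0 r) + norm (dz0 r) * \<rho> (lh r) (zh r))) =
      (LINT r:{x..y}|lebesgue. indicator {0<..<S} r - dt r)" by (simp only: set_integral_Ioo_eq_Icc)
    have "(LINT r=x..y|lebesgue. (lh r \<bullet> dz0 r)) = (LINT r:{x<..<y}|lebesgue. ?l r \<bullet> dz1 r)"
      unfolding interval_lebesgue_integral_def using xy
      by (simp, intro set_lebesgue_integral_cong) (auto simp: dz1_def)
    also have "\<dots> = (LINT r:{x<..<y}|lebesgue. k r)"
    proof (rule set_lebesgue_integral_cong_AE)
      show "AE r\<in>{x<..<y} in lebesgue. ?l r \<bullet> dz1 r = k r"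
        using dz1 by eventually_elim (auto simp: k_def)
    qed (use lm dz1m zD(1) in \<open>auto simp: k_def intro!: borel_measurable_inner\<close>)
    finally have 2: "(LINT r=x..y|lebesgue. (lh r \<bullet> dz0 r)) = (LINT r:{x..y}|lebesgue. k r)"
      by (simp only: set_integral_Ioo_eq_Icc)
    show ?thesis using en[of x y] xy unfolding 1 2 by simp
  qed
  \<comment> \<open>Both integrands vanish outside \<open>(0, S)\<close>, so the energy identity holds on every interval of the line.\<close>
  have gl: "(LINT r:{x..y}|lebesgue. indicator {0<..<S} r - dt r) =
       E (?z x) - E (?z y) + (LINT r:{x..y}|lebesgue. k r)" if "x \<le> y" for x y
    using local[of "clip 0 S x" "clip 0 S y"] clip_mono[OF that, of 0 S] S
      set_integral_clip[of 0 S x y "\<lambda>r. indicator {0<..<S} r - dt r"] set_integral_clip[of 0 S x y k] dt(2) dz(2) that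
    by (simp add: k_def)
  show ?thesis
  proof (rule that[of dt dz])
    show "extended_solution z0 T S ?t dt ?z dz ?l"
      unfolding extended_solution_def
      using S dt(1) dz(1) lm ae gl init by (simp add: k_def)
  qed
qed

text \<open>The lower bound is the Lipschitz bound for \<open>te\<close>. For the upper bound, take the energy identity on \<open>[0, S]\<close>: the work of the
  load is at most its \<open>L\<^sup>1\<close> norm times \<open>1 / c\<close>, and the final energy is nonnegative.\<close>

lemma extended_solution_length:
  assumes "extended_solution z0 T S te dt ze dz le"
    and B: "set_integrable lebesgue {0<..<S} le" "(LINT s:{0<..<S}|lebesgue. norm (le s)) \<le> B"
  shows "T \<le> S" "S \<le> T + E z0 + B / c"
proof -
  have S: "S > 0" and t: "bounded_primitive 1 te dt" and z: "bounded_primitive (1 / c) ze dz"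
    and init: "te 0 = 0" "te S = T" "ze 0 = z0" and lm: "le \<in> borel_measurable lebesgue"
    and en: "(LINT r:{0..S}|lebesgue. indicator {0<..<S} r - dt r) =
       E (ze 0) - E (ze S) + (LINT r:{0..S}|lebesgue. le r \<bullet> dz r)"
    using assms by (auto simp: extended_solution_def)
  note tD = bounded_primitiveD[OF t] and zD = bounded_primitiveD[OF z]
  show "T \<le> S" using tD(5)[of S 0] init S by simp
  have "(LINT r:{0..S}|lebesgue. indicator {0<..<S} r - dt r) =
      (LINT r:{0..S}|lebesgue. indicator {0<..<S} r) - (LINT r:{0..S}|lebesgue. dt r)"
  proof (rule set_integral_diff(2)[OF set_integrable_bounded[where K = 1] tD(7)])
    show "norm (indicat_real {0<..<S} r) \<le> 1" for r by (simp add: indicator_def)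
  qed (auto intro: borel_measurable_indicator)
  also have "(LINT r:{0..S}|lebesgue. indicat_real {0<..<S} r) = S"
    using S unfolding set_integral_Ioo_eq_Icc[symmetric]
    by (simp add: set_lebesgue_integral_def indicator_inter_arith[symmetric])
  also have "(LINT r:{0..S}|lebesgue. dt r) = T"
    using tD(4)[of 0 S] S init by simp
  finally have "S - T = E z0 - E (ze S) + (LINT r:{0..S}|lebesgue. le r \<bullet> dz r)"
    using en init by simp
  moreover have "(LINT r:{0..S}|lebesgue. le r \<bullet> dz r) \<le> B / c"
  proof -
    have int: "integrable lebesgue (\<lambda>x. indicator {0<..<S} x *\<^sub>R le x)"
      using B(1) by (simp add: set_integrable_def)
    have "(LINT r:{0..S}|lebesgue. le r \<bullet> dz r) = (LINT r:{0<..<S}|lebesgue. dz r \<bullet> (indicator {0<..<S} r *\<^sub>R le r))"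
      unfolding set_integral_Ioo_eq_Icc[symmetric] by (rule set_lebesgue_integral_cong) (auto simp: inner_commute)
    also have "\<dots> \<le> 1 / c * (LINT x|lebesgue. norm (indicat_real {0<..<S} x *\<^sub>R le x))"
      using integrable_bounded_inner(2)[OF zD(1,2) int, of "{0<..<S}"] by simp
    also have "(LINT x|lebesgue. norm (indicat_real {0<..<S} x *\<^sub>R le x)) = (LINT s:{0<..<S}|lebesgue. norm (le s))"
      by (simp add: set_lebesgue_integral_def)
    also have "1 / c * \<dots> \<le> 1 / c * B" using B(2) c by (intro mult_left_mono) auto
    finally show ?thesis by simp
  qed
  ultimately show "S \<le> T + E z0 + B / c" using energy_nonneg[of "ze S"] by linarith
qed

lemma extended_solution_bounds:
  assumes "extended_solution z0 T S te dt ze dz le"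
  shows "\<bar>te x\<bar> \<le> S" "norm (ze x) \<le> norm z0 + 1 / c * S"
    "x \<le> y \<Longrightarrow> te x \<le> te y" "\<bar>te y - te x\<bar> \<le> \<bar>y - x\<bar>"
    "dominates_increments (\<lambda>x. 1 * clip 0 S x) te" "dominates_increments (\<lambda>x. 1 / c * clip 0 S x) ze"
proof -
  have S: "S > 0" and t: "bounded_primitive 1 te dt" and z: "bounded_primitive (1 / c) ze dz"
    and tc: "\<And>x. te x = te (clip 0 S x)" and zc: "\<And>x. ze x = ze (clip 0 S x)"
    and init: "te 0 = 0" "ze 0 = z0"
    and ae: "AE x in lebesgue. 0 \<le> dt x \<and> dt x * \<rho> (le x) (ze x) = 0 \<and>
       dt x + R (dz x) + norm (dz x) * \<rho> (le x) (ze x) = indicator {0<..<S} x"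
    using assms unfolding extended_solution_def by blast+
  note tD = bounded_primitiveD[OF t] and zD = bounded_primitiveD[OF z]
  have cl: "\<bar>clip 0 S x\<bar> \<le> S" for x using S by (auto simp: clip_def)
  show "\<bar>te x\<bar> \<le> S" for x using tD(5)[of "clip 0 S x" 0] cl[of x] tc[of x] init by simp
  show "norm (ze x) \<le> norm z0 + 1 / c * S" for x
  proof -
    have "norm (ze x - z0) \<le> 1 / c * \<bar>clip 0 S x\<bar>" using zD(5)[of "clip 0 S x" 0] zc[of x] init by simp
    also have "\<dots> \<le> 1 / c * S" using cl[of x] c by (intro mult_left_mono) auto
    finally show ?thesis using norm_triangle_ineq2[of "ze x" z0] by linarith
  qed
  show "te x \<le> te y" if "x \<le> y" for x y
  proof -
    have "0 \<le> (LINT r:{x..y}|lebesgue. dt r)"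
      unfolding set_lebesgue_integral_def
      by (rule integral_nonneg_AE) (use ae in \<open>eventually_elim, simp\<close>)
    then show ?thesis using tD(4)[OF that] by simp
  qed
  show "\<bar>te y - te x\<bar> \<le> \<bar>y - x\<bar>" for x y using tD(5)[of y x] by simp
  show "dominates_increments (\<lambda>x. 1 * clip 0 S x) te" by (rule dominates_increments_clip[OF t tc])
  show "dominates_increments (\<lambda>x. 1 / c * clip 0 S x) ze" by (rule dominates_increments_clip[OF z zc])
qed

end

section \<open>Points of increase and the coupling of the loads\<close>

text \<open>If every point of increase in \<open>(x, y)\<close> were exceptional, \<open>th\<close> would map this interval into the union of the Lipschitz image
  of a null set and a countable set, although by the intermediate value theorem the image contains an interval.\<close>

lemma good_increase_point:
  fixes th :: "real \<Rightarrow> real"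
  assumes lip: "\<And>x y. x \<in> {0..S} \<Longrightarrow> y \<in> {0..S} \<Longrightarrow> \<bar>th y - th x\<bar> \<le> \<bar>y - x\<bar>"
    and mono: "\<And>x y. 0 \<le> x \<Longrightarrow> x \<le> y \<Longrightarrow> y \<le> S \<Longrightarrow> th x \<le> th y"
    and xy: "0 \<le> x" "x < y" "y \<le> S" "th x < th y"
    and ae: "AE s in lebesgue. s \<in> increase_points S th \<longrightarrow> P s"
  shows "\<exists>s. x < s \<and> s < y \<and> s \<in> increase_points S th \<and> P s"
proof (rule ccontr)
  assume none: "\<not> ?thesis"
  obtain N where N: "\<And>s. s \<notin> N \<Longrightarrow> s \<in> increase_points S th \<Longrightarrow> P s" "N \<in> null_sets lebesgue"
    by (rule AE_E3[OF ae]) auto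
  let ?I = "{x<..<y}"
  \<comment> \<open>Off the points of increase \<open>th\<close> is locally constant, so that its value is attained at a rational.\<close>
  have "th ` ?I \<subseteq> th ` (N \<inter> ?I) \<union> th ` \<rat>"
  proof
    fix v assume "v \<in> th ` ?I"
    then obtain s where s: "s \<in> ?I" "v = th s" by blast
    show "v \<in> th ` (N \<inter> ?I) \<union> th ` \<rat>"
    proof (cases "s \<in> increase_points S th")
      case True
      then have "s \<in> N" using N(1) none s(1) by auto
      then show ?thesis using s by blast
    next
      case False
      then obtain s1 s2 where s12: "s1 \<in> {0..S}" "s2 \<in> {0..S}" "s1 < s" "s < s2" "\<not> th s1 < th s2"
        using s(1) xy unfolding increase_points_def by auto
      obtain q where q: "q \<in> \<rat>" "s < q" "q < s2" using Rats_dense_in_real[OF s12(4)] by blast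
      have "th s1 \<le> th s" "th s \<le> th q" "th q \<le> th s2" using s12 q by (auto intro!: mono)
      then have "th q = v" using s12(5) s(2) by linarith
      then show ?thesis using q(1) by blast
    qed
  qed
  moreover have "negligible (th ` (N \<inter> ?I))"
  proof (rule negligible_locally_Lipschitz_image)
    show "negligible (N \<inter> ?I)"
      using N(2) by (intro negligible_Int) (auto simp: negligible_iff_null_sets)
    show "\<exists>T B. open T \<and> s \<in> T \<and> (\<forall>r\<in>(N \<inter> ?I) \<inter> T. norm (th r - th s) \<le> B * norm (r - s))" if "s \<in> N \<inter> ?I" for s
      using that xy lip by (intro exI[of _ UNIV] exI[of _ 1]) auto
  qed auto
  moreover have "negligible (th ` \<rat>)"
    unfolding negligible_iff_null_sets
    by (intro null_sets_completionI countable_imp_null_set_lborel countable_image countable_rat)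
  ultimately have "negligible (th ` ?I)"
    by (meson negligible_Un negligible_subset)
  moreover have "{th x<..<th y} \<subseteq> th ` ?I"
  proof
    fix v assume v: "v \<in> {th x<..<th y}"
    have "1-lipschitz_on {x..y} th"
      using xy lip by (auto simp: lipschitz_on_def dist_real_def abs_minus_commute)
    then have "continuous_on {x..y} th" by (rule lipschitz_on_continuous_on)
    then obtain s where "x \<le> s" "s \<le> y" "th s = v"
      using IVT'[of th x v y] v xy by auto
    moreover then have "s \<noteq> x" "s \<noteq> y" using v by auto
    ultimately show "v \<in> th ` ?I" by force
  qed
  ultimately have "negligible {th x<..<th y}" by (rule negligible_subset)
  then show False
    using open_not_negligible[of "{th x<..<th y}"] xy(4) by auto
qed

text \<open>A level set contains at most two points of increase, as one between two others would separate their values.\<close>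

lemma countable_increase_fibre: "countable {s \<in> increase_points S th. th s = v}"
proof -
  let ?X = "{s \<in> increase_points S th. th s = v}"
  have mid: False if "s \<in> ?X" "s' \<in> ?X" "s'' \<in> ?X" "s < s'" "s' < s''" for s s' s''
  proof -
    have "s \<in> {0..S}" "s'' \<in> {0..S}" using that by (auto simp: increase_points_def)
    then have "th s < th s''" using that(2,4,5) unfolding increase_points_def by blast
    then show False using that by simp
  qed
  have single: "countable Y" if "\<And>a b. a \<in> Y \<Longrightarrow> b \<in> Y \<Longrightarrow> \<not> a < b" for Y :: "real set"
  proof (cases "Y = {}")
    case False
    then obtain a where "a \<in> Y" by blast
    then have "Y \<subseteq> {a}" using that by (metis insertI1 linorder_cases subsetI)
    then show ?thesis by (rule countable_subset) simp
  qed simp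
  show ?thesis
  proof (cases "?X = {}")
    case True then show ?thesis by (simp only: countable_empty)
  next
    case False
    then obtain x where x: "x \<in> ?X" by blast
    have "countable {s\<in>?X. s < x}" using mid x by (intro single) blast
    moreover have "countable {s\<in>?X. x < s}" using mid x by (intro single) blast
    ultimately have "countable ({s\<in>?X. s < x} \<union> {s\<in>?X. x < s} \<union> {x})" by simp
    then show ?thesis by (rule countable_subset[rotated]) auto
  qed
qed

text \<open>A point of increase \<open>s\<close> of the limit need not be one for the approximating functions. But \<open>th n\<close> eventually grows across every
  neighbourhood of \<open>s\<close>, so there are points of increase of \<open>th n\<close> close to \<open>s\<close> at which the identity holds.
  Off a countable set, both sides can be evaluated along such points in the limit.\<close>

lemma limit_load_identity:
  fixes lh l :: "nat \<Rightarrow> real \<Rightarrow> 'a::real_normed_vector"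
  assumes S: "S \<longlonglongrightarrow> Sl"
    and lip: "\<And>n x y. x \<in> {0..S n} \<Longrightarrow> y \<in> {0..S n} \<Longrightarrow> \<bar>th n y - th n x\<bar> \<le> \<bar>y - x\<bar>"
    and mono: "\<And>n x y. 0 \<le> x \<Longrightarrow> x \<le> y \<Longrightarrow> y \<le> S n \<Longrightarrow> th n x \<le> th n y"
    and range: "\<And>n x. x \<in> {0..S n} \<Longrightarrow> th n x \<in> {0..T}"
    and ae: "\<And>n. AE s in lebesgue. s \<in> increase_points (S n) (th n) \<longrightarrow> lh n s = l n (th n s)"
    and t: "\<And>s. 0 < s \<Longrightarrow> s < Sl \<Longrightarrow> (\<lambda>n. th n s) \<longlonglongrightarrow> tlim s"
    and C: "countable C" "countable C'"
    and lh: "\<And>s e. s \<notin> C \<Longrightarrow> e > 0 \<Longrightarrow> \<exists>d>0. \<forall>\<^sub>F n in sequentially. \<forall>y\<in>{0..S n}. \<bar>y - s\<bar> < d \<longrightarrow> norm (lh n y - lhl s) < e"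
    and l: "\<And>s e. s \<notin> C' \<Longrightarrow> e > 0 \<Longrightarrow> \<exists>d>0. \<forall>\<^sub>F n in sequentially. \<forall>y\<in>{0..T}. \<bar>y - s\<bar> < d \<longrightarrow> norm (l n y - ll s) < e"
  shows "AE s in lebesgue. s \<in> increase_points Sl tlim \<longrightarrow> lhl s = ll (tlim s)"
proof -
  \<comment> \<open>Exceptional points: those of the loads on the arc-length scale, and the points of increase that are
    mapped to exceptional times.\<close>
  define X where "X = C \<union> (\<Union>v\<in>C'. {s \<in> increase_points Sl tlim. tlim s = v})"
  have "countable X" unfolding X_def using C countable_increase_fibre by (intro countable_Un countable_UN) auto
  then have "AE s in lebesgue. s \<notin> X"
    by (intro AE_not_in) (intro null_sets_completionI countable_imp_null_set_lborel)
  then show ?thesis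
  proof eventually_elim
    case (elim s)
    show ?case
    proof (intro impI)
      assume inc: "s \<in> increase_points Sl tlim"
      have sC: "s \<notin> C" and tC: "tlim s \<notin> C'" using elim inc by (auto simp: X_def)
      have s: "0 < s" "s < Sl" using inc by (auto simp: increase_points_def)
      have "norm (lhl s - ll (tlim s)) \<le> e" if "e > 0" for e
      proof -
        obtain d1 where d1: "d1 > 0" "\<forall>\<^sub>F n in sequentially. \<forall>y\<in>{0..S n}. \<bar>y - s\<bar> < d1 \<longrightarrow> norm (lh n y - lhl s) < e / 2"
          using lh[OF sC, of "e / 2"] \<open>e > 0\<close> by auto
        obtain d2 where d2: "d2 > 0" "\<forall>\<^sub>F n in sequentially. \<forall>y\<in>{0..T}. \<bar>y - tlim s\<bar> < d2 \<longrightarrow> norm (l n y - ll (tlim s)) < e / 2"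
          using l[OF tC, of "e / 2"] \<open>e > 0\<close> by auto
        define d where "d = min (min d1 (d2 / 2)) (min s (Sl - s)) / 2"
        have d: "d > 0" "d < d1" "d < d2 / 2" "0 < s - d" "s + d < Sl"
          using d1 d2 s by (auto simp: d_def min_def field_simps)
        have "tlim (s - d) < tlim (s + d)"
          using inc d s unfolding increase_points_def by auto
        then have "0 < tlim (s + d) - tlim (s - d)" by simp
        then have e1: "\<forall>\<^sub>F n in sequentially. 0 < th n (s + d) - th n (s - d)"
          using d s by (intro order_tendstoD(1)[OF tendsto_diff[OF t t]]) auto
        have e2: "\<forall>\<^sub>F n in sequentially. s + d < S n" using d(5) by (rule order_tendstoD(1)[OF S])
        have e3: "\<forall>\<^sub>F n in sequentially. dist (th n s) (tlim s) < d2 / 2"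
          using d2(1) by (intro tendstoD[OF t[OF s]]) simp
        have "\<forall>\<^sub>F n in sequentially. norm (lhl s - ll (tlim s)) \<le> e"
          using d1(2) d2(2) e1 e2 e3
        proof eventually_elim
          case (elim n)
          have "\<exists>r. s - d < r \<and> r < s + d \<and> r \<in> increase_points (S n) (th n) \<and> lh n r = l n (th n r)"
            by (rule good_increase_point[OF lip mono _ _ _ _ ae]) (use elim d in auto)
          then obtain r where r: "s - d < r" "r < s + d" "r \<in> increase_points (S n) (th n)" "lh n r = l n (th n r)"
            by blast
          have rS: "r \<in> {0..S n}" using r elim d by auto
          have "\<bar>r - s\<bar> < d1" using r d by (simp add: abs_less_iff)
          then have "norm (lh n r - lhl s) < e / 2" using elim(1) rS by blast
          moreover have "\<bar>th n r - th n s\<bar> \<le> \<bar>r - s\<bar>" using rS s elim d by (intro lip) auto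
          then have "\<bar>th n r - tlim s\<bar> < d2"
            using elim(5) r d unfolding dist_real_def by linarith
          then have "norm (l n (th n r) - ll (tlim s)) < e / 2" using elim(2) range[OF rS] by blast
          ultimately show ?case
            using norm_triangle_ineq4[of "l n (th n r) - ll (tlim s)" "lh n r - lhl s"] r(4) by simp
        qed
        then show ?thesis by simp
      qed
      then have "norm (lhl s - ll (tlim s)) \<le> 0" by (rule field_le_epsilon) simp
      then show "lhl s = ll (tlim s)" by simp
    qed
  qed
qed

section \<open>Limits of solutions\<close>

context rate_independent_system
begin

text \<open>Write \<open>r\<close> for the residual of the limit. The energy identity passes to the limit and, compared with the chain rule, shows that
  \<open>1 - dtl\<close> equals \<open>(ll - DE zl) \<bullet> dzl\<close> almost everywhere. This is at most the dissipation density \<open>R dzl + norm dzl * r\<close> by the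
  definition of \<open>r\<close>, and the density is at most \<open>1 - dtl\<close> by lower semicontinuity. Equality throughout gives the normalization
  and the energy identity of the limit at once.\<close>

lemma limit_of_extended_solutions:
  fixes S :: "nat \<Rightarrow> real"
  assumes ext: "\<And>n. extended_solution z0 T (S n) (te n) (dt n) (ze n) (dz n) (le n)"
    and S: "S \<longlonglongrightarrow> Sl" "Sl > 0"
    and te: "\<And>x. (\<lambda>n. te n x) \<longlonglongrightarrow> tlim x" and ze: "\<And>x. (\<lambda>n. ze n x) \<longlonglongrightarrow> zl x"
    and le: "\<And>x. (\<lambda>n. le n x) \<longlonglongrightarrow> ll x" "\<And>n x. norm (le n x) \<le> B"
    and zeB: "\<And>n x. norm (ze n x) \<le> B"
  obtains M dtl dzl where "\<And>n. bounded_primitive M (te n) (dt n)" "\<And>n. bounded_primitive M (ze n) (dz n)"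
    "bounded_primitive M tlim dtl" "bounded_primitive M zl dzl"
    "tlim 0 = 0" "tlim Sl = T" "zl 0 = z0"
    "AE x in lebesgue. x \<in> {0<..<Sl} \<longrightarrow> 0 \<le> dtl x \<and> dtl x * \<rho> (ll x) (zl x) = 0 \<and>
       dtl x + R (dzl x) + norm (dzl x) * \<rho> (ll x) (zl x) = 1"
    "\<And>x y. 0 \<le> x \<Longrightarrow> x \<le> y \<Longrightarrow> y \<le> Sl \<Longrightarrow>
       E (zl y) + (LINT r:{x..y}|lebesgue. R (dzl r) + norm (dzl r) * \<rho> (ll r) (zl r)) =
       E (zl x) + (LINT r:{x..y}|lebesgue. ll r \<bullet> dzl r)"
proof -
  have Sn: "S n > 0" and t: "bounded_primitive 1 (te n) (dt n)" and z: "bounded_primitive (1 / c) (ze n) (dz n)"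
    and lm: "le n \<in> borel_measurable lebesgue"
    and init: "te n 0 = 0" "te n (S n) = T" "ze n 0 = z0"
    and ae: "AE x in lebesgue. 0 \<le> dt n x \<and> dt n x * \<rho> (le n x) (ze n x) = 0 \<and>
       dt n x + R (dz n x) + norm (dz n x) * \<rho> (le n x) (ze n x) = indicator {0<..<S n} x"
    and en: "x \<le> y \<Longrightarrow> (LINT r:{x..y}|lebesgue. indicator {0<..<S n} r - dt n r) =
       E (ze n x) - E (ze n y) + (LINT r:{x..y}|lebesgue. le n r \<bullet> dz n r)" for n x y
    using ext[of n] unfolding extended_solution_def by blast+
  \<comment> \<open>\<open>M\<close> exceeds the bounds of all derivatives; the dimension enters because the derivative of the
    limit is built component by component.\<close>
  define M where "M = 1 + 1 / c + 1 / c * DIM(real^'n)"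
  have ic: "1 / c > 0" using c by simp
  then have MK: "1 \<le> M" "1 / c \<le> M" "1 / c * DIM(real^'n) \<le> M" "1 * real DIM(real) \<le> M" by (auto simp: M_def)
  obtain dtl where tlim0: "bounded_primitive (1 * real DIM(real)) tlim dtl"
    by (rule bounded_primitive_pointwise_limit[OF t zero_less_one te])
  obtain dzl where zl0: "bounded_primitive (1 / c * DIM(real^'n)) zl dzl"
    by (rule bounded_primitive_pointwise_limit[OF z ic ze])
  have tM: "bounded_primitive M (te n) (dt n)" and zM: "bounded_primitive M (ze n) (dz n)" for n
    using bounded_primitive_mono[OF t MK(1)] bounded_primitive_mono[OF z MK(2)] by auto
  have tlim: "bounded_primitive M tlim dtl" and zl: "bounded_primitive M zl dzl"
    using bounded_primitive_mono[OF tlim0 MK(4)] bounded_primitive_mono[OF zl0 MK(3)] by auto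
  note tD = bounded_primitiveD[OF tM] and zD = bounded_primitiveD[OF zM]
    and tlD = bounded_primitiveD[OF tlim] and zlD = bounded_primitiveD[OF zl]
  define rn where "rn n x = \<rho> (le n x) (ze n x)" for n x
  define r where "r x = \<rho> (ll x) (zl x)" for x
  have llm: "ll \<in> borel_measurable lebesgue" by (rule borel_measurable_LIMSEQ_metric[OF lm]) (rule le)
  have zem: "ze n \<in> borel_measurable lebesgue" "zl \<in> borel_measurable lebesgue" for n
    by (rule continuous_imp_lebesgue_measurable, rule zD(6) zlD(6))+
  have rnm: "rn n \<in> borel_measurable lebesgue" for n unfolding rn_def[abs_def] by (rule \<rho>_measurable[OF lm zem(1)])
  have rm: "r \<in> borel_measurable lebesgue" unfolding r_def[abs_def] by (rule \<rho>_measurable[OF llm zem(2)])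
  have rlim: "(\<lambda>n. rn n x) \<longlonglongrightarrow> r x" for x unfolding rn_def r_def by (rule \<rho>_tendsto[OF le(1) ze])
  have zlB: "norm (zl x) \<le> B" for x by (rule Lim_bounded[OF tendsto_norm[OF ze]]) (use zeB in auto)
  have llB: "norm (ll x) \<le> B" for x by (rule Lim_bounded[OF tendsto_norm[OF le(1)]]) (use le(2) in auto)
  obtain P where P: "\<And>v. norm v \<le> B \<Longrightarrow> norm (DE v) \<le> P"
  proof -
    have "bounded (DE ` cball 0 B)"
      by (intro compact_imp_bounded compact_continuous_image continuous_on_subset[OF continuous_DE]) auto
    then obtain P where "\<forall>w\<in>DE ` cball 0 B. norm w \<le> P" unfolding bounded_iff by blast
    then show ?thesis by (intro that[of P]) auto
  qed
  have rnB: "\<bar>rn n x\<bar> \<le> B + P" for n x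
    using \<rho>_le[of "le n x" "ze n x"] \<rho>_nonneg[of "le n x" "ze n x"] le(2)[of n x] P[OF zeB[of n x]]
    unfolding rn_def by linarith
  have rB: "\<bar>r x\<bar> \<le> B + P" for x
    using \<rho>_le[of "ll x" "zl x"] \<rho>_nonneg[of "ll x" "zl x"] llB[of x] P[OF zlB[of x]]
    unfolding r_def by linarith
  have r0: "r x \<ge> 0" for x unfolding r_def by (rule \<rho>_nonneg)
  define m where "m n x = indicat_real {0<..<S n} x" for n x
  have mm: "m n \<in> borel_measurable lebesgue" for n unfolding m_def[abs_def] by (intro borel_measurable_indicator) auto
  have mB: "\<bar>m n x\<bar> \<le> 1" for n x by (simp add: m_def indicator_def)
  have mlim: "(\<lambda>n. m n x) \<longlonglongrightarrow> 1" if "x \<in> {0<..<Sl}" for x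
  proof (rule tendsto_eventually)
    have "\<forall>\<^sub>F n in sequentially. x < S n" using that by (intro order_tendstoD(1)[OF S(1)]) simp
    then show "\<forall>\<^sub>F n in sequentially. m n x = 1" by eventually_elim (use that in \<open>simp add: m_def\<close>)
  qed

  \<comment> \<open>Bundling \<open>(1, dt n, dz n)\<close> as the derivative of \<open>(x, te n x, ze n x)\<close> lets one weak-star
    statement serve all the limits below.\<close>
  define w where "w n x = (x, te n x, ze n x)" for n x
  define w' where "w' n x = (1::real, dt n x, dz n x)" for n x
  define wl where "wl x = (x, tlim x, zl x)" for x
  define wl' where "wl' x = (1::real, dtl x, dzl x)" for x
  have w: "bounded_primitive (1 + (M + M)) (w n) (w' n)" for n
    unfolding w_def w'_def by (intro bounded_primitive_Pair bounded_primitive_id tM zM)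
  have wl: "bounded_primitive (1 + (M + M)) wl wl'"
    unfolding wl_def wl'_def by (intro bounded_primitive_Pair bounded_primitive_id tlim zl)
  have "weak_star_Linf 0 Sl w' wl'"
    by (rule weak_star_Linf_primitives[OF w wl]) (auto simp: w_def wl_def intro!: tendsto_intros te ze)
  note weak = weak_star_Linf_times_strong_set[OF this bounded_primitiveD(1)[OF w] bounded_primitiveD(2)[OF w]]
  have conv: "(\<lambda>n. LINT x:X|lebesgue. a n x + dt n x * b n x + dz n x \<bullet> p n x)
      \<longlonglongrightarrow> (LINT x:X|lebesgue. al x + dtl x * bl x + dzl x \<bullet> pl x)"
    if X: "X \<in> sets lebesgue" "X \<subseteq> {0..Sl}"
      and m: "\<And>n. a n \<in> borel_measurable lebesgue" "\<And>n. b n \<in> borel_measurable lebesgue" "\<And>n. p n \<in> borel_measurable lebesgue"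
        "al \<in> borel_measurable lebesgue" "bl \<in> borel_measurable lebesgue" "pl \<in> borel_measurable lebesgue"
      and bd: "\<And>n x. \<bar>a n x\<bar> \<le> Q" "\<And>n x. \<bar>b n x\<bar> \<le> Q" "\<And>n x. norm (p n x) \<le> Q"
      and l: "\<And>x. x \<in> {0<..<Sl} \<Longrightarrow> (\<lambda>n. a n x) \<longlonglongrightarrow> al x" "\<And>x. x \<in> {0<..<Sl} \<Longrightarrow> (\<lambda>n. b n x) \<longlonglongrightarrow> bl x"
        "\<And>x. x \<in> {0<..<Sl} \<Longrightarrow> (\<lambda>n. p n x) \<longlonglongrightarrow> pl x"
    for X a b al bl Q and p :: "nat \<Rightarrow> real \<Rightarrow> real^'n" and pl
  proof -
    have "(\<lambda>n. LINT x:X|lebesgue. w' n x \<bullet> (a n x, b n x, p n x)) \<longlonglongrightarrow> (LINT x:X|lebesgue. wl' x \<bullet> (al x, bl x, pl x))"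
    proof (rule weak[where B = "Q + (Q + Q)"])
      show "norm (a n x, b n x, p n x) \<le> Q + (Q + Q)" for n x
        using bd[of n x] norm_Pair_le[of "a n x" "(b n x, p n x)"] norm_Pair_le[of "b n x" "p n x"] by simp
    qed (use X m l in \<open>auto intro!: borel_measurable_Pair tendsto_intros\<close>)
    then show ?thesis by (simp add: w'_def wl'_def add.assoc)
  qed

  have init_lim: "tlim 0 = 0" "zl 0 = z0"
    using LIMSEQ_unique[OF te[of 0]] LIMSEQ_unique[OF ze[of 0]] by (auto simp: init)
  have "(\<lambda>n. T - te n Sl) \<longlonglongrightarrow> 0"
  proof (rule Lim_null_comparison)
    show "\<forall>\<^sub>F n in sequentially. norm (T - te n Sl) \<le> \<bar>S n - Sl\<bar>"
      using bounded_primitiveD(5)[OF t] init(2) by (intro always_eventually) (metis mult_1)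
    show "(\<lambda>n. \<bar>S n - Sl\<bar>) \<longlonglongrightarrow> 0" using S(1) by (intro tendsto_rabs_zero) (simp add: LIM_zero)
  qed
  moreover have "(\<lambda>n. T - te n Sl) \<longlonglongrightarrow> T - tlim Sl" by (intro tendsto_intros te)
  ultimately have final_lim: "tlim Sl = T" using LIMSEQ_unique by fastforce

  have int: "set_integrable lebesgue {x..y} f" if "f \<in> borel_measurable lebesgue" "\<And>r. \<bar>f r\<bar> \<le> Q" for f :: "real \<Rightarrow> real" and x y Q
    by (rule set_integrable_bounded[where K = Q]) (use that in auto)
  have innerm: "(\<lambda>r. f r \<bullet> g r) \<in> borel_measurable lebesgue"
    if "f \<in> borel_measurable lebesgue" "g \<in> borel_measurable lebesgue" for f g :: "real \<Rightarrow> real^'n"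
    using that by (rule borel_measurable_inner)
  have innerB: "\<bar>f \<bullet> g\<bar> \<le> Q * Q'" if "norm f \<le> Q" "norm g \<le> Q'" for f g :: "real^'n" and Q Q'
    by (rule order_trans[OF Cauchy_Schwarz_ineq2 mult_mono[OF that order_trans[OF norm_ge_zero that(1)] norm_ge_zero]])

  \<comment> \<open>The energy identity is affine in the derivatives, so it passes to the limit; comparing it with
    the chain rule identifies \<open>1 - dtl\<close> almost everywhere with the power \<open>q\<close>.\<close>
  define q where "q x = (ll x - DE (zl x)) \<bullet> dzl x" for x
  have DEm: "(\<lambda>x. DE (zl x)) \<in> borel_measurable lebesgue"
    by (rule borel_measurable_continuous_on[OF continuous_DE zem(2)])
  have qm: "q \<in> borel_measurable lebesgue"
    unfolding q_def[abs_def] by (intro innerm borel_measurable_diff llm DEm zlD(1))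
  have qB: "\<bar>q x\<bar> \<le> (B + P) * M" for x
    unfolding q_def using norm_triangle_ineq4[of "ll x" "DE (zl x)"] llB[of x] P[OF zlB[of x]]
    by (intro innerB zlD(2)) auto
  have dtlB: "\<bar>dtl x\<bar> \<le> M" for x using tlD(2)[of x] by simp
  have limit_energy: "(LINT r:{x..y}|lebesgue. 1 - dtl r) = E (zl x) - E (zl y) + (LINT r:{x..y}|lebesgue. ll r \<bullet> dzl r)"
    if xy: "0 \<le> x" "x \<le> y" "y \<le> Sl" for x y
  proof -
    have i1: "set_integrable lebesgue {x..y} (\<lambda>r. m n r - dt n r)" for n
      by (rule int[where Q = "1 + M"]) (use mm tD(1,2) mB in \<open>auto intro!: borel_measurable_diff order_trans[OF abs_triangle_ineq4] add_mono\<close>)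
    have i2: "set_integrable lebesgue {x..y} (\<lambda>r. le n r \<bullet> dz n r)" for n
      by (rule int[where Q = "B * M"]) (intro innerm lm zD innerB le)+
    have i1': "set_integrable lebesgue {x..y} (\<lambda>r. 1 - dtl r)"
      by (rule int[where Q = "1 + M"]) (use tlD(1) dtlB in \<open>auto intro!: borel_measurable_diff order_trans[OF abs_triangle_ineq4] add_mono\<close>)
    have i2': "set_integrable lebesgue {x..y} (\<lambda>r. ll r \<bullet> dzl r)"
      by (rule int[where Q = "B * M"]) (intro innerm llm zlD innerB llB)+
    have "(LINT r:{x..y}|lebesgue. m n r + dt n r * (-1) + dz n r \<bullet> (- le n r)) = E (ze n x) - E (ze n y)" for n
      using set_integral_diff(2)[OF i1[of n] i2[of n]] en[OF xy(2), of n]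
      by (simp add: m_def inner_commute)
    moreover have "(\<lambda>n. LINT r:{x..y}|lebesgue. m n r + dt n r * (-1) + dz n r \<bullet> (- le n r)) \<longlonglongrightarrow>
        (LINT r:{x..y}|lebesgue. 1 + dtl r * (-1) + dzl r \<bullet> (- ll r))"
    proof (rule conv[where Q = "1 + B"])
      have B0: "0 \<le> B" using le(2) norm_ge_zero order_trans by blast
      show "\<bar>m n s\<bar> \<le> 1 + B" "\<bar>-1\<bar> \<le> 1 + B" for n s using mB[of n s] B0 by linarith+
      show "norm (- le n s) \<le> 1 + B" for n s using le(2)[of n s] unfolding norm_minus_cancel by linarith
    qed (use xy mm lm llm mlim le(1) in \<open>auto intro!: tendsto_intros\<close>)
    moreover have "(\<lambda>n. E (ze n x) - E (ze n y)) \<longlonglongrightarrow> E (zl x) - E (zl y)"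
      using continuous_E by (intro tendsto_diff isCont_tendsto_compose[OF _ ze]) (auto simp: continuous_on_eq_continuous_at)
    ultimately have "(LINT r:{x..y}|lebesgue. 1 + dtl r * (-1) + dzl r \<bullet> (- ll r)) = E (zl x) - E (zl y)"
      using LIMSEQ_unique by simp
    then show ?thesis
      using set_integral_diff(2)[OF i1' i2'] by (simp add: inner_commute)
  qed
  have "AE x in lebesgue. x \<in> {0<..<Sl} \<longrightarrow> (1 - dtl x) - q x = 0"
  proof (rule AE_zero_from_interval_integrals[where K = "(1 + M) + (B + P) * M"])
    show "\<bar>1 - dtl x - q x\<bar> \<le> 1 + M + (B + P) * M" for x using dtlB[of x] qB[of x] by linarith
    fix x y assume xy: "0 \<le> x" "x \<le> y" "y \<le> Sl"
    have i1: "set_integrable lebesgue {x..y} (\<lambda>r. 1 - dtl r)"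
      by (rule int[where Q = "1 + M"]) (use tlD(1) dtlB in \<open>auto intro!: borel_measurable_diff order_trans[OF abs_triangle_ineq4] add_mono\<close>)
    have i2: "set_integrable lebesgue {x..y} (\<lambda>r. ll r \<bullet> dzl r)"
      by (rule int[where Q = "B * M"]) (intro innerm llm zlD innerB llB)+
    have i3: "set_integrable lebesgue {x..y} (\<lambda>r. DE (zl r) \<bullet> dzl r)"
      by (rule int[where Q = "P * M"]) (intro innerm DEm zlD innerB P zlB)+
    have "(LINT r:{x..y}|lebesgue. q r) = (LINT r:{x..y}|lebesgue. ll r \<bullet> dzl r) - (LINT r:{x..y}|lebesgue. DE (zl r) \<bullet> dzl r)"
      unfolding q_def inner_diff_left by (rule set_integral_diff(2)[OF i2 i3])
    also have "\<dots> = (LINT r:{x..y}|lebesgue. 1 - dtl r)"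
      using limit_energy[OF xy] chain_rule_primitive[OF GDERIV_energy continuous_DE zl xy(2)] by simp
    finally show "(LINT r:{x..y}|lebesgue. 1 - dtl r - q r) = 0"
      using set_integral_diff(2)[OF i1 int[OF qm qB]] by simp
  qed (use qm tlD(1) S(2) in \<open>auto intro!: borel_measurable_diff\<close>)
  then have ae_q: "AE x in lebesgue. x \<in> {0<..<Sl} \<longrightarrow> 1 - dtl x = q x"
    by eventually_elim auto

  \<comment> \<open>Lower semicontinuity of the dissipation: each affine minorant \<open>(\<xi> + r x *\<^sub>R e) \<bullet> v\<close> of the
    density is stable under weak-star limits, and countably many of them suffice.\<close>
  obtain D where D: "countable D" "D \<subseteq> K \<times> cball (0 :: real^'n) 1" "K \<times> cball (0 :: real^'n) 1 \<subseteq> closure D"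
    using separable[of "K \<times> cball (0 :: real^'n) 1"] by blast
  have lsc: "AE x in lebesgue. x \<in> {0<..<Sl} \<longrightarrow> 0 \<le> (1 - dtl x) - (\<xi> + r x *\<^sub>R e) \<bullet> dzl x" if d: "(\<xi>, e) \<in> D" for \<xi> e
  proof (rule AE_nonneg_from_set_integrals[where K = "(1 + M) + (norm \<xi> + (B + P)) * M"])
    have \<xi>: "\<xi> \<in> K" and e: "norm e \<le> 1" using d D(2) by auto
    have vB: "norm (\<xi> + s *\<^sub>R e) \<le> norm \<xi> + (B + P)" if "\<bar>s\<bar> \<le> B + P" for s
      using norm_triangle_ineq[of \<xi> "s *\<^sub>R e"] mult_left_mono[OF e abs_ge_zero[of s]] that by simp
    have vm: "(\<lambda>x. \<xi> + s x *\<^sub>R e) \<in> borel_measurable lebesgue" if "s \<in> borel_measurable lebesgue" for s :: "real \<Rightarrow> real"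
      using that by measurable
    show "(\<lambda>x. 1 - dtl x - (\<xi> + r x *\<^sub>R e) \<bullet> dzl x) \<in> borel_measurable lebesgue"
      by (intro borel_measurable_diff innerm vm rm tlD(1) zlD(1)) auto
    show "\<bar>1 - dtl x - (\<xi> + r x *\<^sub>R e) \<bullet> dzl x\<bar> \<le> 1 + M + (norm \<xi> + (B + P)) * M" for x
      using dtlB[of x] innerB[OF vB[OF rB[of x]] zlD(2)[of x]] by linarith
    fix X :: "real set" assume X: "X \<in> sets lebesgue" "X \<subseteq> {0<..<Sl}"
    have pw: "AE x in lebesgue. 0 \<le> m n x + dt n x * (-1) + dz n x \<bullet> (- (\<xi> + rn n x *\<^sub>R e))" for n
      using ae[of n]
    proof eventually_elim
      case (elim x)
      have "\<xi> \<bullet> dz n x \<le> R (dz n x)" using \<xi> by (simp add: subdifferential_def R0)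
      moreover have "e \<bullet> dz n x \<le> norm (dz n x)"
        using norm_cauchy_schwarz[of e "dz n x"] mult_right_mono[OF e norm_ge_zero[of "dz n x"]] by simp
      then have "rn n x * (e \<bullet> dz n x) \<le> rn n x * norm (dz n x)"
        using \<rho>_nonneg by (intro mult_left_mono) (auto simp: rn_def)
      moreover have "dz n x \<bullet> (- (\<xi> + rn n x *\<^sub>R e)) = - (\<xi> \<bullet> dz n x) - rn n x * (e \<bullet> dz n x)"
        by (simp only: inner_commute[of "dz n x"] inner_minus_left inner_add_left inner_scaleR_left minus_add_distrib diff_conv_add_uminus)
      moreover have "dt n x + R (dz n x) + norm (dz n x) * rn n x = m n x"
        using elim by (simp add: m_def rn_def)
      then have "m n x = dt n x + R (dz n x) + rn n x * norm (dz n x)" by (simp only: mult.commute)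
      ultimately show ?case by linarith
    qed
    have "0 \<le> (LINT x:X|lebesgue. m n x + dt n x * (-1) + dz n x \<bullet> (- (\<xi> + rn n x *\<^sub>R e)))" for n
      unfolding set_lebesgue_integral_def
      by (rule integral_nonneg_AE) (use pw[of n] in \<open>eventually_elim, simp\<close>)
    moreover have "(\<lambda>n. LINT x:X|lebesgue. m n x + dt n x * (-1) + dz n x \<bullet> (- (\<xi> + rn n x *\<^sub>R e))) \<longlonglongrightarrow>
        (LINT x:X|lebesgue. 1 + dtl x * (-1) + dzl x \<bullet> (- (\<xi> + r x *\<^sub>R e)))"
    proof (rule conv[where Q = "1 + (norm \<xi> + (B + P))"])
      have BP: "0 \<le> B + P" using rB[of 0] by linarith
      show "\<bar>m n x\<bar> \<le> 1 + (norm \<xi> + (B + P))" "\<bar>-1\<bar> \<le> 1 + (norm \<xi> + (B + P))" for n x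
        using mB[of n x] BP norm_ge_zero[of \<xi>] by linarith+
      show "norm (- (\<xi> + rn n x *\<^sub>R e)) \<le> 1 + (norm \<xi> + (B + P))" for n x
        using vB[OF rnB[of n x]] unfolding norm_minus_cancel by linarith
      show "(\<lambda>x. - (\<xi> + rn n x *\<^sub>R e)) \<in> borel_measurable lebesgue" for n
        by (intro borel_measurable_uminus vm rnm)
      show "(\<lambda>x. - (\<xi> + r x *\<^sub>R e)) \<in> borel_measurable lebesgue"
        by (intro borel_measurable_uminus vm rm)
    qed (use X mm mlim rlim in \<open>auto intro!: tendsto_intros\<close>)
    ultimately have "0 \<le> (LINT x:X|lebesgue. 1 + dtl x * (-1) + dzl x \<bullet> (- (\<xi> + r x *\<^sub>R e)))"
      by (intro LIMSEQ_le_const) auto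
    moreover have "1 + dtl x * (-1) + dzl x \<bullet> (- v) = 1 - dtl x - v \<bullet> dzl x" for x v
      by (simp add: inner_commute)
    ultimately show "0 \<le> (LINT x:X|lebesgue. 1 - dtl x - (\<xi> + r x *\<^sub>R e) \<bullet> dzl x)"
      by (simp only:)
  qed
  have "AE x in lebesgue. \<forall>p\<in>D. x \<in> {0<..<Sl} \<longrightarrow> 0 \<le> (1 - dtl x) - (fst p + r x *\<^sub>R snd p) \<bullet> dzl x"
    using lsc by (intro AE_ball_countable[THEN iffD2, OF D(1)]) auto
  then have ae_le: "AE x in lebesgue. x \<in> {0<..<Sl} \<longrightarrow> R (dzl x) + norm (dzl x) * r x \<le> 1 - dtl x"
  proof eventually_elim
    case (elim x)
    then show ?case by (auto intro!: dissipation_le_from_dense[OF R D(3)])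
  qed
  have ae_eq: "AE x in lebesgue. x \<in> {0<..<Sl} \<longrightarrow> R (dzl x) + norm (dzl x) * r x = 1 - dtl x"
    using ae_le ae_q
  proof eventually_elim
    case (elim x)
    have "q x \<le> R (dzl x) + norm (dzl x) * r x"
      unfolding q_def r_def \<rho>_def by (rule inner_le_dissipation[OF R0 K_ne])
    then show ?case using elim by auto
  qed

  \<comment> \<open>The sign of \<open>dtl\<close> and the complementarity \<open>dtl x * r x = 0\<close> are linear in \<open>dtl\<close>, hence stable too.\<close>
  have nonneg: "AE x in lebesgue. x \<in> {0<..<Sl} \<longrightarrow> 0 \<le> dtl x"
  proof (rule AE_nonneg_from_set_integrals[OF tlD(1)])
    fix X :: "real set" assume X: "X \<in> sets lebesgue" "X \<subseteq> {0<..<Sl}"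
    have "0 \<le> (LINT x:X|lebesgue. 0 + dt n x * 1 + dz n x \<bullet> 0)" for n
      unfolding set_lebesgue_integral_def
      by (rule integral_nonneg_AE) (use ae[of n] in \<open>eventually_elim, simp\<close>)
    moreover have "(\<lambda>n. LINT x:X|lebesgue. 0 + dt n x * 1 + dz n x \<bullet> 0) \<longlonglongrightarrow> (LINT x:X|lebesgue. 0 + dtl x * 1 + dzl x \<bullet> 0)"
      by (rule conv[where Q = 1]) (use X in auto)
    ultimately have "0 \<le> (LINT x:X|lebesgue. 0 + dtl x * 1 + dzl x \<bullet> 0)"
      by (intro LIMSEQ_le_const) auto
    then show "0 \<le> (LINT x:X|lebesgue. dtl x)" by simp
  qed (use dtlB in auto)
  have compl: "AE x in lebesgue. x \<in> {0<..<Sl} \<longrightarrow> dtl x * r x = 0"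
  proof (rule AE_zero_from_set_integrals[where K = "M * (B + P)"])
    show "(\<lambda>x. dtl x * r x) \<in> borel_measurable lebesgue" by (intro borel_measurable_times tlD(1) rm)
    show "\<bar>dtl x * r x\<bar> \<le> M * (B + P)" for x
      using mult_mono[OF dtlB[of x] rB[of x]] order_trans[OF abs_ge_zero dtlB] by (simp add: abs_mult)
    fix X :: "real set" assume X: "X \<in> sets lebesgue" "X \<subseteq> {0<..<Sl}"
    have "(LINT x:X|lebesgue. 0 + dt n x * rn n x + dz n x \<bullet> 0) = integral\<^sup>L lebesgue (\<lambda>x::real. 0)" for n
      unfolding set_lebesgue_integral_def
    proof (rule integral_cong_AE)
      show "(\<lambda>x. indicat_real X x *\<^sub>R (0 + dt n x * rn n x + dz n x \<bullet> 0)) \<in> borel_measurable lebesgue"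
        by (intro borel_measurable_scaleR borel_measurable_add borel_measurable_times borel_measurable_inner
            borel_measurable_indicator borel_measurable_const tD(1) rnm zD(1) X(1))
      show "AE x in lebesgue. indicat_real X x *\<^sub>R (0 + dt n x * rn n x + dz n x \<bullet> 0) = 0"
        using ae[of n] by eventually_elim (simp add: rn_def)
    qed simp
    moreover have "(\<lambda>n. LINT x:X|lebesgue. 0 + dt n x * rn n x + dz n x \<bullet> 0) \<longlonglongrightarrow> (LINT x:X|lebesgue. 0 + dtl x * r x + dzl x \<bullet> 0)"
      by (rule conv[where Q = "B + P"]) (use X rnm rm rnB rlim order_trans[OF abs_ge_zero rB] in auto)
    ultimately show "(LINT x:X|lebesgue. dtl x * r x) = 0"
      by (simp add: LIMSEQ_const_iff)
  qed
  show ?thesis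
  proof (rule that[OF tM zM tlim zl init_lim(1) final_lim init_lim(2)])
    show "AE x in lebesgue. x \<in> {0<..<Sl} \<longrightarrow> 0 \<le> dtl x \<and> dtl x * \<rho> (ll x) (zl x) = 0 \<and>
       dtl x + R (dzl x) + norm (dzl x) * \<rho> (ll x) (zl x) = 1"
      using nonneg compl ae_eq by eventually_elim (auto simp: r_def)
    fix x y :: real assume xy: "0 \<le> x" "x \<le> y" "y \<le> Sl"
    have "(LINT s:{x..y}|lebesgue. R (dzl s) + norm (dzl s) * r s) = (LINT s:{x..y}|lebesgue. 1 - dtl s)"
      unfolding set_integral_Ioo_eq_Icc[symmetric]
    proof (rule set_lebesgue_integral_cong_AE)
      show "AE s\<in>{x<..<y} in lebesgue. R (dzl s) + norm (dzl s) * r s = 1 - dtl s"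
        using ae_eq by eventually_elim (use xy in auto)
      have "(\<lambda>s. norm (dzl s)) \<in> borel_measurable lebesgue" using zlD(1) by measurable
      then show "(\<lambda>s. R (dzl s) + norm (dzl s) * r s) \<in> borel_measurable lebesgue"
        by (intro borel_measurable_add borel_measurable_times borel_measurable_continuous_on[OF continuous_R] zlD(1) rm)
    qed (use tlD(1) in \<open>auto intro: borel_measurable_diff\<close>)
    then show "E (zl y) + (LINT s:{x..y}|lebesgue. R (dzl s) + norm (dzl s) * \<rho> (ll s) (zl s)) =
       E (zl x) + (LINT s:{x..y}|lebesgue. ll s \<bullet> dzl s)"
      using limit_energy[OF xy] by (simp add: r_def)
  qed
qed

end

section \<open>Compactness and stability of relaxed solutions\<close>

theorem theorem3p4:
  fixes A :: "real^'n^'n" and F R :: "real^'n \<Rightarrow> real" and z0 :: "real^'n"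
    and T CF q c C :: real
    and l :: "nat \<Rightarrow> real \<Rightarrow> real^'n"
    and S :: "nat \<Rightarrow> real" and th :: "nat \<Rightarrow> real \<Rightarrow> real"
    and zh lh :: "nat \<Rightarrow> real \<Rightarrow> real^'n"
  assumes "T > 0"
    and "symmetric_positive_definite A"
    and "C2_function F" and "\<forall>z. F z \<ge> 0"
    and "CF > 0" and "q \<ge> 1"
    and "\<forall>z v. norm (hessian F z *v v) \<le> CF * (1 + norm z powr q) * norm v"
    and "\<forall>z. R z \<ge> 0" and "convex_on UNIV R" and "lower_semicontinuous R"
    and "\<forall>a>0. \<forall>z. R (a *\<^sub>R z) = a * R z"
    and "c > 0" and "C > 0" and "\<forall>z. c * norm z \<le> R z \<and> R z \<le> C * norm z"
    and "\<exists>l0. - grad (energy A F) z0 + l0 \<in> subdifferential R 0"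
    and "\<forall>n. BV_on 0 T (l n)"
    and "\<exists>B. \<forall>n. BV_norm 0 T (l n) \<le> B"
    and "\<forall>n. relaxed_solution A F R z0 T (l n) (S n) (th n) (zh n) (lh n)"
    and "\<exists>B. \<forall>n. BV_norm 0 (S n) (lh n) \<le> B"
  shows "\<exists>r Slim thlim zhlim lhlim llim.
     strict_mono (r::nat \<Rightarrow> nat) \<and>
     (\<lambda>n. S (r n)) \<longlonglongrightarrow> Slim \<and>
     weak_star_W1inf 0 Slim (\<lambda>n. const_ext (S (r n)) (zh (r n))) zhlim \<and>
     weak_star_W1inf 0 Slim (\<lambda>n. const_ext (S (r n)) (th (r n))) thlim \<and>
     weak_star_BV 0 Slim (\<lambda>n. const_ext (S (r n)) (lh (r n))) lhlim \<and>
     weak_star_BV 0 T (\<lambda>n. l (r n)) llim \<and>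
     (\<forall>s\<in>{0..Slim}. (\<lambda>n. const_ext (S (r n)) (lh (r n)) s) \<longlonglongrightarrow> lhlim s) \<and>
     (\<forall>t\<in>{0..T}. (\<lambda>n. l (r n) t) \<longlonglongrightarrow> llim t) \<and>
     BV_on 0 T llim \<and>
     relaxed_solution A F R z0 T llim Slim thlim zhlim lhlim"
proof -
  interpret rate_independent_system A F R c
    by unfold_locales (use assms in auto)
  note T = \<open>T > 0\<close>
  obtain B1 where B1: "\<And>n. BV_norm 0 T (l n) \<le> B1" using assms(17) by blast
  obtain B2 where B2: "\<And>n. BV_norm 0 (S n) (lh n) \<le> B2" using assms(19) by blast
  have sol: "relaxed_solution A F R z0 T (l n) (S n) (th n) (zh n) (lh n)" for n using assms(18) by blast
  have S0: "S n > 0" and lhBV: "BV_on 0 (S n) (lh n)"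
    and ident: "AE s in lebesgue. s \<in> increase_points (S n) (th n) \<longrightarrow> lh n s = l n (th n s)" for n
    using sol[of n] unfolding relaxed_solution_def by blast+
  have lBV: "BV_on 0 T (l n)" for n using assms(16) by blast
  define te where "te n x = th n (clip 0 (S n) x)" for n x
  define ze where "ze n x = zh n (clip 0 (S n) x)" for n x
  define le where "le n x = lh n (clip 0 (S n) x)" for n x
  define lc where "lc n x = l n (clip 0 T x)" for n x
  have "\<forall>n. \<exists>dt dz. extended_solution z0 T (S n) (te n) dt (ze n) dz (le n)"
    unfolding te_def ze_def le_def using relaxed_solution_extended[OF sol] by blast
  then obtain dt dz where ext: "\<And>n. extended_solution z0 T (S n) (te n) (dt n) (ze n) (dz n) (le n)"
    by metis

  \<comment> \<open>The lengths \<open>S n\<close> stay between \<open>T\<close> and a constant; this bounds all other quantities.\<close>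
  have lh_int: "set_integrable lebesgue {0<..<S n} (le n)" "(LINT s:{0<..<S n}|lebesgue. norm (le n s)) \<le> B2" for n
  proof -
    have eq: "le n s = lh n s" if "s \<in> {0<..<S n}" for s using that by (simp add: le_def)
    show "set_integrable lebesgue {0<..<S n} (le n)"
      using BV_norm_bounds_values(3)[OF lhBV S0, of 0 n] S0[of n]
      by (subst set_integrable_cong[OF refl refl eq]) auto
    have "(LINT s:{0<..<S n}|lebesgue. norm (le n s)) = (LINT s:{0<..<S n}|lebesgue. norm (lh n s))"
      by (rule set_lebesgue_integral_cong) (auto simp: eq)
    then show "(LINT s:{0<..<S n}|lebesgue. norm (le n s)) \<le> B2"
      using BV_norm_bounds_values(4)[OF lhBV S0, of 0 n] B2[of n] S0[of n] by simp
  qed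
  define Mx where "Mx = T + E z0 + B2 / c"
  have ST: "T \<le> S n" and SM: "S n \<le> Mx" for n
    using extended_solution_length[OF ext lh_int] by (auto simp: Mx_def)
  have BVnn: "0 \<le> BV_norm 0 (S n) (lh n)" "0 \<le> BV_norm 0 T (l n)" for n
    using order_trans[OF enn2real_nonneg BV_norm_bounds_values(2)[OF lhBV S0, of 0 n]]
      order_trans[OF enn2real_nonneg BV_norm_bounds_values(2)[OF lBV T, of 0 n]] S0[of n] T by auto
  have leB: "norm (le n x) \<le> B2 / T + B2" for n x
  proof -
    have "norm (le n x) \<le> BV_norm 0 (S n) (lh n) / (S n - 0) + BV_norm 0 (S n) (lh n)"
      unfolding le_def using S0[of n] by (intro BV_norm_bounds_values(1) lhBV) auto
    also have "\<dots> \<le> B2 / T + B2"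
      using B2[of n] BVnn(1)[of n] ST[of n] T by (intro add_mono frac_le) auto
    finally show ?thesis .
  qed
  have lcB: "norm (lc n x) \<le> B1 / T + B1" for n x
  proof -
    have "norm (lc n x) \<le> BV_norm 0 T (l n) / (T - 0) + BV_norm 0 T (l n)"
      unfolding lc_def using T by (intro BV_norm_bounds_values(1) lBV) auto
    also have "\<dots> \<le> B1 / T + B1" using B1[of n] divide_right_mono[OF B1[of n] less_imp_le[OF T]] by simp
    finally show ?thesis .
  qed
  note eb = extended_solution_bounds[OF ext]
  have zeB: "norm (ze n x) \<le> norm z0 + 1 / c * Mx" for n x
    using eb(2)[of n x] mult_left_mono[OF SM[of n], of "1 / c"] c by simp
  have teB: "norm (te n x) \<le> Mx" for n x using eb(1)[of n x] SM[of n] by simp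

  have "\<forall>n. \<exists>V. dominates_increments V (le n) \<and> (\<forall>x. 0 \<le> V x \<and> V x \<le> B2)"
  proof
    fix n
    obtain V where "dominates_increments V (le n)" "\<And>x. 0 \<le> V x" "\<And>x. V x \<le> enn2real (variation 0 (S n) (lh n))"
      unfolding le_def using BV_on_dominated[OF lhBV less_imp_le[OF S0]] by blast
    moreover have "enn2real (variation 0 (S n) (lh n)) \<le> B2"
      using BV_norm_bounds_values(2)[OF lhBV S0, of 0 n] S0[of n] B2[of n] by simp
    ultimately show "\<exists>V. dominates_increments V (le n) \<and> (\<forall>x. 0 \<le> V x \<and> V x \<le> B2)"
      by (meson order_trans)
  qed
  then obtain V where V: "\<And>n. dominates_increments (V n) (le n)" "\<And>n x. 0 \<le> V n x" "\<And>n x. V n x \<le> B2"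
    by metis
  have "\<forall>n. \<exists>V. dominates_increments V (lc n) \<and> (\<forall>x. 0 \<le> V x \<and> V x \<le> B1)"
  proof
    fix n
    obtain V where "dominates_increments V (lc n)" "\<And>x. 0 \<le> V x" "\<And>x. V x \<le> enn2real (variation 0 T (l n))"
      unfolding lc_def using BV_on_dominated[OF lBV less_imp_le[OF T]] by blast
    moreover have "enn2real (variation 0 T (l n)) \<le> B1"
      using BV_norm_bounds_values(2)[OF lBV T, of 0 n] T B1[of n] by simp
    ultimately show "\<exists>V. dominates_increments V (lc n) \<and> (\<forall>x. 0 \<le> V x \<and> V x \<le> B1)"
      by (meson order_trans)
  qed
  then obtain W where W: "\<And>n. dominates_increments (W n) (lc n)" "\<And>n x. 0 \<le> W n x" "\<And>n x. W n x \<le> B1"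
    by metis

  \<comment> \<open>Helly's theorem is applied once, to the curve of all unknowns together. The first component is
    constant in \<open>x\<close> and yields the convergence of the lengths.\<close>
  define f where "f n x = (S n, te n x, ze n x, le n x, lc n x)" for n x
  define U where "U n x = 0 + (1 * clip 0 (S n) x + (1 / c * clip 0 (S n) x + (V n x + W n x)))" for n x
  have U: "dominates_increments (U n) (f n)" for n
    unfolding U_def f_def by (intro dominates_increments_Pair dominates_increments_const eb V W)
  define M where "M = Mx + (Mx + ((norm z0 + 1 / c * Mx) + ((B2 / T + B2) + (B1 / T + B1))))"
  have nonneg: "0 \<le> Mx" "0 \<le> B2" "0 \<le> B1"
    using T ST[of 0] SM[of 0] order_trans[OF BVnn(1) B2[of 0]] order_trans[OF BVnn(2) B1[of 0]] by auto
  have fM: "norm (f n x) \<le> M" for n x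
    unfolding f_def M_def
    by (intro order_trans[OF norm_Pair_le] add_mono teB zeB leB lcB) (use SM[of n] S0[of n] in simp)
  have UM: "\<bar>U n x\<bar> \<le> M" for n x
  proof -
    have cl: "0 \<le> clip 0 (S n) x" "clip 0 (S n) x \<le> Mx" using S0[of n] SM[of n] by (auto simp: clip_def)
    have "0 \<le> 1 / c * clip 0 (S n) x" "1 / c * clip 0 (S n) x \<le> 1 / c * Mx"
      using cl c by (intro mult_nonneg_nonneg mult_left_mono; simp)+
    moreover have "0 \<le> B2 / T" "0 \<le> B1 / T" using nonneg T by auto
    ultimately show ?thesis
      using cl V(2,3)[of n x] W(2,3)[of n x] nonneg norm_ge_zero[of z0] unfolding U_def M_def by linarith
  qed
  obtain r fl X where r: "strict_mono r" and X: "countable X" and fl: "\<And>x. (\<lambda>n. f (r n) x) \<longlonglongrightarrow> fl x"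
    and unif: "\<And>x e. x \<notin> X \<Longrightarrow> e > 0 \<Longrightarrow>
      \<exists>d>0. \<forall>\<^sub>F n in sequentially. \<forall>y. \<bar>y - x\<bar> < d \<longrightarrow> norm (f (r n) y - fl x) < e"
    by (rule Helly_selection_dominated[of U f M, OF U UM fM]) (rule that)
  define Slim where "Slim = fst (fl 0)"
  define tlim where "tlim x = fst (snd (fl x))" for x
  define zlim where "zlim x = fst (snd (snd (fl x)))" for x
  define llim where "llim x = fst (snd (snd (snd (fl x))))" for x
  define lclim where "lclim x = snd (snd (snd (snd (fl x))))" for x
  have Slim: "(\<lambda>n. S (r n)) \<longlonglongrightarrow> Slim"
    using tendsto_fst[OF fl[of 0]] by (simp add: f_def Slim_def)
  have tlim: "(\<lambda>n. te (r n) x) \<longlonglongrightarrow> tlim x" and zlim: "(\<lambda>n. ze (r n) x) \<longlonglongrightarrow> zlim x"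
    and llim: "(\<lambda>n. le (r n) x) \<longlonglongrightarrow> llim x" and lclim: "(\<lambda>n. lc (r n) x) \<longlonglongrightarrow> lclim x" for x
    using tendsto_fst[OF tendsto_snd[OF fl[of x]]] tendsto_fst[OF tendsto_snd[OF tendsto_snd[OF fl[of x]]]]
      tendsto_fst[OF tendsto_snd[OF tendsto_snd[OF tendsto_snd[OF fl[of x]]]]]
      tendsto_snd[OF tendsto_snd[OF tendsto_snd[OF tendsto_snd[OF fl[of x]]]]]
    by (simp_all add: f_def tlim_def zlim_def llim_def lclim_def)
  have "T \<le> Slim" using ST by (intro LIMSEQ_le_const[OF Slim]) auto
  then have Slim0: "Slim > 0" using T by simp

  define B where "B = (B2 / T + B2) + (norm z0 + 1 / c * Mx)"
  have B: "norm (le n x) \<le> B" "norm (ze n x) \<le> B" for n x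
  proof -
    have "0 \<le> B2 / T" "0 \<le> 1 / c * Mx" using nonneg T c by auto
    then show "norm (le n x) \<le> B" "norm (ze n x) \<le> B"
      using leB[of n x] zeB[of n x] nonneg norm_ge_zero[of z0] unfolding B_def by linarith+
  qed
  obtain L dtl dzl where bp: "\<And>n. bounded_primitive L (te (r n)) (dt (r n))" "\<And>n. bounded_primitive L (ze (r n)) (dz (r n))"
    "bounded_primitive L tlim dtl" "bounded_primitive L zlim dzl"
    and init: "tlim 0 = 0" "tlim Slim = T" "zlim 0 = z0"
    and ae: "AE x in lebesgue. x \<in> {0<..<Slim} \<longrightarrow> 0 \<le> dtl x \<and> dtl x * \<rho> (llim x) (zlim x) = 0 \<and>
       dtl x + R (dzl x) + norm (dzl x) * \<rho> (llim x) (zlim x) = 1"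
    and en: "\<And>x y. 0 \<le> x \<Longrightarrow> x \<le> y \<Longrightarrow> y \<le> Slim \<Longrightarrow>
       E (zlim y) + (LINT r:{x..y}|lebesgue. R (dzl r) + norm (dzl r) * \<rho> (llim r) (zlim r)) =
       E (zlim x) + (LINT r:{x..y}|lebesgue. llim r \<bullet> dzl r)"
    by (rule limit_of_extended_solutions[where S = "\<lambda>n. S (r n)" and te = "\<lambda>n. te (r n)" and dt = "\<lambda>n. dt (r n)"
          and ze = "\<lambda>n. ze (r n)" and dz = "\<lambda>n. dz (r n)" and le = "\<lambda>n. le (r n)",
          OF ext Slim Slim0 tlim zlim llim B]) (rule that)

  have Vd: "V n b - V n a \<le> B2" "W n b - W n a \<le> B1" for n a b
    using V(2)[of n a] V(3)[of n b] W(2)[of n a] W(3)[of n b] by auto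
  have BVl: "BV_on 0 Slim llim"
    by (rule BV_on_pointwise_limit[of "\<lambda>n. V (r n)", OF V(1) Vd(1) llim])
  have BVlc: "BV_on 0 T lclim"
    by (rule BV_on_pointwise_limit[of "\<lambda>n. W (r n)", OF W(1) Vd(2) lclim])

  \<comment> \<open>The identity \<open>lh s = l (th s)\<close> at points of increase survives the limit.\<close>
  have range: "th n x \<in> {0..T}" and thte: "th n x = te n x" if "x \<in> {0..S n}" for n x
  proof -
    show "th n x = te n x" using that by (simp add: te_def)
    moreover have "te n 0 = 0" "te n (S n) = T" using ext[of n] by (auto simp: extended_solution_def)
    ultimately show "th n x \<in> {0..T}" using eb(3)[of 0 x n] eb(3)[of x "S n" n] that by auto
  qed
  have loads: "AE s in lebesgue. s \<in> increase_points Slim tlim \<longrightarrow> llim s = lclim (tlim s)"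
  proof (rule limit_load_identity[OF Slim, where th = "\<lambda>n. th (r n)" and lh = "\<lambda>n. lh (r n)" and l = "\<lambda>n. l (r n)"
        and C = X and C' = X and T = T])
    fix n x y assume "x \<in> {0..S (r n)}" "y \<in> {0..S (r n)}"
    then show "\<bar>th (r n) y - th (r n) x\<bar> \<le> \<bar>y - x\<bar>" using eb(4)[of "r n" y x] thte by simp
  next
    fix n x y assume "0 \<le> x" "x \<le> y" "y \<le> S (r n)"
    then show "th (r n) x \<le> th (r n) y" using eb(3)[of x y "r n"] thte[of x "r n"] thte[of y "r n"] by simp
  next
    fix s assume s: "0 < s" "s < Slim"
    have "\<forall>\<^sub>F n in sequentially. s < S (r n)" using s(2) by (rule order_tendstoD(1)[OF Slim])
    then have "\<forall>\<^sub>F n in sequentially. te (r n) s = th (r n) s"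
      by eventually_elim (use s in \<open>simp add: thte\<close>)
    then show "(\<lambda>n. th (r n) s) \<longlonglongrightarrow> tlim s" by (rule Lim_transform_eventually[OF tlim])
  next
    fix s e :: real assume "s \<notin> X" "e > 0"
    then obtain d where d: "d > 0" "\<forall>\<^sub>F n in sequentially. \<forall>y. \<bar>y - s\<bar> < d \<longrightarrow> norm (f (r n) y - fl s) < e"
      using unif by blast
    have comp: "norm (le n y - llim s) \<le> norm (f n y - fl s)" "norm (lc n y - lclim s) \<le> norm (f n y - fl s)" for n y
    proof -
      let ?p = "f n y - fl s"
      have "norm (fst (snd (snd (snd ?p)))) \<le> norm ?p" "norm (snd (snd (snd (snd ?p)))) \<le> norm ?p"
        by (rule order_trans[OF norm_fst_le_norm] order_trans[OF norm_snd_le_norm] order_refl)+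
      then show "norm (le n y - llim s) \<le> norm (f n y - fl s)" "norm (lc n y - lclim s) \<le> norm (f n y - fl s)"
        by (simp_all add: f_def llim_def lclim_def)
    qed
    have "\<forall>\<^sub>F n in sequentially. \<forall>y\<in>{0..S (r n)}. \<bar>y - s\<bar> < d \<longrightarrow> norm (lh (r n) y - llim s) < e"
      using d(2)
    proof eventually_elim
      case (elim n)
      show ?case
      proof (intro ballI impI)
        fix y assume y: "y \<in> {0..S (r n)}" "\<bar>y - s\<bar> < d"
        then have "norm (le (r n) y - llim s) < e" using elim comp(1) le_less_trans by blast
        then show "norm (lh (r n) y - llim s) < e" using y(1) by (simp add: le_def)
      qed
    qed
    then show "\<exists>d>0. \<forall>\<^sub>F n in sequentially. \<forall>y\<in>{0..S (r n)}. \<bar>y - s\<bar> < d \<longrightarrow> norm (lh (r n) y - llim s) < e"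
      using d(1) by blast
    have "\<forall>\<^sub>F n in sequentially. \<forall>y\<in>{0..T}. \<bar>y - s\<bar> < d \<longrightarrow> norm (l (r n) y - lclim s) < e"
      using d(2)
    proof eventually_elim
      case (elim n)
      show ?case
      proof (intro ballI impI)
        fix y assume y: "y \<in> {0..T}" "\<bar>y - s\<bar> < d"
        then have "norm (lc (r n) y - lclim s) < e" using elim comp(2) le_less_trans by blast
        then show "norm (l (r n) y - lclim s) < e" using y(1) by (simp add: lc_def)
      qed
    qed
    then show "\<exists>d>0. \<forall>\<^sub>F n in sequentially. \<forall>y\<in>{0..T}. \<bar>y - s\<bar> < d \<longrightarrow> norm (l (r n) y - lclim s) < e"
      using d(1) by blast
  qed (use range ident X in auto)

  have limit: "relaxed_solution A F R z0 T lclim Slim tlim zlim llim"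
    unfolding relaxed_solution_def residual_eq
  proof (intro conjI exI[of _ dtl] exI[of _ dzl] ballI)
    show "W1inf 0 Slim tlim dtl" "W1inf 0 Slim zlim dzl"
      using Slim0 by (auto intro!: bounded_primitive_imp_W1inf[OF bp(3)] bounded_primitive_imp_W1inf[OF bp(4)])
    show "AE s in lebesgue_on {0<..<Slim}. 0 \<le> dtl s \<and> dtl s * \<rho> (llim s) (zlim s) = 0 \<and>
        dtl s + R (dzl s) + norm (dzl s) * \<rho> (llim s) (zlim s) = 1"
      by (rule AE_restrict_space_iff[THEN iffD2, OF _ ae]) simp
    fix s1 s2 assume s: "s1 \<in> {0..Slim}" "s2 \<in> {0..Slim}"
    show "E (zlim s2) + (LINT r=s1..s2|lebesgue. (R (dzl r) + norm (dzl r) * \<rho> (llim r) (zlim r))) =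
        E (zlim s1) + (LINT r=s1..s2|lebesgue. (llim r \<bullet> dzl r))"
    proof (cases "s1 \<le> s2")
      case True
      then show ?thesis using en[of s1 s2] s by (simp add: interval_integral_lebesgue_Icc(1))
    next
      case False
      then show ?thesis using en[of s2 s1] s by (simp add: interval_integral_lebesgue_Icc(2))
    qed
  qed (use Slim0 BVl init loads in auto)

  have ce: "const_ext (S n) g x = g (clip 0 (S n) x)" if "x \<ge> 0" for n x and g :: "real \<Rightarrow> 'c"
    using that S0[of n] by (simp add: const_ext_def clip_def)
  have wz: "weak_star_W1inf 0 Slim (\<lambda>n. const_ext (S (r n)) (zh (r n))) zlim"
    by (rule weak_star_W1inf_pointwise[where f = "\<lambda>n. ze (r n)" and g = "\<lambda>n. dz (r n)", OF bp(2,4) zlim B(2)]) (use Slim0 in \<open>auto simp: ce ze_def\<close>)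
  have wt: "weak_star_W1inf 0 Slim (\<lambda>n. const_ext (S (r n)) (th (r n))) tlim"
    by (rule weak_star_W1inf_pointwise[where f = "\<lambda>n. te (r n)" and g = "\<lambda>n. dt (r n)", OF bp(1,3) tlim teB]) (use Slim0 in \<open>auto simp: ce te_def\<close>)
  obtain Vl where Vl: "dominates_increments Vl (\<lambda>x. llim (clip 0 Slim x))"
    by (rule BV_on_dominated[OF BVl less_imp_le[OF Slim0]]) (rule that)
  have "weak_star_BV 0 Slim (\<lambda>n. le (r n)) (\<lambda>x. llim (clip 0 Slim x))"
    by (rule weak_star_BV_pointwise[where V = "\<lambda>n. V (r n)" and f = "\<lambda>n. le (r n)", OF V(1) Vd(1) Vl Slim0 leB]) (use llim in simp)
  then have wl: "weak_star_BV 0 Slim (\<lambda>n. const_ext (S (r n)) (lh (r n))) llim"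
    by (rule weak_star_BV_cong[THEN iffD1, rotated -1]) (auto simp: ce le_def)
  obtain Wl where Wl: "dominates_increments Wl (\<lambda>x. lclim (clip 0 T x))"
    by (rule BV_on_dominated[OF BVlc less_imp_le[OF T]]) (rule that)
  have "weak_star_BV 0 T (\<lambda>n. lc (r n)) (\<lambda>x. lclim (clip 0 T x))"
    by (rule weak_star_BV_pointwise[where V = "\<lambda>n. W (r n)" and f = "\<lambda>n. lc (r n)", OF W(1) Vd(2) Wl T lcB]) (use lclim in simp)
  then have wlc: "weak_star_BV 0 T (\<lambda>n. l (r n)) lclim"
    by (rule weak_star_BV_cong[THEN iffD1, rotated -1]) (auto simp: lc_def)
  have pl: "\<forall>s\<in>{0..Slim}. (\<lambda>n. const_ext (S (r n)) (lh (r n)) s) \<longlonglongrightarrow> llim s"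
    using llim by (simp add: ce le_def)
  have pt: "\<forall>t\<in>{0..T}. (\<lambda>n. l (r n) t) \<longlonglongrightarrow> lclim t"
  proof
    fix t assume "t \<in> {0..T}"
    then show "(\<lambda>n. l (r n) t) \<longlonglongrightarrow> lclim t" using lclim[of t] by (simp add: lc_def)
  qed
  show ?thesis
    by (rule exI[of _ r], rule exI[of _ Slim], rule exI[of _ tlim], rule exI[of _ zlim], rule exI[of _ llim],
        rule exI[of _ lclim], intro conjI r Slim wz wt wl wlc pl pt BVlc limit)
qed

end
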